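(* Let $\nu\in\{0,\tfrac12\}$, and let $N_1,\dots,N_8\in\mathbb{Z}+\nu$ and $a_1,\dots,a_8\in\mathbb{C}$ satisfy $$\sum_{k=1}^8 N_k=4,\qquad \sum_{k=1}^8 a_k=0 .$$ Put $X=\sum_{j=1}^4 a_j$, $L=\sum_{j=1}^4 N_j$ (an integer), and for $j=1,\dots,4$ $$M_j=N_j+1-\tfrac{L}{2},\quad M_{j+4}=N_{j+4}-1+\tfrac{L}{2},\quad s_j=a_j-\tfrac{X}{2},\quad s_{j+4}=a_{j+4}+\tfrac{X}{2}.$$ Let $\mu\in\{0,\tfrac12\}$ be defined by $\mu=\nu$ if $L$ is even and $\mu\neq\nu$ if $L$ is odd (so that $M_k\in\mathbb{Z}+\mu$). Then $$\sum_{N\in\mathbb{Z}+\nu}\int_{C_N}(y^2-N^2)\prod_{k=1}^8 \Big(1+\tfrac{a_k-N_k+(y-N)}{2}\Big)_{N_k-1+N}\Big(1+\tfrac{a_k-N_k-(y-N)}{2}\Big)_{N_k-1-N} dy$$ $$=(-1)^L\prod_{(j,k)\in P}\Big(1+\tfrac{a_j+ a_k-N_j-N_k}{2}\Big)_{N_j+N_k-1}\sum_{M\in\mathbb{Z}+\mu}\int_{C_M}(y^2-M^2)\prod_{k=1}^8 \Big(1+\tfrac{s_k-M_k+(y-M)}{2}\Big)_{M_k-1+M}\Big(1+\tfrac{s_k-M_k-(y-M)}{2}\Big)_{M_k-1-M} dy,$$ where $P=\{(j,k):1\le j<k\le 4\}\cup\{(j,k):5\le j<k\le 8\}$.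
   Context: For $a\in\mathbb{C}$ and $n\in\mathbb{Z}$ the Pochhammer symbol is $(a)_n=\Gamma(a+n)/\Gamma(a)$, i.e. $(a)_0=1$, $(a)_n=a(a+1)\cdots(a+n-1)$ for $n>0$, and $(a)_n=1/\big((a-1)(a-2)\cdots(a+n)\big)$ for $n<0$. All Pochhammer indices occurring are integers, so each integrand is a rational function of $y$. In each integrand, call the factors with $+(y-N)$ (resp. $+(y-M)$) "plus-sign" factors and those with $-(y-N)$ (resp. $-(y-M)$) "minus-sign" factors. The contour $C_N$ (resp. $C_M$) runs from $-\infty$ to $+\infty$, coinciding with the real axis outside a compact set, and separates the poles of the plus-sign factors of the corresponding integrand (lying to its left, i.e. above it) from the poles of the minus-sign factors (lying to its right, i.e. below it); parameters are assumed generic enough that such contours exist. Only finitely many terms of each sum are nonzero. *)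

theory Defs
  imports "HOL-Complex_Analysis.Complex_Analysis"
begin

definition poch :: "complex \<Rightarrow> int \<Rightarrow> complex" where
  "poch a n = (if 0 \<le> n then pochhammer a (nat n)
               else 1 / (\<Prod>i\<in>{1..nat (- n)}. (a - of_nat i)))"

text \<open>Pochhammer symbol whose index is given as a real number that is an integer
  (all indices occurring in the theorem are integers).\<close>
definition pochR :: "complex \<Rightarrow> real \<Rightarrow> complex" where
  "pochR a x = poch a \<lfloor>x\<rfloor>"

definition poch_poles :: "real \<Rightarrow> complex set" where
  "poch_poles x = {b. \<lfloor>x\<rfloor> < 0 \<and> (\<exists>i\<in>{1..nat (- \<lfloor>x\<rfloor>)}. b = of_nat i)}"

definition integrand :: "(nat \<Rightarrow> real) \<Rightarrow> (nat \<Rightarrow> complex) \<Rightarrow> real \<Rightarrow> complex \<Rightarrow> complex" where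
  "integrand Nk a n y = (y^2 - (of_real n)^2) *
     (\<Prod>k\<in>{1..8::nat}.
        pochR (1 + (a k - of_real (Nk k) + (y - of_real n)) / 2) (Nk k - 1 + n) *
        pochR (1 + (a k - of_real (Nk k) - (y - of_real n)) / 2) (Nk k - 1 - n))"

definition plus_poles :: "(nat \<Rightarrow> real) \<Rightarrow> (nat \<Rightarrow> complex) \<Rightarrow> real \<Rightarrow> complex set" where
  "plus_poles Nk a n = {y. \<exists>k\<in>{1..8::nat}.
      1 + (a k - of_real (Nk k) + (y - of_real n)) / 2 \<in> poch_poles (Nk k - 1 + n)}"

definition minus_poles :: "(nat \<Rightarrow> real) \<Rightarrow> (nat \<Rightarrow> complex) \<Rightarrow> real \<Rightarrow> complex set" where
  "minus_poles Nk a n = {y. \<exists>k\<in>{1..8::nat}.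
      1 + (a k - of_real (Nk k) - (y - of_real n)) / 2 \<in> poch_poles (Nk k - 1 - n)}"

definition cseg :: "(real \<Rightarrow> complex) \<Rightarrow> real \<Rightarrow> real \<Rightarrow> complex" where
  "cseg \<gamma> R = (\<lambda>s. \<gamma> ((2 * s - 1) * R))"

text \<open>\<gamma> is a contour from -\<infinity> to +\<infinity> that coincides with the real axis outside a
  compact set, is piecewise smooth, avoids all points of P and Q, and has the points of P
  above (to its left) and the points of Q below (to its right).  Above/below is measured by
  the winding number of the loop formed by the piece of \<gamma> over [-R,R] closed by the upper
  half circle of radius R.\<close>
definition sep_contour :: "(real \<Rightarrow> complex) \<Rightarrow> complex set \<Rightarrow> complex set \<Rightarrow> bool" where
  "sep_contour \<gamma> P Q \<longleftrightarrow>
     (\<exists>R0>0. (\<forall>t. R0 \<le> \<bar>t\<bar> \<longrightarrow> \<gamma> t = of_real t) \<and>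
        (\<forall>R\<ge>R0. valid_path (cseg \<gamma> R)) \<and>
        (\<forall>p\<in>P \<union> Q. p \<notin> range \<gamma>) \<and>
        (\<forall>p\<in>P. \<forall>R\<ge>R0. norm p < R \<longrightarrow>
            winding_number (cseg \<gamma> R +++ part_circlepath 0 R 0 pi) p = 1) \<and>
        (\<forall>p\<in>Q. \<forall>R\<ge>R0. norm p < R \<longrightarrow>
            winding_number (cseg \<gamma> R +++ part_circlepath 0 R 0 pi) p = 0))"

definition cint :: "(complex \<Rightarrow> complex) \<Rightarrow> (real \<Rightarrow> complex) \<Rightarrow> complex" where
  "cint f \<gamma> = Lim at_top (\<lambda>R. contour_integral (cseg \<gamma> R) f)"

definition Lsum :: "(nat \<Rightarrow> real) \<Rightarrow> real" where
  "Lsum Nk = (\<Sum>j\<in>{1..4::nat}. Nk j)"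

definition Mshift :: "(nat \<Rightarrow> real) \<Rightarrow> nat \<Rightarrow> real" where
  "Mshift Nk k = (if k \<le> 4 then Nk k + 1 - Lsum Nk / 2 else Nk k - 1 + Lsum Nk / 2)"

definition sshift :: "(nat \<Rightarrow> complex) \<Rightarrow> nat \<Rightarrow> complex" where
  "sshift a k = (let X = (\<Sum>j\<in>{1..4::nat}. a j) in
                 if k \<le> 4 then a k - X / 2 else a k + X / 2)"

definition pairsP :: "(nat \<times> nat) set" where
  "pairsP = {(j, k). 1 \<le> j \<and> j < k \<and> k \<le> 4} \<union> {(j, k). 5 \<le> j \<and> j < k \<and> k \<le> 8}"

end

theory Submission
  imports Defs "HOL-Library.Landau_Symbols"
begin

text \<open>With \<open>A k = (a k + N k) / 2\<close>, \<open>B k = (a k - N k) / 2\<close>, \<open>w = (y + n) / 2\<close> and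
  \<open>z = (y - n) / 2\<close> the integrand is \<open>4 w z\<close> times the product over \<open>k\<close> of
  \<open>\<Gamma>(A k \<plusminus> w) / \<Gamma>(1 + B k \<plusminus> z)\<close>, and each side of the identity is a finite sum of residues.
  For fixed generic \<open>B\<close> consider it as a function of \<open>N\<close> only. Raising \<open>N i\<close> by one multiplies the
  integrand by \<open>(A i)\<^sup>2 - w\<^sup>2\<close>, which gives a linear relation between any three such shifts; and shifting
  \<open>n\<close> by \<open>1/2\<close> at fixed \<open>z\<close> and symmetrising under \<open>(n, z) \<mapsto> (- n, - z)\<close> gives a second three-term
  relation, involving \<open>N \<plusminus> 1/2\<close>. The reflection of the theorem exchanges or preserves these relations, so
  both sides obey the same recurrences. These connect all index vectors with the two for which
  at most one pole contributes for each \<open>n\<close>, namely \<open>(1/2, \<dots>, 1/2)\<close> and \<open>(3/2, - 1/2, 1/2, \<dots>, 1/2)\<close>.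
  Nongeneric parameters are reached as limits along a curve whose generic points are co-countable.\<close>

section \<open>Residue sums\<close>

text \<open>With \<open>B\<close> and \<open>z\<close> held fixed the denominators \<Gamma>(1 + B k
  \<plusminus> z) never change: for every \<open>N\<close> and \<open>n\<close> the poles stay in
  the one set \<open>lattice B\<close> or in its negative, and shifting \<open>N\<close> or
  \<open>n\<close> only multiplies the integrand by a rational function of w = z + n. At an index
  vector of sum 3 the residue sum thus becomes a linear functional on polynomials in w. It vanishes
  on even polynomials because the residues of each integrand add up to zero, and what both kinds of
  shift leave behind lies in the span of w and w ^ 3; three members of a plane are dependent, hence
  three terms. The two kinds cannot be separated: reflecting a unit shift gives a unit shift when
  the index is in one block of four and a half shift when it is in the other, so a relation for the
  reflected sum may come from the opposite relation for \<open>val\<close>. The obstacle at special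
  parameters is that \<open>lattice B\<close> may meet its negative. The sums are therefore
  rewritten over the actual poles before the limit is taken, and the separating contours themselves
  guarantee that actual plus-poles and minus-poles stay apart.\<close>

definition coset :: "real \<Rightarrow> real set" where
  "coset \<nu> = {n. n - \<nu> \<in> \<int>}"

text \<open>The set \<open>X\<close> is fixed beforehand and may be infinite. Summing over the poles
  of \<open>h\<close> would make the range depend on \<open>h\<close> and obscure linearity.\<close>

definition res_on :: "complex set \<Rightarrow> (complex \<Rightarrow> complex) \<Rightarrow> complex" where
  "res_on X h = (\<Sum>\<^sub>\<infinity>p\<in>X. residue h p)"

definition ressum :: "real \<Rightarrow> complex set \<Rightarrow> (real \<Rightarrow> complex \<Rightarrow> complex) \<Rightarrow> complex" where
  "ressum \<nu> X f = (\<Sum>\<^sub>\<infinity>n\<in>coset \<nu>. res_on X (f n))"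

text \<open>\<open>P\<close> is meant for plus-poles and \<open>Q\<close> for minus-poles; both may
  be larger than the set of true singularities. The decay says that there is no residue at
  infinity.\<close>

definition poles_in :: "complex set \<Rightarrow> complex set \<Rightarrow> (complex \<Rightarrow> complex) \<Rightarrow> bool" where
  "poles_in P Q h \<longleftrightarrow> finite P \<and> finite Q \<and> h holomorphic_on - (P \<union> Q) \<and>
     h \<in> O[at_infinity](\<lambda>z. 1 / z ^ 2)"

text \<open>The last two clauses make the sum over \<open>n\<close> finite: far to the right there
  are no plus-poles, far to the left no minus-poles, and either way the residues in \<open>X\<close>
  add up to zero.\<close>

definition admissible :: "real \<Rightarrow> complex set \<Rightarrow> (real \<Rightarrow> complex \<Rightarrow> complex) \<Rightarrow> bool" where
  "admissible \<nu> X f \<longleftrightarrow> (\<exists>n0. \<forall>n\<in>coset \<nu>. \<exists>P Q. poles_in P Q (f n) \<and>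
      P \<subseteq> X \<and> Q \<subseteq> uminus ` X \<and> (n0 \<le> n \<longrightarrow> P = {}) \<and> (n \<le> - n0 \<longrightarrow> Q = {}))"

lemma mem_uminus_image: "z \<in> uminus ` S \<longleftrightarrow> - z \<in> S" for z :: complex
  by (metis image_iff minus_minus)

lemma coset_uminus:
  assumes "2 * \<nu> \<in> \<int>" "n \<in> coset \<nu>"
  shows "- n \<in> coset \<nu>"
proof -
  have "- n - \<nu> = - (n - \<nu>) - 2 * \<nu>" by simp
  also have "\<dots> \<in> \<int>" using assms unfolding coset_def by (metis Ints_diff Ints_minus mem_Collect_eq)
  finally show ?thesis by (simp add: coset_def)
qed

lemma coset_cong:
  assumes "\<nu> - \<nu>' \<in> \<int>" shows "coset \<nu> = coset \<nu>'"
proof -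
  have "n - \<nu> \<in> \<int> \<longleftrightarrow> n - \<nu>' \<in> \<int>" for n
    using Ints_add[of "n - \<nu>" "\<nu> - \<nu>'"] Ints_diff[of "n - \<nu>'" "\<nu> - \<nu>'"] assms by auto
  thus ?thesis by (simp add: coset_def)
qed

lemma finite_coset_bounded: "finite {n \<in> coset \<nu>. \<bar>n\<bar> < c}"
proof -
  have "{n \<in> coset \<nu>. \<bar>n\<bar> < c} \<subseteq> (\<lambda>i. of_int i + \<nu>) ` {- \<lceil>\<bar>c\<bar> + \<bar>\<nu>\<bar>\<rceil> .. \<lceil>\<bar>c\<bar> + \<bar>\<nu>\<bar>\<rceil>}"
  proof
    fix n assume "n \<in> {n \<in> coset \<nu>. \<bar>n\<bar> < c}"
    then obtain i where i: "n - \<nu> = of_int i" and n: "\<bar>n\<bar> < c"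
      by (auto simp: coset_def elim: Ints_cases)
    have "\<bar>of_int i\<bar> \<le> \<bar>c\<bar> + \<bar>\<nu>\<bar>" using i n by linarith
    hence "real_of_int \<bar>i\<bar> \<le> \<bar>c\<bar> + \<bar>\<nu>\<bar>" by simp
    hence "real_of_int \<bar>i\<bar> \<le> of_int \<lceil>\<bar>c\<bar> + \<bar>\<nu>\<bar>\<rceil>" by linarith
    hence "\<bar>i\<bar> \<le> \<lceil>\<bar>c\<bar> + \<bar>\<nu>\<bar>\<rceil>" by linarith
    thus "n \<in> (\<lambda>i. of_int i + \<nu>) ` {- \<lceil>\<bar>c\<bar> + \<bar>\<nu>\<bar>\<rceil> .. \<lceil>\<bar>c\<bar> + \<bar>\<nu>\<bar>\<rceil>}"
      using i by (intro image_eqI[of _ _ i]) auto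
  qed
  thus ?thesis using finite_subset by blast
qed

lemma poles_in_mono:
  assumes "poles_in P Q h" "finite P'" "finite Q'" "P \<subseteq> P'" "Q \<subseteq> Q'"
  shows "poles_in P' Q' h"
  using assms unfolding poles_in_def by (auto elim: holomorphic_on_subset)

lemma residue_eq_0_off_poles:
  assumes "poles_in P Q h" "p \<notin> P \<union> Q" shows "residue h p = 0"
  using assms unfolding poles_in_def
  by (intro residue_holo[of "- (P \<union> Q)"]) (auto intro: finite_imp_closed)

lemma res_on_eq_sum:
  assumes "poles_in P Q h" "P \<subseteq> X" "X \<inter> Q = {}"
  shows "res_on X h = (\<Sum>p\<in>P. residue h p)"
proof -
  have "res_on X h = infsum (residue h) P"
    unfolding res_on_def
    by (rule infsum_cong_neutral) (use assms residue_eq_0_off_poles[OF assms(1)] in auto)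
  thus ?thesis using assms by (simp add: poles_in_def)
qed

lemma bigo_inverse_square_bound:
  assumes "h \<in> O[at_infinity](\<lambda>z. 1 / z ^ 2)"
  obtains C R where "C > 0" "R > 0" "\<And>z. norm z \<ge> R \<Longrightarrow> norm (h z) \<le> C / norm z ^ 2"
proof -
  obtain C where C: "C > 0" "eventually (\<lambda>z. norm (h z) \<le> C * norm (1 / z ^ 2)) at_infinity"
    using assms by (elim landau_o.bigE)
  then obtain R where R: "\<And>z. norm z \<ge> R \<Longrightarrow> norm (h z) \<le> C * norm (1 / z ^ 2)"
    unfolding eventually_at_infinity by blast
  show ?thesis
    by (rule that[of C "max R 1"]) (use C R in \<open>auto simp: norm_divide norm_power\<close>)
qed

text \<open>The integral over a circle of radius r is 2 pi i times the sum of the residues, and it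
  is at most 2 pi C / r by the decay of \<open>h\<close>; let r grow.\<close>

lemma sum_residues_eq_0:
  assumes "poles_in P Q h"
  shows "(\<Sum>p\<in>P \<union> Q. residue h p) = 0"
proof -
  obtain C R where CR: "C > 0" "R > 0" "\<And>z. norm z \<ge> R \<Longrightarrow> norm (h z) \<le> C / norm z ^ 2"
    using assms bigo_inverse_square_bound unfolding poles_in_def by blast
  define S where "S = P \<union> Q"
  have fin: "finite S" and hol: "h holomorphic_on - S"
    using assms by (auto simp: poles_in_def S_def)
  obtain R1 where R1: "\<And>p. p \<in> S \<Longrightarrow> norm p < R1"
    using finite_imp_bounded[OF fin] unfolding bounded_pos_less by blast
  define s where "s = (\<Sum>p\<in>S. residue h p)"
  have bound: "norm s \<le> C / r" if r: "r > max R (max R1 1)" for r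
  proof -
    have img: "path_image (circlepath 0 r) \<subseteq> - S"
      using r R1 by fastforce
    have int: "h contour_integrable_on (circlepath 0 r)"
      using hol img fin
      by (intro contour_integrable_holomorphic_simple[of h "- S"])
         (auto intro: finite_imp_closed)
    have "contour_integral (circlepath 0 r) h =
            2 * pi * \<i> * (\<Sum>p\<in>S. winding_number (circlepath 0 r) p * residue h p)"
      using fin hol img by (intro Residue_theorem[of UNIV]) (auto simp: Compl_eq_Diff_UNIV)
    also have "(\<Sum>p\<in>S. winding_number (circlepath 0 r) p * residue h p) = s"
      unfolding s_def
    proof (rule sum.cong[OF refl])
      fix p assume "p \<in> S"
      hence "norm (p - 0) < r" using R1[of p] r by simp
      hence "winding_number (circlepath 0 r) p = 1" by (rule winding_number_circlepath)
      thus "winding_number (circlepath 0 r) p * residue h p = residue h p" by simp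
    qed
    finally have eq: "contour_integral (circlepath 0 r) h = 2 * pi * \<i> * s" .
    have "norm (contour_integral (circlepath 0 r) h) \<le> (C / r ^ 2) * (2 * pi * r)"
    proof (rule has_contour_integral_bound_circlepath)
      show "(h has_contour_integral contour_integral (circlepath 0 r) h) (circlepath 0 r)"
        using int by (rule has_contour_integral_integral)
    qed (use CR r in auto)
    also have "\<dots> = 2 * pi * (C / r)" using r by (simp add: power2_eq_square field_simps)
    finally have "2 * pi * norm s \<le> 2 * pi * (C / r)"
      unfolding eq by (simp add: norm_mult)
    thus ?thesis by (rule mult_left_le_imp_le) simp
  qed
  have "norm s \<le> 0"
  proof (rule tendsto_lowerbound)
    show "((\<lambda>r. C / r) \<longlongrightarrow> 0) at_top" by real_asymp
    show "eventually (\<lambda>r. norm s \<le> C / r) at_top"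
      using eventually_gt_at_top[of "max R (max R1 1)"] by eventually_elim (rule bound)
  qed auto
  thus ?thesis by (simp add: s_def S_def)
qed

section \<open>Finiteness, linearity and reflection of residue sums\<close>

context
  fixes X :: "complex set"
  assumes X: "X \<inter> uminus ` X = {}"
begin

lemma admissibleE:
  assumes "admissible \<nu> X f" "n \<in> coset \<nu>"
  obtains P Q where "poles_in P Q (f n)" "P \<subseteq> X" "Q \<subseteq> uminus ` X"
    "res_on X (f n) = (\<Sum>p\<in>P. residue (f n) p)" "P \<inter> Q = {}"
proof -
  obtain P Q where PQ: "poles_in P Q (f n)" "P \<subseteq> X" "Q \<subseteq> uminus ` X"
    using assms unfolding admissible_def by blast
  have "X \<inter> Q = {}" using X PQ by auto
  thus ?thesis using that[of P Q] PQ res_on_eq_sum[of P Q "f n" X] by auto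
qed

text \<open>For large \<open>n\<close> the sum over \<open>P\<close> is empty. For large
  \<open>- n\<close> the set \<open>Q\<close> is empty, and the sum over \<open>P\<close> is then
  the sum of all residues, which is zero.\<close>

lemma res_on_eventually_0:
  assumes "admissible \<nu> X f"
  obtains n0 where "\<And>n. n \<in> coset \<nu> \<Longrightarrow> n0 \<le> \<bar>n\<bar> \<Longrightarrow> res_on X (f n) = 0"
proof -
  obtain n0 where n0: "\<And>n. n \<in> coset \<nu> \<Longrightarrow> \<exists>P Q. poles_in P Q (f n) \<and>
      P \<subseteq> X \<and> Q \<subseteq> uminus ` X \<and> (n0 \<le> n \<longrightarrow> P = {}) \<and> (n \<le> - n0 \<longrightarrow> Q = {})"
    using assms unfolding admissible_def by blast
  show ?thesis
  proof (rule that[of n0])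
    fix n assume n: "n \<in> coset \<nu>" "n0 \<le> \<bar>n\<bar>"
    obtain P Q where PQ: "poles_in P Q (f n)" "P \<subseteq> X" "Q \<subseteq> uminus ` X"
      "n0 \<le> n \<Longrightarrow> P = {}" "n \<le> - n0 \<Longrightarrow> Q = {}"
      using n0[OF n(1)] by blast
    have "X \<inter> Q = {}" using X PQ by auto
    hence "res_on X (f n) = (\<Sum>p\<in>P. residue (f n) p)" using PQ res_on_eq_sum by blast
    also have "\<dots> = 0"
      using n(2) PQ(4,5) sum_residues_eq_0[OF PQ(1)] by (cases "n \<ge> 0") auto
    finally show "res_on X (f n) = 0" .
  qed
qed

lemma ressum_eq_sum:
  assumes "admissible \<nu> X f"
  shows "\<exists>n0. \<forall>c\<ge>n0. ressum \<nu> X f = (\<Sum>n\<in>{n \<in> coset \<nu>. \<bar>n\<bar> < c}. res_on X (f n))"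
proof -
  obtain n0 where n0: "\<And>n. n \<in> coset \<nu> \<Longrightarrow> n0 \<le> \<bar>n\<bar> \<Longrightarrow> res_on X (f n) = 0"
    using res_on_eventually_0[OF assms] by blast
  show ?thesis
  proof (intro exI[of _ n0] allI impI)
    fix c assume "n0 \<le> c"
    hence "ressum \<nu> X f = infsum (\<lambda>n. res_on X (f n)) {n \<in> coset \<nu>. \<bar>n\<bar> < c}"
      unfolding ressum_def by (intro infsum_cong_neutral) (use n0 in force)+
    thus "ressum \<nu> X f = (\<Sum>n\<in>{n \<in> coset \<nu>. \<bar>n\<bar> < c}. res_on X (f n))"
      using finite_coset_bounded by simp
  qed
qed

lemma admissible_lincomb:
  assumes "admissible \<nu> X f" "admissible \<nu> X g"
  shows "admissible \<nu> X (\<lambda>n z. c * f n z + d * g n z)"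
proof -
  obtain n1 where n1: "\<And>n. n \<in> coset \<nu> \<Longrightarrow> \<exists>P Q. poles_in P Q (f n) \<and>
      P \<subseteq> X \<and> Q \<subseteq> uminus ` X \<and> (n1 \<le> n \<longrightarrow> P = {}) \<and> (n \<le> - n1 \<longrightarrow> Q = {})"
    using assms unfolding admissible_def by blast
  obtain n2 where n2: "\<And>n. n \<in> coset \<nu> \<Longrightarrow> \<exists>P Q. poles_in P Q (g n) \<and>
      P \<subseteq> X \<and> Q \<subseteq> uminus ` X \<and> (n2 \<le> n \<longrightarrow> P = {}) \<and> (n \<le> - n2 \<longrightarrow> Q = {})"
    using assms unfolding admissible_def by blast
  show ?thesis unfolding admissible_def
  proof (intro exI[of _ "max n1 n2"] ballI)
    fix n assume n: "n \<in> coset \<nu>"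
    obtain P Q where PQ: "poles_in P Q (f n)" "P \<subseteq> X" "Q \<subseteq> uminus ` X"
      "n1 \<le> n \<longrightarrow> P = {}" "n \<le> - n1 \<longrightarrow> Q = {}" using n1[OF n] by blast
    obtain P' Q' where PQ': "poles_in P' Q' (g n)" "P' \<subseteq> X" "Q' \<subseteq> uminus ` X"
      "n2 \<le> n \<longrightarrow> P' = {}" "n \<le> - n2 \<longrightarrow> Q' = {}" using n2[OF n] by blast
    have "poles_in (P \<union> P') (Q \<union> Q') (\<lambda>z. c * f n z + d * g n z)"
    proof -
      have "f n holomorphic_on - ((P \<union> P') \<union> (Q \<union> Q'))" "g n holomorphic_on - ((P \<union> P') \<union> (Q \<union> Q'))"
        using PQ(1) PQ'(1) unfolding poles_in_def
        by (auto elim!: holomorphic_on_subset)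
      moreover have "(\<lambda>z. c * f n z + d * g n z) \<in> O[at_infinity](\<lambda>z. 1 / z ^ 2)"
        using PQ(1) PQ'(1) unfolding poles_in_def
        by (intro sum_in_bigo) (auto intro: landau_o.big.cmult_in_iff')
      ultimately show ?thesis using PQ(1) PQ'(1) unfolding poles_in_def
        by (auto intro!: holomorphic_intros)
    qed
    thus "\<exists>P Q. poles_in P Q (\<lambda>z. c * f n z + d * g n z) \<and> P \<subseteq> X \<and> Q \<subseteq> uminus ` X \<and>
      (max n1 n2 \<le> n \<longrightarrow> P = {}) \<and> (n \<le> - max n1 n2 \<longrightarrow> Q = {})"
      using PQ PQ' by (intro exI[of _ "P \<union> P'"] exI[of _ "Q \<union> Q'"]) auto
  qed
qed

lemma residue_lincomb:
  assumes "poles_in P Q h1" "poles_in P' Q' h2"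
  shows "residue (\<lambda>z. c * h1 z + d * h2 z) p = c * residue h1 p + d * residue h2 p"
proof -
  define s where "s = - (P \<union> Q \<union> P' \<union> Q' - {p})"
  have "finite (P \<union> Q \<union> P' \<union> Q' - {p})" using assms unfolding poles_in_def by simp
  hence s: "open s" "p \<in> s"
    unfolding s_def by (simp_all only: open_Compl finite_imp_closed) simp
  have h: "h1 holomorphic_on s - {p}" "h2 holomorphic_on s - {p}"
    using assms unfolding s_def poles_in_def by (auto elim!: holomorphic_on_subset)
  show ?thesis
    using residue_add[OF s, of "\<lambda>z. c * h1 z" "\<lambda>z. d * h2 z"] residue_lmul[OF s h(1)]
      residue_lmul[OF s h(2)] h by (simp add: holomorphic_intros)
qed

text \<open>The three functions are compared over common finite pole sets and a common finite range
  of \<open>n\<close>, so that no convergence question arises.\<close>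

lemma ressum_lincomb:
  assumes f: "admissible \<nu> X f" and g: "admissible \<nu> X g"
  shows "ressum \<nu> X (\<lambda>n z. c * f n z + d * g n z) = c * ressum \<nu> X f + d * ressum \<nu> X g"
proof -
  define h where "h = (\<lambda>n z. c * f n z + d * g n z)"
  have h: "admissible \<nu> X h" unfolding h_def by (rule admissible_lincomb[OF f g])
  obtain n1 where n1: "\<forall>b\<ge>n1. ressum \<nu> X f = (\<Sum>n\<in>{n \<in> coset \<nu>. \<bar>n\<bar> < b}. res_on X (f n))"
    using ressum_eq_sum[OF f] by (rule exE)
  obtain n2 where n2: "\<forall>b\<ge>n2. ressum \<nu> X g = (\<Sum>n\<in>{n \<in> coset \<nu>. \<bar>n\<bar> < b}. res_on X (g n))"
    using ressum_eq_sum[OF g] by (rule exE)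
  obtain n3 where n3: "\<forall>b\<ge>n3. ressum \<nu> X h = (\<Sum>n\<in>{n \<in> coset \<nu>. \<bar>n\<bar> < b}. res_on X (h n))"
    using ressum_eq_sum[OF h] by (rule exE)
  have *: "res_on X (h n) = c * res_on X (f n) + d * res_on X (g n)"
    if n: "n \<in> coset \<nu>" for n
  proof -
    obtain P Q where PQ: "poles_in P Q (f n)" "P \<subseteq> X" "Q \<subseteq> uminus ` X"
      by (rule admissibleE[OF f n], rule that)
    obtain P' Q' where PQ': "poles_in P' Q' (g n)" "P' \<subseteq> X" "Q' \<subseteq> uminus ` X"
      by (rule admissibleE[OF g n], rule that)
    obtain P'' Q'' where PQ'': "poles_in P'' Q'' (h n)" "P'' \<subseteq> X" "Q'' \<subseteq> uminus ` X"
      by (rule admissibleE[OF h n], rule that)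
    define P0 where "P0 = P \<union> P' \<union> P''"
    define Q0 where "Q0 = Q \<union> Q' \<union> Q''"
    have fin: "finite P0" "finite Q0" and sub: "P0 \<subseteq> X" "X \<inter> Q0 = {}"
      using PQ PQ' PQ'' X by (auto simp: P0_def Q0_def poles_in_def)
    have a: "poles_in P0 Q0 (f n)" "poles_in P0 Q0 (g n)" "poles_in P0 Q0 (h n)"
      using PQ(1) PQ'(1) PQ''(1) fin
      by (auto elim!: poles_in_mono simp: P0_def Q0_def)
    have "residue (h n) p = c * residue (f n) p + d * residue (g n) p" for p
      unfolding h_def by (rule residue_lincomb[OF a(1,2)])
    thus ?thesis
      unfolding res_on_eq_sum[OF a(1) sub] res_on_eq_sum[OF a(2) sub] res_on_eq_sum[OF a(3) sub] by (simp add: sum.distrib sum_distrib_left)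
  qed
  define b where "b = max n1 (max n2 n3)"
  have "ressum \<nu> X h = c * ressum \<nu> X f + d * ressum \<nu> X g"
    using n1[rule_format, of b] n2[rule_format, of b] n3[rule_format, of b] * by (simp add: b_def sum.distrib sum_distrib_left)
  thus ?thesis by (simp add: h_def)
qed

text \<open>The sign is the derivative of z \<mapsto> - z. This map carries the circle around
  \<open>- p\<close> to the circle around \<open>p\<close>, with the same orientation but started
  half a turn later.\<close>

lemma residue_reflect:
  assumes "poles_in P Q h"
  shows "residue (\<lambda>z. h (- z)) p = - residue h (- p)"
proof -
  define s where "s = - (uminus ` (P \<union> Q) - {p})"
  have "finite (uminus ` (P \<union> Q) - {p})" using assms unfolding poles_in_def by simp
  hence "open s" "p \<in> s"
    unfolding s_def by (simp_all only: open_Compl finite_imp_closed) simp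
  then obtain r where r: "r > 0" "cball p r \<subseteq> s" by (auto simp: open_contains_cball)
  have "finite (P \<union> Q - {- p})" using assms unfolding poles_in_def by simp
  hence opn: "open (- (P \<union> Q - {- p}))" by (intro open_Compl finite_imp_closed)
  have 1: "(h has_contour_integral (2 * pi * \<i> * residue h (- p))) (circlepath (- p) r)"
  proof (rule base_residue)
    show "h holomorphic_on - (P \<union> Q - {-p}) - {- p}"
      using assms by (auto simp: poles_in_def elim: holomorphic_on_subset)
    show "cball (- p) r \<subseteq> - (P \<union> Q - {-p})"
    proof
      fix x assume "x \<in> cball (- p) r"
      hence "dist (-p) x \<le> r" by simp
      hence "norm (p + x) \<le> r" by (simp add: dist_norm norm_minus_commute add.commute)
      hence "- x \<in> cball p r" by (simp add: dist_norm)
      hence "- x \<in> s" using r by auto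
      thus "x \<in> - (P \<union> Q - {-p})" unfolding s_def by (auto simp: mem_uminus_image)
    qed
  qed (use opn r in auto)
  have 2: "((\<lambda>z. h (- z)) has_contour_integral (2 * pi * \<i> * residue (\<lambda>z. h (- z)) p)) (circlepath p r)"
  proof (rule base_residue)
    have "(h \<circ> uminus) holomorphic_on s - {p}"
      by (rule holomorphic_on_compose_gen[of _ _ _ "- (P \<union> Q)"])
         (use assms in \<open>auto simp: poles_in_def s_def mem_uminus_image intro!: holomorphic_intros\<close>)
    thus "(\<lambda>z. h (- z)) holomorphic_on s - {p}" by (simp add: o_def)
  qed (use \<open>open s\<close> r in auto)
  have "((\<lambda>z. h (- z)) has_contour_integral - (2 * pi * \<i> * residue h (- p))) (uminus \<circ> circlepath (- p) r)"
    using has_contour_integral_negatepath[OF valid_path_circlepath, of "\<lambda>z. h (- z)"] 1 by simp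
  also have "uminus \<circ> circlepath (- p) r = shiftpath (1/2) (circlepath p r)"
  proof
    fix t :: real
    have "exp (2 * complex_of_real pi * \<i> * of_real (1/2 + t)) = - exp (2 * complex_of_real pi * \<i> * of_real t)"
      "exp (2 * complex_of_real pi * \<i> * of_real (1/2 + t - 1)) = - exp (2 * complex_of_real pi * \<i> * of_real t)"
      by (simp_all add: ring_distribs exp_add exp_diff)
    thus "(uminus \<circ> circlepath (- p) r) t = shiftpath (1/2) (circlepath p r) t"
      by (simp only: circlepath shiftpath_def o_apply if_distrib) simp
  qed
  finally have "((\<lambda>z. h (- z)) has_contour_integral - (2 * pi * \<i> * residue h (- p))) (circlepath p r)"
    by (subst (asm) has_contour_integral_shiftpath_eq) auto
  from has_contour_integral_unique[OF this 2]
  have "2 * pi * \<i> * residue (\<lambda>z. h (- z)) p = 2 * pi * \<i> * (- residue h (- p))" by simp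
  thus ?thesis by (subst (asm) mult_cancel_left) simp
qed

text \<open>Two signs cancel: reflection turns the sum over \<open>P\<close> into minus the sum over
  \<open>Q\<close>, and the latter is minus the sum over \<open>P\<close> because all residues add
  up to zero.\<close>

lemma res_on_reflect:
  assumes "poles_in P Q h" "P \<subseteq> X" "Q \<subseteq> uminus ` X"
  shows "res_on X (\<lambda>z. h (- z)) = res_on X h"
proof -
  have PQ: "P \<inter> Q = {}" "X \<inter> Q = {}" using X assms by auto
  have fin: "finite P" "finite Q" using assms(1) by (auto simp: poles_in_def)
  have "res_on X (\<lambda>z. h (- z)) = infsum (\<lambda>p. - residue h (- p)) X"
    unfolding res_on_def by (intro infsum_cong residue_reflect[OF assms(1)])
  also have "\<dots> = infsum (\<lambda>p. - residue h (- p)) (uminus ` Q)"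
  proof (rule infsum_cong_neutral)
    fix p assume "p \<in> X - uminus ` Q"
    hence "- p \<notin> P \<union> Q" using X assms(2) by (auto simp: mem_uminus_image)
    thus "- residue h (- p) = 0" using residue_eq_0_off_poles[OF assms(1)] by simp
  qed (use assms in auto)
  also have "\<dots> = - (\<Sum>q\<in>Q. residue h q)"
    using fin by (simp add: sum.reindex sum_negf)
  also have "\<dots> = (\<Sum>p\<in>P. residue h p)"
    using sum_residues_eq_0[OF assms(1)] fin PQ by (simp add: sum.union_disjoint add_eq_0_iff)
  also have "\<dots> = res_on X h" using res_on_eq_sum[OF assms(1,2)] PQ by simp
  finally show ?thesis .
qed

lemma ressum_reflect:
  assumes nu: "2 * \<nu> \<in> \<int>" and f: "admissible \<nu> X f"
  shows "ressum \<nu> X (\<lambda>n z. f (- n) (- z)) = ressum \<nu> X f"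
proof -
  have "ressum \<nu> X (\<lambda>n z. f (- n) (- z)) = infsum (\<lambda>n. res_on X (f (- n))) (coset \<nu>)"
    unfolding ressum_def
  proof (rule infsum_cong)
    fix n assume n: "n \<in> coset \<nu>"
    show "res_on X (\<lambda>z. f (- n) (- z)) = res_on X (f (- n))"
      using admissibleE[OF f coset_uminus[OF nu n]] res_on_reflect by metis
  qed
  also have "\<dots> = ressum \<nu> X f" unfolding ressum_def
    by (rule infsum_reindex_bij_witness[where i = uminus and j = uminus])
       (use coset_uminus[OF nu] in auto)
  finally show ?thesis .
qed

end

lemma ressum_shift_half:
  "ressum \<nu> X (\<lambda>n. f (n + 1/2)) = ressum (\<nu> + 1/2) X f"
  unfolding ressum_def
  by (rule infsum_reindex_bij_witness[where i = "\<lambda>n. n - 1/2" and j = "\<lambda>n. n + 1/2"])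
     (auto simp: coset_def algebra_simps)

text \<open>A residue sees only a punctured neighbourhood, so agreement off the lattice is enough.
  At the poles themselves the shift identities may fail, since there a division by zero yields
  0.\<close>

lemma ressum_cong:
  assumes X: "\<And>p. eventually (\<lambda>z. z \<notin> X \<union> uminus ` X) (at p)"
    and eq: "\<And>n z. n \<in> coset \<nu> \<Longrightarrow> z \<notin> X \<union> uminus ` X \<Longrightarrow> f n z = g n z"
  shows "ressum \<nu> X f = ressum \<nu> X g"
  unfolding ressum_def res_on_def
proof (intro infsum_cong residue_cong refl)
  fix n p assume "n \<in> coset \<nu>"
  show "\<forall>\<^sub>F z in at p. f n z = g n z"
    using X[of p] by eventually_elim (use eq \<open>n \<in> coset \<nu>\<close> in auto)
qed

section \<open>The summand\<close>

text \<open>\<open>gq b m\<close> stands for \<open>\<Gamma>(b + m) / \<Gamma>(1 + b)\<close>.\<close>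

definition gq :: "complex \<Rightarrow> real \<Rightarrow> complex" where
  "gq b m = pochR (1 + b) (m - 1)"

text \<open>The factor w = z + n of the integrand is left out and supplied later as a polynomial in
  w. The factor \<open>z\<close> makes \<open>kern\<close> odd under (n, z) \<mapsto> (- n, -
  z).\<close>

definition kern :: "(nat \<Rightarrow> complex) \<Rightarrow> (nat \<Rightarrow> real) \<Rightarrow> real \<Rightarrow> complex \<Rightarrow> complex" where
  "kern B N n z = z * (\<Prod>k\<in>{1..8}. gq (B k + z) (N k + n) * gq (B k - z) (N k - n))"

text \<open>Constant coefficient vectors have to be exempt: in the application the sum of
  \<open>B\<close> is the rational number -2.\<close>

definition generic :: "(nat \<Rightarrow> complex) \<Rightarrow> bool" where
  "generic B \<longleftrightarrow> (\<forall>c::nat \<Rightarrow> int. (\<exists>i\<in>{1..8}. \<exists>j\<in>{1..8}. c i \<noteq> c j) \<longrightarrow>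
     (\<Sum>k\<in>{1..8}. of_int (c k) * B k) \<notin> \<rat>)"

text \<open>A set that holds the plus-poles for all \<open>N\<close> and \<open>n\<close> at once,
  so that kernels with different indices can be added under one residue sum.\<close>

definition lattice :: "(nat \<Rightarrow> complex) \<Rightarrow> complex set" where
  "lattice B = {z. \<exists>k\<in>{1..8}. z + B k \<in> \<int>}"

section \<open>Shift relations, poles and growth of the quotients \<open>gq\<close>\<close>

lemma poch_neg: "k \<le> 0 \<Longrightarrow> poch a k = 1 / (\<Prod>i\<in>{1..nat (- k)}. (a - of_nat i))"
  by (cases "k = 0") (auto simp: poch_def)

text \<open>In the excluded case with \<open>k < 0\<close>, \<open>poch a k\<close> is a division by
  zero, hence 0, while \<open>poch a (k + 1)\<close> need not vanish.\<close>

lemma poch_add_1: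
  assumes "a + of_int k \<noteq> 0"
  shows "poch a (k + 1) = (a + of_int k) * poch a k"
proof (cases "k \<ge> 0")
  case True
  hence "nat (k + 1) = Suc (nat k)" by simp
  thus ?thesis using True by (simp add: poch_def pochhammer_Suc)
next
  case False
  define m where "m = nat (- (k + 1))"
  have m: "nat (- k) = Suc m" "nat (- (k + 1)) = m" "k = - of_nat (Suc m)" using False by (auto simp: m_def)
  have "(\<Prod>i\<in>{1..Suc m}. a - of_nat i) = (\<Prod>i\<in>{1..m}. a - of_nat i) * (a - of_nat (Suc m))"
    by (simp add: prod.nat_ivl_Suc')
  moreover have "a - of_nat (Suc m) = a + of_int k" by (simp add: m(3))
  ultimately have p: "(\<Prod>i\<in>{1..Suc m}. a - of_nat i) = (\<Prod>i\<in>{1..m}. a - of_nat i) * (a + of_int k)"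
    by simp
  have "poch a k = 1 / (\<Prod>i\<in>{1..Suc m}. a - of_nat i)" "poch a (k + 1) = 1 / (\<Prod>i\<in>{1..m}. a - of_nat i)"
    using False poch_neg[of k a] poch_neg[of "k + 1" a] unfolding m(1,2) by simp_all
  thus ?thesis using assms unfolding p by simp
qed

lemma gq_step:
  assumes "m \<in> \<int>" "b + of_real m \<noteq> 0"
  shows "gq b (m + 1) = (b + of_real m) * gq b m"
proof -
  from assms(1) obtain k where k: "m = of_int k" by (elim Ints_cases)
  have "\<lfloor>m + 1 - 1\<rfloor> = (k - 1) + 1" "\<lfloor>m - 1\<rfloor> = k - 1" by (simp_all add: k)
  thus ?thesis using poch_add_1[of "1 + b" "k - 1"] assms(2)
    unfolding gq_def pochR_def by (simp add: k algebra_simps)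
qed

lemma gq_back:
  assumes "m \<in> \<int>" "b + of_real m - 1 \<noteq> 0"
  shows "gq b m = (b + of_real m - 1) * gq b (m - 1)"
  using gq_step[of "m - 1" b] assms by (simp add: algebra_simps)

lemma gq_0: "gq b 0 = 1 / b"
proof -
  have "\<lfloor>0 - 1 :: real\<rfloor> = - 1" unfolding floor_eq_iff by simp
  thus ?thesis unfolding gq_def pochR_def poch_def by simp
qed

lemma gq_1: "gq b 1 = 1"
  by (simp add: gq_def pochR_def poch_def)

definition gpoles :: "complex \<Rightarrow> real \<Rightarrow> complex set" where
  "gpoles b m = (\<lambda>i. of_nat i - 1 - b) ` {1..nat (- \<lfloor>m - 1\<rfloor>)}"

lemma finite_gpoles [simp]: "finite (gpoles b m)"
  by (simp add: gpoles_def)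

lemma gpoles_empty: "m \<ge> 1 \<Longrightarrow> gpoles b m = {}"
  by (simp add: gpoles_def)

lemma gpoles_Ints: "z \<in> gpoles b m \<Longrightarrow> z + b \<in> \<int>"
  by (auto simp: gpoles_def)

lemma gq_holomorphic: "(\<lambda>z. gq (b + z) m) holomorphic_on - gpoles b m"
proof (cases "\<lfloor>m - 1\<rfloor> \<ge> 0")
  case True
  thus ?thesis unfolding gq_def pochR_def poch_def
    by (auto simp: pochhammer_prod intro!: holomorphic_intros)
next
  case False
  have "(\<lambda>z. 1 / (\<Prod>i\<in>{1..nat (- \<lfloor>m - 1\<rfloor>)}. (1 + (b + z) - of_nat i))) holomorphic_on - gpoles b m"
  proof (intro holomorphic_intros)
    fix z assume "z \<in> - gpoles b m"
    thus "(\<Prod>i\<in>{1..nat (- \<lfloor>m - 1\<rfloor>)}. (1 + (b + z) - of_nat i)) \<noteq> 0"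
      by (auto simp: gpoles_def image_iff algebra_simps)
  qed
  thus ?thesis using False unfolding gq_def pochR_def poch_def by simp
qed

lemma gq_holomorphic_minus: "(\<lambda>z. gq (b - z) m) holomorphic_on - (uminus ` gpoles b m)"
proof -
  have "((\<lambda>z. gq (b + z) m) \<circ> uminus) holomorphic_on - (uminus ` gpoles b m)"
    by (rule holomorphic_on_compose_gen[OF _ gq_holomorphic])
       (auto simp: mem_uminus_image intro!: holomorphic_intros)
  thus ?thesis by (simp add: o_def)
qed

lemma bigtheta_linear:
  fixes b s :: complex assumes "s \<noteq> 0"
  shows "(\<lambda>z. b + s * z) \<in> \<Theta>[at_infinity](\<lambda>z. z)"
proof -
  have "(\<lambda>_. b) \<in> o[at_infinity](\<lambda>z::complex. z)"
  proof (rule landau_o.smallI)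
    fix c :: real assume "c > 0"
    have "eventually (\<lambda>z::complex. norm z \<ge> norm b / c) at_infinity"
      by (auto simp: eventually_at_infinity)
    thus "eventually (\<lambda>z. norm b \<le> c * norm (z::complex)) at_infinity"
      by eventually_elim (use \<open>c > 0\<close> in \<open>simp add: field_simps\<close>)
  qed
  hence "(\<lambda>_. b) \<in> o[at_infinity](\<lambda>z. s * z)" using assms by simp
  hence "\<Theta>[at_infinity](\<lambda>z. b + s * z) = \<Theta>[at_infinity](\<lambda>z. s * z)"
    by (rule landau_theta.plus_absorb1)
  hence "(\<lambda>z. b + s * z) \<in> \<Theta>[at_infinity](\<lambda>z. s * z)"
    using bigtheta_refl[of "\<lambda>z. b + s * z" at_infinity] by (simp only:)
  thus ?thesis using assms by simp
qed

lemma bigtheta_prod_linear: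
  fixes c :: "'b \<Rightarrow> complex"
  assumes "s \<noteq> 0" "finite I"
  shows "(\<lambda>z. \<Prod>i\<in>I. (c i + s * z)) \<in> \<Theta>[at_infinity](\<lambda>z. z ^ card I)"
  using assms(2)
proof induction
  case (insert i I)
  have "(\<lambda>z. (c i + s * z) * (\<Prod>i\<in>I. (c i + s * z))) \<in> \<Theta>[at_infinity](\<lambda>z. z * z ^ card I)"
    by (intro landau_theta.mult insert.IH bigtheta_linear assms(1))
  thus ?case using insert by simp
qed auto

lemma bigtheta_gq:
  fixes s :: complex assumes "s \<noteq> 0" "m \<in> \<int>"
  shows "(\<lambda>z. gq (b + s * z) m) \<in> \<Theta>[at_infinity](\<lambda>z. z powi (\<lfloor>m\<rfloor> - 1))"
proof -
  from assms(2) obtain k where k: "m = of_int k" by (elim Ints_cases)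
  have fl: "\<lfloor>m - 1\<rfloor> = k - 1" "\<lfloor>m\<rfloor> = k" by (simp_all add: k)
  show ?thesis
  proof (cases "k - 1 \<ge> 0")
    case True
    have "(\<lambda>z. \<Prod>i\<in>{0..<nat (k - 1)}. ((1 + b + of_nat i) + s * z)) \<in> \<Theta>[at_infinity](\<lambda>z. z ^ nat (k - 1))"
      using bigtheta_prod_linear[OF assms(1), of "{0..<nat (k - 1)}"] by simp
    thus ?thesis using True
      by (simp add: gq_def pochR_def poch_def fl pochhammer_prod power_int_def add_ac)
  next
    case False
    have "(\<lambda>z. inverse (\<Prod>i\<in>{1..nat (1 - k)}. ((1 + b - of_nat i) + s * z))) \<in>
            \<Theta>[at_infinity](\<lambda>z. inverse (z ^ nat (1 - k)))"
      unfolding bigtheta_inverse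
      using bigtheta_prod_linear[OF assms(1), of "{1..nat (1 - k)}"] by simp
    thus ?thesis using False
      by (simp add: gq_def pochR_def poch_def fl power_int_def power_inverse algebra_simps divide_inverse)
  qed
qed


section \<open>Generic parameters and the lattice of poles\<close>

lemma generic_lincomb:
  assumes "generic B" "i \<in> {1..8}" "j \<in> {1..8}" "c i \<noteq> (c j :: int)"
  shows "(\<Sum>k\<in>{1..8}. of_int (c k) * B k) \<notin> \<rat>"
  using assms unfolding generic_def by blast

lemma sum_indicator:
  fixes B :: "nat \<Rightarrow> complex" assumes "i \<in> {1..8}"
  shows "(\<Sum>k\<in>{1..8}. of_int (if k = i then 1 else 0) * B k) = B i"
proof -
  have "(\<Sum>k\<in>{1..8}. of_int (if k = i then 1 else 0) * B k) = (\<Sum>k\<in>{1..8}. if k = i then B k else 0)"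
    by (intro sum.cong) auto
  thus ?thesis using assms by simp
qed

lemma generic_sum2:
  assumes "generic B" "i \<in> {1..8}" "j \<in> {1..8}"
  shows "B i + B j \<notin> \<rat>"
proof -
  define c :: "nat \<Rightarrow> int" where "c = (\<lambda>k. (if k = i then 1 else 0) + (if k = j then 1 else 0))"
  \<comment> \<open>Some index outside \<open>{i, j}\<close> has coefficient 0, so \<open>c\<close>
    is not constant; this covers \<open>i = j\<close> as well, where the coefficient at
    \<open>i\<close> is 2.\<close>
  have "(1 \<noteq> i \<and> 1 \<noteq> j) \<or> (2 \<noteq> i \<and> 2 \<noteq> j) \<or> (3 \<noteq> i \<and> 3 \<noteq> j)" by presburger
  hence "1 \<in> {1..8} - {i, j} \<or> 2 \<in> {1..8} - {i, j} \<or> 3 \<in> {1..8} - {i, j}" by simp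
  then obtain l where l: "l \<in> {1..8} - {i, j}" by blast
  have "(\<Sum>k\<in>{1..8}. of_int (c k) * B k) = B i + B j"
    unfolding c_def using assms by (simp only: of_int_add of_int_diff distrib_right sum.distrib sum_indicator)
  thus ?thesis using generic_lincomb[OF assms(1,2), of l c] l by (auto simp: c_def)
qed

lemma generic_diff:
  assumes "generic B" "i \<in> {1..8}" "j \<in> {1..8}" "i \<noteq> j"
  shows "B i - B j \<notin> \<rat>"
proof -
  define c :: "nat \<Rightarrow> int" where "c = (\<lambda>k. (if k = i then 1 else 0) - (if k = j then 1 else 0))"
  have "(\<Sum>k\<in>{1..8}. of_int (c k) * B k) = B i - B j"
    unfolding c_def using assms by (simp only: of_int_add of_int_diff left_diff_distrib sum_subtractf sum_indicator)
  thus ?thesis using generic_lincomb[OF assms(1-3), of c] assms(4) by (auto simp: c_def)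
qed

text \<open>If z + B k and - z + B l were both integers, so would be their sum B k + B l, against
  genericity.\<close>

lemma lattice_disjoint:
  assumes "generic B"
  shows "lattice B \<inter> uminus ` lattice B = {}"
proof -
  have False if z: "z \<in> lattice B" "- z \<in> lattice B" for z
  proof -
    obtain k where k: "k \<in> {1..8}" "z + B k \<in> \<int>" using z(1) by (auto simp: lattice_def)
    obtain l where l: "l \<in> {1..8}" "- z + B l \<in> \<int>" using z(2) by (auto simp: lattice_def)
    note kl = k l
    have "(z + B k) + (- z + B l) \<in> \<int>" by (rule Ints_add[OF kl(2) kl(4)])
    hence "B k + B l \<in> \<int>" by (simp add: algebra_simps)
    thus False using generic_sum2[OF assms kl(1,3)] Ints_subset_Rats by blast
  qed
  thus ?thesis by (auto simp: mem_uminus_image)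
qed

lemma eventually_not_Ints: "eventually (\<lambda>z::complex. z \<notin> \<int>) (at p)"
proof -
  have "open (- (\<int> - {p}))" by (intro open_Compl closed_subset_Ints) auto
  thus ?thesis unfolding eventually_at_topological by (intro exI[of _ "- (\<int> - {p})"]) auto
qed

lemma eventually_not_Ints_affine:
  assumes "s \<noteq> 0" shows "eventually (\<lambda>z::complex. s * z + c \<notin> \<int>) (at p)"
proof -
  have "filterlim (\<lambda>z. s * z + c) (at (s * p + c)) (at p)"
    unfolding filterlim_at using assms
    by (auto intro!: tendsto_intros simp: eventually_at_filter)
  thus ?thesis using eventually_not_Ints[of "s * p + c"]
    unfolding filterlim_iff by blast
qed

lemma lattice_discrete: "eventually (\<lambda>z. z \<notin> lattice B \<union> uminus ` lattice B) (at p)"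
proof -
  have "eventually (\<lambda>z. \<forall>k\<in>{1..8}. 1 * z + B k \<notin> \<int> \<and> (- 1) * z + B k \<notin> \<int>) (at p)"
    by (intro eventually_ball_finite ballI eventually_conj eventually_not_Ints_affine) auto
  thus ?thesis by eventually_elim (auto simp: lattice_def mem_uminus_image)
qed

section \<open>Poles and decay of the kernel\<close>

lemma bigo_poly:
  fixes p :: "complex poly" assumes "degree p \<le> d"
  shows "(\<lambda>z. poly p (z + c)) \<in> O[at_infinity](\<lambda>z. z ^ d)"
proof -
  have "(\<lambda>z. (z + c) ^ i) \<in> O[at_infinity](\<lambda>z. z ^ d)" if "i \<le> d" for i
  proof -
    have "(\<lambda>z. c + 1 * z) \<in> O[at_infinity](\<lambda>z. z)"
      by (rule bigthetaD1[OF bigtheta_linear]) simp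
    hence "(\<lambda>z. (c + 1 * z) ^ i) \<in> O[at_infinity](\<lambda>z. z ^ i)" by (rule landau_o.big_power)
    also have "(\<lambda>z::complex. z ^ i) \<in> O[at_infinity](\<lambda>z. z ^ d)"
    proof (rule bigoI[of _ 1])
      have "eventually (\<lambda>z::complex. norm z \<ge> 1) at_infinity" by (auto simp: eventually_at_infinity)
      thus "eventually (\<lambda>z::complex. norm (z ^ i) \<le> 1 * norm (z ^ d)) at_infinity"
        by eventually_elim (use that in \<open>simp add: norm_power power_increasing\<close>)
    qed
    finally show ?thesis by (simp add: add.commute)
  qed
  thus ?thesis unfolding poly_altdef using assms
    by (intro big_sum_in_bigo landau_o.big.cmult_in_iff'[THEN iffD2]) auto
qed


text \<open>The condition on \<open>2 * \<nu>\<close> is what makes N k + n, and not only N k - n,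
  an integer for \<open>n\<close> in the coset.\<close>

definition on_coset :: "real \<Rightarrow> (nat \<Rightarrow> real) \<Rightarrow> bool" where
  "on_coset \<nu> N \<longleftrightarrow> 2 * \<nu> \<in> \<int> \<and> (\<forall>k\<in>{1..8}. N k - \<nu> \<in> \<int>)"

lemma on_coset_index:
  assumes "on_coset \<nu> N" "n \<in> coset \<nu>" "k \<in> {1..8}"
  shows "N k + n \<in> \<int>" "N k - n \<in> \<int>"
proof -
  have "(N k - \<nu>) + (n - \<nu>) + 2 * \<nu> \<in> \<int>" "(N k - \<nu>) - (n - \<nu>) \<in> \<int>"
    using assms unfolding on_coset_def coset_def by (blast intro: Ints_add Ints_diff)+
  thus "N k + n \<in> \<int>" "N k - n \<in> \<int>" by (simp_all add: algebra_simps)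
qed

text \<open>These are the plus-poles. The minus-poles of \<open>kern B N n\<close> are the negatives
  of \<open>kern_poles B N (- n)\<close>.\<close>

definition kern_poles :: "(nat \<Rightarrow> complex) \<Rightarrow> (nat \<Rightarrow> real) \<Rightarrow> real \<Rightarrow> complex set" where
  "kern_poles B N n = (\<Union>k\<in>{1..8}. gpoles (B k) (N k + n))"

lemma finite_kern_poles [simp]: "finite (kern_poles B N n)"
  by (simp add: kern_poles_def)

lemma kern_poles_empty: "(\<And>k. k \<in> {1..8} \<Longrightarrow> 1 \<le> N k + n) \<Longrightarrow> kern_poles B N n = {}"
  by (simp add: kern_poles_def gpoles_empty del: atLeastAtMost_iff)

lemma kern_poles_subset: "kern_poles B N n \<subseteq> lattice B"
  unfolding kern_poles_def lattice_def using gpoles_Ints by blast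

lemma kern_holomorphic: "kern B N n holomorphic_on - (kern_poles B N n \<union> uminus ` kern_poles B N (- n))"
  unfolding kern_def
proof (intro holomorphic_intros)
  fix k :: nat assume k: "k \<in> {1..8}"
  show "(\<lambda>z. gq (B k + z) (N k + n)) holomorphic_on - (kern_poles B N n \<union> uminus ` kern_poles B N (- n))"
    by (rule holomorphic_on_subset[OF gq_holomorphic]) (use k in \<open>auto simp: kern_poles_def\<close>)
  have "uminus ` gpoles (B k) (N k - n) \<subseteq> uminus ` kern_poles B N (- n)"
    unfolding kern_poles_def using k by (intro image_mono) auto
  thus "(\<lambda>z. gq (B k - z) (N k - n)) holomorphic_on - (kern_poles B N n \<union> uminus ` kern_poles B N (- n))"
    by (intro holomorphic_on_subset[OF gq_holomorphic_minus]) blast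
qed

lemma bigo_prod_powi:
  fixes f :: "'b \<Rightarrow> complex \<Rightarrow> complex"
  assumes "finite I" "\<And>i. i \<in> I \<Longrightarrow> f i \<in> O[at_infinity](\<lambda>z. z powi e i)"
  shows "(\<lambda>z. \<Prod>i\<in>I. f i z) \<in> O[at_infinity](\<lambda>z. z powi (\<Sum>i\<in>I. e i))"
  using assms
proof induction
  case (insert i I)
  have "(\<lambda>z. f i z * (\<Prod>i\<in>I. f i z)) \<in> O[at_infinity](\<lambda>z. z powi e i * z powi (\<Sum>i\<in>I. e i))"
    using insert by (intro landau_o.big.mult) auto
  also have "(\<lambda>z::complex. z powi e i * z powi (\<Sum>i\<in>I. e i)) \<in> \<Theta>[at_infinity](\<lambda>z. z powi (e i + (\<Sum>i\<in>I. e i)))"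
    by (rule bigthetaI_cong, use eventually_not_equal_at_infinity[of "0::complex"] in eventually_elim)
       (simp add: power_int_add)
  finally show ?case using insert by simp
qed auto

text \<open>The two factors of index k grow together like the power 2 N k - 2, whatever
  \<open>n\<close> is, so \<open>kern\<close> has order 2 \<Sum>N - 15. Order at most -2 after
  multiplication by \<open>p\<close> is the stated bound 13: degree 5 is allowed at index sum 4,
  degree 7 at index sum 3.\<close>

lemma kern_bigo:
  assumes "on_coset \<nu> N" "n \<in> coset \<nu>" "real (degree p) + 2 * (\<Sum>k\<in>{1..8}. N k) \<le> 13"
  shows "(\<lambda>z. kern B N n z * poly p (z + of_real n)) \<in> O[at_infinity](\<lambda>z. 1 / z ^ 2)"
proof -
  define e where "e = (\<Sum>k\<in>{1..8}. (\<lfloor>N k + n\<rfloor> - 1) + (\<lfloor>N k - n\<rfloor> - 1))"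
  have "real_of_int e = (\<Sum>k\<in>{1..8}. (real_of_int \<lfloor>N k + n\<rfloor> - 1) + (real_of_int \<lfloor>N k - n\<rfloor> - 1))"
    by (simp add: e_def)
  also have "\<dots> = (\<Sum>k\<in>{1..8::nat}. 2 * N k - 2)"
  proof (intro sum.cong refl)
    fix k :: nat assume k: "k \<in> {1..8}"
    have "of_int \<lfloor>x\<rfloor> = x" if "x \<in> \<int>" for x :: real using that by (auto elim: Ints_cases)
    thus "(real_of_int \<lfloor>N k + n\<rfloor> - 1) + (real_of_int \<lfloor>N k - n\<rfloor> - 1) = 2 * N k - 2"
      using on_coset_index[OF assms(1,2) k] by simp
  qed
  also have "\<dots> = 2 * (\<Sum>k\<in>{1..8}. N k) - 16" by (simp add: sum_subtractf sum_distrib_left)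
  finally have e: "e + 1 + int (degree p) \<le> - 2" using assms(3) by linarith
  have gq: "(\<lambda>z. gq (B k + z) (N k + n) * gq (B k - z) (N k - n)) \<in>
      O[at_infinity](\<lambda>z. z powi ((\<lfloor>N k + n\<rfloor> - 1) + (\<lfloor>N k - n\<rfloor> - 1)))" if k: "k \<in> {1..8}" for k
  proof -
    have "(\<lambda>z. gq (B k + 1 * z) (N k + n) * gq (B k + (- 1) * z) (N k - n)) \<in>
      O[at_infinity](\<lambda>z. z powi (\<lfloor>N k + n\<rfloor> - 1) * z powi (\<lfloor>N k - n\<rfloor> - 1))"
      using on_coset_index[OF assms(1,2) k]
      by (intro landau_o.big.mult bigthetaD1 bigtheta_gq) auto
    also have "(\<lambda>z::complex. z powi (\<lfloor>N k + n\<rfloor> - 1) * z powi (\<lfloor>N k - n\<rfloor> - 1)) \<in>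
      \<Theta>[at_infinity](\<lambda>z. z powi ((\<lfloor>N k + n\<rfloor> - 1) + (\<lfloor>N k - n\<rfloor> - 1)))"
      by (rule bigthetaI_cong, use eventually_not_equal_at_infinity[of "0::complex"] in eventually_elim)
         (rule power_int_add[symmetric], simp)
    finally show ?thesis by simp
  qed
  have "(\<lambda>z. kern B N n z * poly p (z + of_real n)) \<in> O[at_infinity](\<lambda>z. z * z powi e * z ^ degree p)"
    unfolding kern_def e_def
    by (intro landau_o.big.mult bigo_prod_powi bigo_poly gq) auto
  also have "(\<lambda>z::complex. z * z powi e * z ^ degree p) \<in> O[at_infinity](\<lambda>z. 1 / z ^ 2)"
  proof (rule bigoI[of _ 1])
    have "eventually (\<lambda>z::complex. norm z \<ge> 1) at_infinity" by (auto simp: eventually_at_infinity)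
    thus "eventually (\<lambda>z::complex. norm (z * z powi e * z ^ degree p) \<le> 1 * norm (1 / z ^ 2)) at_infinity"
    proof eventually_elim
      case (elim z)
      hence nz: "z \<noteq> 0" by auto
      have "z * z powi e * z ^ degree p = z powi (e + 1 + int (degree p))"
        using nz by (simp add: power_int_add)
      hence "norm (z * z powi e * z ^ degree p) = norm z powi (e + 1 + int (degree p))"
        by (simp only: norm_power_int)
      also have "\<dots> \<le> norm z powi (- 2)" using e elim by (intro power_int_increasing) auto
      also have "\<dots> = norm (1 / z ^ 2)" by (simp add: power_int_minus norm_inverse norm_power divide_inverse)
      finally show ?case by simp
    qed
  qed
  finally show ?thesis .
qed

lemma poles_in_kern:
  assumes "on_coset \<nu> N" "n \<in> coset \<nu>" "real (degree p) + 2 * (\<Sum>k\<in>{1..8}. N k) \<le> 13"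
  shows "poles_in (kern_poles B N n) (uminus ` kern_poles B N (- n)) (\<lambda>z. kern B N n z * poly p (z + of_real n))"
  unfolding poles_in_def using kern_holomorphic[of B N n] kern_bigo[OF assms]
  by (auto intro!: holomorphic_intros)

lemma admissible_kern:
  assumes "on_coset \<nu> N" "real (degree p) + 2 * (\<Sum>k\<in>{1..8}. N k) \<le> 13"
  shows "admissible \<nu> (lattice B) (\<lambda>n z. kern B N n z * poly p (z + of_real n))"
  unfolding admissible_def
proof (intro exI[of _ "1 + (\<Sum>k\<in>{1..8}. \<bar>N k\<bar>)"] ballI)
  fix n assume n: "n \<in> coset \<nu>"
  have N: "\<bar>N k\<bar> \<le> (\<Sum>k\<in>{1..8}. \<bar>N k\<bar>)" if "k \<in> {1..8}" for k
    using that by (intro member_le_sum) auto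
  have empty: "kern_poles B N m = {}" if "1 + (\<Sum>k\<in>{1..8}. \<bar>N k\<bar>) \<le> m" for m
  proof (rule kern_poles_empty)
    fix k :: nat assume "k \<in> {1..8}"
    from N[OF this] that show "1 \<le> N k + m" by linarith
  qed
  show "\<exists>P Q. poles_in P Q (\<lambda>z. kern B N n z * poly p (z + of_real n)) \<and> P \<subseteq> lattice B \<and>
      Q \<subseteq> uminus ` lattice B \<and> (1 + (\<Sum>k\<in>{1..8}. \<bar>N k\<bar>) \<le> n \<longrightarrow> P = {}) \<and>
      (n \<le> - (1 + (\<Sum>k\<in>{1..8}. \<bar>N k\<bar>)) \<longrightarrow> Q = {})"
    using poles_in_kern[OF assms(1) n assms(2)] kern_poles_subset[of B N n]
      image_mono[OF kern_poles_subset[of B N "- n"], of uminus] empty[of n] empty[of "- n"]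
    by (intro exI[of _ "kern_poles B N n"] exI[of _ "uminus ` kern_poles B N (- n)"]) auto
qed

section \<open>Contiguous relations\<close>

text \<open>The polynomial is evaluated at w = z + n, and \<open>N 1\<close> serves as a
  representative of the coset of all \<open>N k\<close>.\<close>

definition val_poly :: "(nat \<Rightarrow> complex) \<Rightarrow> (nat \<Rightarrow> real) \<Rightarrow> complex poly \<Rightarrow> complex" where
  "val_poly B N p = ressum (N 1) (lattice B) (\<lambda>n z. kern B N n z * poly p (z + of_real n))"

definition val :: "(nat \<Rightarrow> complex) \<Rightarrow> (nat \<Rightarrow> real) \<Rightarrow> complex" where
  "val B N = val_poly B N [:0, 1:]"

definition index_ok :: "(nat \<Rightarrow> real) \<Rightarrow> bool" where
  "index_ok N \<longleftrightarrow> on_coset (N 1) N"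

definition half_shift :: "(nat \<Rightarrow> real) \<Rightarrow> nat set \<Rightarrow> nat \<Rightarrow> real" where
  "half_shift N U k = (if k \<in> U then N k + 1/2 else N k - 1/2)"

lemma on_coset_cong:
  assumes "\<nu> - \<nu>' \<in> \<int>" "on_coset \<nu> N" shows "on_coset \<nu>' N"
proof -
  have "N k - \<nu>' = (N k - \<nu>) + (\<nu> - \<nu>')" "2 * \<nu>' = 2 * \<nu> - 2 * (\<nu> - \<nu>')" for k by auto
  thus ?thesis using assms unfolding on_coset_def by (metis Ints_add Ints_diff Ints_mult Ints_numeral)
qed

lemma on_coset_index_ok: "on_coset \<nu> N \<Longrightarrow> index_ok N"
  unfolding index_ok_def
proof (rule on_coset_cong)
  assume "on_coset \<nu> N"
  hence "N 1 - \<nu> \<in> \<int>" by (simp add: on_coset_def)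
  hence "- (N 1 - \<nu>) \<in> \<int>" by (rule Ints_minus)
  thus "\<nu> - N 1 \<in> \<int>" by simp
qed

abbreviation bump :: "(nat \<Rightarrow> real) \<Rightarrow> nat \<Rightarrow> nat \<Rightarrow> real" where
  "bump N i \<equiv> N(i := N i + 1)"

lemma index_ok_upd:
  assumes "index_ok N" shows "index_ok (bump N i)"
proof -
  have "on_coset (N 1) (bump N i)"
    using assms unfolding index_ok_def on_coset_def
    by (auto simp: diff_add_eq[symmetric] intro: Ints_add)
  thus ?thesis by (rule on_coset_index_ok)
qed

lemma on_coset_half_shift:
  assumes "on_coset \<nu> N" shows "on_coset (\<nu> + 1/2) (half_shift N U)"
  unfolding on_coset_def
proof (intro conjI ballI)
  have "2 * (\<nu> + 1/2) = 2 * \<nu> + 1" by simp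
  thus "2 * (\<nu> + 1/2) \<in> \<int>" using assms unfolding on_coset_def by (metis Ints_1 Ints_add)
next
  fix k :: nat assume "k \<in> {1..8}"
  hence k: "N k - \<nu> \<in> \<int>" using assms by (simp add: on_coset_def)
  have "half_shift N U k - (\<nu> + 1/2) = (if k \<in> U then N k - \<nu> else (N k - \<nu>) - 1)"
    by (simp add: half_shift_def)
  thus "half_shift N U k - (\<nu> + 1/2) \<in> \<int>" using k by auto
qed

lemma index_ok_half_shift: "index_ok N \<Longrightarrow> index_ok (half_shift N U)"
  unfolding index_ok_def[of N] by (rule on_coset_index_ok[OF on_coset_half_shift])

lemma val_poly_eq:
  assumes "on_coset \<nu> N"
  shows "val_poly B N p = ressum \<nu> (lattice B) (\<lambda>n z. kern B N n z * poly p (z + of_real n))"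
proof -
  have "N 1 - \<nu> \<in> \<int>" using assms by (simp add: on_coset_def)
  hence "coset (N 1) = coset \<nu>" by (rule coset_cong)
  thus ?thesis unfolding val_poly_def ressum_def by simp
qed

lemma kern_cong: "(\<And>k. k \<in> {1..8} \<Longrightarrow> N k = N' k) \<Longrightarrow> kern B N = kern B N'"
  unfolding kern_def by (intro ext arg_cong2[of _ _ _ _ "(*)"] prod.cong refl) auto

lemma val_cong:
  assumes "\<And>k. k \<in> {1..8} \<Longrightarrow> N k = N' k" shows "val B N = val B N'"
  using kern_cong[OF assms] assms[of 1] unfolding val_def val_poly_def by simp

lemma kern_uminus: "kern B N (- n) (- z) = - kern B N n z"
  unfolding kern_def by (simp add: mult.commute)

lemma val_poly_lincomb:
  assumes "generic B" "index_ok N"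
    "real (degree p) + 2 * (\<Sum>k\<in>{1..8}. N k) \<le> 13" "real (degree q) + 2 * (\<Sum>k\<in>{1..8}. N k) \<le> 13"
  shows "val_poly B N (smult c p + smult d q) = c * val_poly B N p + d * val_poly B N q"
proof -
  have "val_poly B N (smult c p + smult d q) = ressum (N 1) (lattice B)
    (\<lambda>n z. c * (kern B N n z * poly p (z + of_real n)) + d * (kern B N n z * poly q (z + of_real n)))"
    unfolding val_poly_def by (simp add: algebra_simps)
  thus ?thesis unfolding val_poly_def
    using assms by (subst ressum_lincomb[symmetric]) (auto intro!: lattice_disjoint admissible_kern simp: index_ok_def)
qed

lemma val_poly_smult:
  assumes "generic B" "index_ok N" "real (degree p) + 2 * (\<Sum>k\<in>{1..8}. N k) \<le> 13"
  shows "val_poly B N (smult c p) = c * val_poly B N p"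
  using val_poly_lincomb[OF assms assms(3), of c 0] by simp

lemma val_poly_reflect:
  assumes "generic B" "index_ok N" "real (degree p) + 2 * (\<Sum>k\<in>{1..8}. N k) \<le> 13"
  shows "val_poly B N (pcompose p [:0, -1:]) = - val_poly B N p"
proof -
  have ok: "on_coset (N 1) N" using assms(2) by (simp add: index_ok_def)
  have "val_poly B N p = ressum (N 1) (lattice B) (\<lambda>n z. kern B N (- n) (- z) * poly p (- z + of_real (- n)))"
    unfolding val_poly_def
    by (rule ressum_reflect[symmetric, OF lattice_disjoint[OF assms(1)] _ admissible_kern[OF ok assms(3)]])
       (use ok in \<open>simp add: on_coset_def\<close>)
  also have "\<dots> = val_poly B N (smult (- 1) (pcompose p [:0, -1:]))"
    unfolding val_poly_def by (simp add: kern_uminus poly_pcompose algebra_simps)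
  also have "\<dots> = - val_poly B N (pcompose p [:0, -1:])"
    using assms by (subst val_poly_smult) (auto simp: degree_pcompose)
  finally show ?thesis by simp
qed

text \<open>The last hypothesis says that \<open>q\<close> is the odd part of \<open>p\<close>; the
  even part contributes 0 because \<open>val_poly_reflect\<close> shows its value to be its own
  negative.\<close>

lemma val_poly_odd_part:
  assumes "generic B" "index_ok N"
    "real (degree p) + 2 * (\<Sum>k\<in>{1..8}. N k) \<le> 13" "real (degree q) + 2 * (\<Sum>k\<in>{1..8}. N k) \<le> 13"
    and eq: "\<And>x. poly p x - poly p (- x) = 2 * poly q x"
  shows "val_poly B N p = val_poly B N q"
proof -
  define p' where "p' = pcompose p [:0, -1:]"
  have deg: "real (degree p') + 2 * (\<Sum>k\<in>{1..8}. N k) \<le> 13"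
    using assms(3) by (simp add: p'_def degree_pcompose)
  have "poly (smult 1 p + smult (- 1) p') x = poly (smult 2 q) x" for x
    using eq[of x] by (simp add: p'_def poly_pcompose)
  hence "smult 1 p + smult (- 1) p' = smult 2 q"
    unfolding poly_eq_poly_eq_iff[symmetric] by (rule ext)
  hence "2 * val_poly B N q = val_poly B N (smult 1 p + smult (- 1) p')"
    using val_poly_smult[OF assms(1,2,4), of 2] by simp
  also have "\<dots> = 2 * val_poly B N p"
    using val_poly_lincomb[OF assms(1-3) deg, of 1 "- 1"] val_poly_reflect[OF assms(1-3)]
    by (simp add: p'_def)
  finally show ?thesis by simp
qed

lemma off_lattice_nonzero:
  assumes "z \<notin> lattice B \<union> uminus ` lattice B" "k \<in> {1..8}" "r \<in> \<int>"
  shows "B k + z + of_real r \<noteq> 0" "B k - z + of_real r \<noteq> 0"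
proof -
  have r: "- complex_of_real r \<in> \<int>" using assms(3) by (auto elim!: Ints_cases)
  have k: "z + B k \<notin> \<int>" "- z + B k \<notin> \<int>"
    using assms(1,2) by (auto simp: lattice_def mem_uminus_image)
  show "B k + z + of_real r \<noteq> 0"
  proof
    assume "B k + z + of_real r = 0"
    hence "z + B k = - of_real r" by (simp add: add_eq_0_iff add.commute)
    thus False using k r by simp
  qed
  show "B k - z + of_real r \<noteq> 0"
  proof
    assume "B k - z + of_real r = 0"
    hence "- z + B k = - of_real r" by (simp add: add_eq_0_iff algebra_simps)
    thus False using k r by simp
  qed
qed

text \<open>Both Gamma factors of index i in the numerator go up by one step, which gives the
  factors A i + w and A i - w with A i = B i + N i.\<close>

lemma kern_upd:
  assumes "on_coset \<nu> N" "n \<in> coset \<nu>" "z \<notin> lattice B \<union> uminus ` lattice B" "i \<in> {1..8}"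
  shows "kern B (bump N i) n z = ((B i + of_real (N i)) ^ 2 - (z + of_real n) ^ 2) * kern B N n z"
proof -
  note idx = on_coset_index[OF assms(1,2,4)]
  note nz = off_lattice_nonzero(1)[OF assms(3,4) idx(1)] off_lattice_nonzero(2)[OF assms(3,4) idx(2)]
  define F where "F = (\<lambda>N k. gq (B k + z) (N k + n) * gq (B k - z) (N k - n))"
  define G where "G = prod (F N) ({1..8} - {i})"
  have 1: "prod (F N) {1..8} = F N i * G" using assms(4) by (simp add: G_def prod.remove)
  have "prod (F (bump N i)) {1..8} = F (bump N i) i * prod (F (bump N i)) ({1..8} - {i})"
    using assms(4) by (intro prod.remove) auto
  also have "prod (F (bump N i)) ({1..8} - {i}) = G"
    unfolding G_def by (intro prod.cong) (auto simp: F_def)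
  also have "F (bump N i) i = gq (B i + z) ((N i + n) + 1) * gq (B i - z) ((N i - n) + 1)"
    by (simp add: F_def algebra_simps)
  also have "\<dots> = ((B i + of_real (N i)) ^ 2 - (z + of_real n) ^ 2) * F N i"
    unfolding gq_step[OF idx(1) nz(1)] gq_step[OF idx(2) nz(2)]
    by (simp add: F_def power2_eq_square algebra_simps)
  finally have "prod (F (bump N i)) {1..8} =
      ((B i + of_real (N i)) ^ 2 - (z + of_real n) ^ 2) * prod (F N) {1..8}" by (simp only: 1 mult.assoc)
  moreover have "kern B M n z = z * prod (F M) {1..8}" for M by (simp add: kern_def F_def)
  ultimately show ?thesis by (simp only: mult_ac)
qed

text \<open>On \<open>U\<close> the index N k + n rises by one and N k - n stays, which gives a
  factor A k + w. On \<open>R\<close> the index N k - n drops by one and N k + n stays; the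
  resulting divisors A k - 1 - w are kept on the left.\<close>

lemma kern_half_shift:
  assumes "on_coset \<nu> N" "n \<in> coset \<nu>" "z \<notin> lattice B \<union> uminus ` lattice B"
    and UR: "U \<inter> R = {}" "U \<union> R = {1..8}"
  shows "kern B (half_shift N U) (n + 1/2) z * (\<Prod>k\<in>R. B k + of_real (N k) - 1 - (z + of_real n)) =
         (\<Prod>k\<in>U. B k + of_real (N k) + (z + of_real n)) * kern B N n z"
proof -
  define F where "F = (\<lambda>N n k. gq (B k + z) (N k + n) * gq (B k - z) (N k - n))"
  have fin: "finite U" "finite R" using UR(2) by (metis finite_Un finite_atLeastAtMost)+
  have split: "prod f {1..8} = prod f U * prod f R" for f :: "nat \<Rightarrow> complex"
    unfolding UR(2)[symmetric] using fin UR(1) by (rule prod.union_disjoint)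
  have U: "F (half_shift N U) (n + 1/2) k = (B k + of_real (N k) + (z + of_real n)) * F N n k" if k: "k \<in> U" for k
  proof -
    have k8: "k \<in> {1..8}" using k UR by auto
    note idx = on_coset_index[OF assms(1,2) k8]
    have *: "F (half_shift N U) (n + 1/2) k = gq (B k + z) ((N k + n) + 1) * gq (B k - z) (N k - n)"
      using k by (simp add: F_def half_shift_def algebra_simps)
    show ?thesis
      unfolding * gq_step[OF idx(1) off_lattice_nonzero(1)[OF assms(3) k8 idx(1)]]
      by (simp add: F_def algebra_simps)
  qed
  have R: "F (half_shift N U) (n + 1/2) k * (B k + of_real (N k) - 1 - (z + of_real n)) = F N n k" if k: "k \<in> R" for k
  proof -
    have k8: "k \<in> {1..8}" "k \<notin> U" using k UR by auto
    note idx = on_coset_index[OF assms(1,2) k8(1)]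
    have *: "F (half_shift N U) (n + 1/2) k = gq (B k + z) (N k + n) * gq (B k - z) ((N k - n) - 1)"
      using k8 by (simp add: F_def half_shift_def algebra_simps)
    have "B k - z + of_real (N k - n) - 1 \<noteq> 0"
      using off_lattice_nonzero(2)[OF assms(3) k8(1) Ints_diff[OF idx(2) Ints_1]] by (simp add: algebra_simps)
    note ** = gq_back[OF idx(2) this]
    show ?thesis unfolding * unfolding F_def ** by (simp add: algebra_simps)
  qed
  have "prod (F (half_shift N U) (n + 1/2)) {1..8} * (\<Prod>k\<in>R. B k + of_real (N k) - 1 - (z + of_real n)) =
        prod (F (half_shift N U) (n + 1/2)) U *
        (\<Prod>k\<in>R. F (half_shift N U) (n + 1/2) k * (B k + of_real (N k) - 1 - (z + of_real n)))"
    by (simp only: split prod.distrib mult_ac)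
  also have "\<dots> = (\<Prod>k\<in>U. (B k + of_real (N k) + (z + of_real n)) * F N n k) * prod (F N n) R"
    by (intro arg_cong2[of _ _ _ _ "(*)"] prod.cong refl U R)
  also have "\<dots> = (\<Prod>k\<in>U. B k + of_real (N k) + (z + of_real n)) * prod (F N n) {1..8}"
    by (simp only: split prod.distrib mult_ac)
  finally have eq: "prod (F (half_shift N U) (n + 1/2)) {1..8} * (\<Prod>k\<in>R. B k + of_real (N k) - 1 - (z + of_real n)) =
    (\<Prod>k\<in>U. B k + of_real (N k) + (z + of_real n)) * prod (F N n) {1..8}" .
  have kern: "kern B M m z = z * prod (F M m) {1..8}" for M m by (simp add: kern_def F_def)
  show ?thesis unfolding kern mult.assoc eq by (simp only: mult_ac)
qed

lemma sum_upd:
  assumes "i \<in> {1..8}" shows "(\<Sum>k\<in>{1..8}. (bump N i) k) = (\<Sum>k\<in>{1..8::nat}. N k) + (1::real)"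
proof -
  have "(\<Sum>k\<in>{1..8}. (bump N i) k) = (N i + 1) + (\<Sum>k\<in>{1..8} - {i}. N k)"
    using assms by (subst sum.remove[of _ i]) auto
  moreover have "(\<Sum>k\<in>{1..8}. N k) = N i + (\<Sum>k\<in>{1..8} - {i}. N k)"
    using assms by (intro sum.remove) auto
  ultimately show ?thesis by linarith
qed

lemma val_upd:
  assumes "generic B" "index_ok N" "i \<in> {1..8}"
  shows "val B (bump N i) = val_poly B N [:0, (B i + of_real (N i)) ^ 2, 0, - 1:]"
proof -
  have ok: "on_coset (N 1) N" using assms(2) by (simp add: index_ok_def)
  hence ok': "on_coset (N 1) (bump N i)"
    unfolding on_coset_def by (auto simp: diff_add_eq[symmetric] intro: Ints_add)
  show ?thesis
    unfolding val_def val_poly_eq[OF ok'] val_poly_eq[OF ok]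
  proof (rule ressum_cong[OF lattice_discrete])
    fix n z assume "n \<in> coset (N 1)" "z \<notin> lattice B \<union> uminus ` lattice B"
    from kern_upd[OF ok this assms(3)]
    show "kern B (bump N i) n z * poly [:0, 1:] (z + of_real n) =
      kern B N n z * poly [:0, (B i + of_real (N i)) ^ 2, 0, - 1:] (z + of_real n)"
      by (simp only:) (simp add: algebra_simps power2_eq_square)
  qed
qed

text \<open>By \<open>val_upd\<close> the shift at k has the cubic w (A k ^ 2 - w ^ 2). All these
  cubics lie in the span of w and w ^ 3, so any three of them are dependent.\<close>

lemma three_term_unit_shifts:
  assumes "generic B" "index_ok N" "(\<Sum>k\<in>{1..8}. N k) = 3" "{i, j, l} \<subseteq> {1..8}"
  defines "A \<equiv> \<lambda>k. B k + of_real (N k)"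
  shows "(A i ^ 2 - A j ^ 2) * val B (bump N l) =
     (A i ^ 2 - A l ^ 2) * val B (bump N j) - (A j ^ 2 - A l ^ 2) * val B (bump N i)"
proof -
  have i: "i \<in> {1..8}" "j \<in> {1..8}" "l \<in> {1..8}" using assms(4) by auto
  define q where "q = (\<lambda>k. [:0, (A k) ^ 2, 0, - 1:])"
  have deg: "real (degree (q k)) + 2 * (\<Sum>k\<in>{1..8}. N k) \<le> 13" for k
    using assms(3) by (simp add: q_def)
  have upd: "val B (bump N k) = val_poly B N (q k)" if "k \<in> {1..8}" for k
    using val_upd[OF assms(1,2) that] by (simp add: q_def A_def)
  define X Y Z where "X = A i ^ 2 - A l ^ 2" and "Y = A j ^ 2 - A l ^ 2" and "Z = A i ^ 2 - A j ^ 2"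
  have "X * val_poly B N (q j) + (- Y) * val_poly B N (q i) = val_poly B N (smult X (q j) + smult (- Y) (q i))"
    by (rule val_poly_lincomb[OF assms(1,2) deg deg, symmetric])
  also have "smult X (q j) + smult (- Y) (q i) = smult Z (q l)"
    by (simp add: q_def X_def Y_def Z_def algebra_simps)
  also have "val_poly B N \<dots> = Z * val_poly B N (q l)"
    by (rule val_poly_smult[OF assms(1,2) deg])
  finally show ?thesis unfolding upd[OF i(1)] upd[OF i(2)] upd[OF i(3)] X_def[symmetric] Y_def[symmetric] Z_def[symmetric]
    by simp
qed

lemma sum_half_shift:
  assumes "U \<subseteq> {1..8}"
  shows "(\<Sum>k\<in>{1..8}. half_shift N U k) = (\<Sum>k\<in>{1..8}. N k) + real (card U) - 4"
proof -
  have "half_shift N U = (\<lambda>k. N k - 1/2 + (if k \<in> U then 1 else 0))" by (auto simp: half_shift_def fun_eq_iff)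
  hence "(\<Sum>k\<in>{1..8}. half_shift N U k) = (\<Sum>k\<in>{1..8}. N k) - 4 + (\<Sum>k\<in>{1..8}. if k \<in> U then 1 else 0)"
    by (simp add: sum.distrib sum_subtractf)
  also have "(\<Sum>k\<in>{1..8}. if k \<in> U then 1 else 0 :: real) = real (card ({1..8} \<inter> U))"
    by (simp add: sum.If_cases)
  also have "{1..8} \<inter> U = U" using assms by blast
  finally show ?thesis by simp
qed

text \<open>The half shift \<open>n \<mapsto> n + 1/2\<close> at fixed \<open>z\<close> turns the integrand at \<open>half_shift N U\<close> into
  a polynomial multiple of the one at \<open>N\<close>; the polynomial \<open>h\<close> is chosen to vanish at the
  spurious poles, and to have no cubic term, so that its odd part is linear.\<close>

lemma val_half_shift:
  assumes "generic B" "index_ok N" "(\<Sum>k\<in>{1..8}. N k) = 3" "(\<Sum>k\<in>{1..8}. B k) = - 2"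
    and dist: "distinct [u1, u2, u3, u4, u5, r1, r2, r3]"
    and set8: "{u1, u2, u3, u4, u5, r1, r2, r3} = {1..8}"
  defines "A \<equiv> \<lambda>k. B k + of_real (N k)"
  defines "\<sigma> \<equiv> A r1 + A r2 + A r3 - 1"
  shows "(A r1 + A r2 - 1) * (A r1 + A r3 - 1) * (A r2 + A r3 - 1) * val B (half_shift N {u1, u2, u3, u4, u5}) =
     - val_poly B N ([:A u1, 1:] * [:A u2, 1:] * [:A u3, 1:] * [:A u4, 1:] * [:A u5, 1:] * [:\<sigma>, 1:])"
proof -
  define U where "U = {u1, u2, u3, u4, u5}"
  define R where "R = {r1, r2, r3}"
  have UR: "U \<inter> R = {}" "U \<union> R = {1..8}" using dist set8 by (auto simp: U_def R_def)
  \<comment> \<open>With x = w + 1/2 the first three factors are those left over on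
    \<open>R\<close>, up to sign. The fourth root is chosen so that the four roots add up to zero,
    which removes x ^ 3.\<close>
  define h where "h = [:1/2 - A r1, 1:] * [:1/2 - A r2, 1:] * [:1/2 - A r3, 1:] * [:A r1 + A r2 + A r3 - 3/2, 1:]"
  define q where "q = [:A u1, 1:] * [:A u2, 1:] * [:A u3, 1:] * [:A u4, 1:] * [:A u5, 1:] * [:\<sigma>, 1:]"
  \<comment> \<open>The linear coefficient of \<open>h\<close>, minus the third elementary symmetric
    function of its roots; it factors into pair sums because the roots add up to zero.\<close>
  define c where "c = (A r1 + A r2 - 1) * (A r1 + A r3 - 1) * (A r2 + A r3 - 1)"
  have ok: "on_coset (N 1) N" using assms(2) by (simp add: index_ok_def)
  have ok': "index_ok (half_shift N U)" by (rule index_ok_half_shift[OF assms(2)])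
  have "card U = 5" "U \<subseteq> {1..8}" using dist UR(2) by (simp add: U_def, blast)
  hence sumU: "(\<Sum>k\<in>{1..8}. half_shift N U k) = 4"
    using sum_half_shift[OF \<open>U \<subseteq> {1..8}\<close>, of N] assms(3) by linarith
  have degh: "real (degree h) + 2 * (\<Sum>k\<in>{1..8}. half_shift N U k) \<le> 13"
    unfolding sumU h_def by simp
  have degc: "real (degree [:0, c:]) + 2 * (\<Sum>k\<in>{1..8}. half_shift N U k) \<le> 13"
    unfolding sumU by simp
  have degx: "real (degree [:0, 1::complex:]) + 2 * (\<Sum>k\<in>{1..8}. half_shift N U k) \<le> 13"
    unfolding sumU by simp
  have degq: "real (degree q) + 2 * (\<Sum>k\<in>{1..8}. N k) \<le> 13"
    using assms(3) by (simp add: q_def degree_mult_eq)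
  have "c * val B (half_shift N U) = val_poly B (half_shift N U) (smult c [:0, 1:])"
    unfolding val_def by (rule val_poly_smult[OF assms(1) ok' degx, symmetric])
  also have "smult c [:0, 1:] = [:0, c:]" by simp
  also have "val_poly B (half_shift N U) [:0, c:] = val_poly B (half_shift N U) h"
  proof (rule val_poly_odd_part[OF assms(1) ok' degh degc, symmetric])
    fix x
    show "poly h x - poly h (- x) = 2 * poly [:0, c:] x"
      by (simp add: h_def c_def field_simps)
  qed
  also have "\<dots> = ressum (N 1 + 1/2) (lattice B) (\<lambda>n z. kern B (half_shift N U) n z * poly h (z + of_real n))"
    by (rule val_poly_eq[OF on_coset_half_shift[OF ok]])
  also have "\<dots> = ressum (N 1) (lattice B)
      (\<lambda>n z. kern B (half_shift N U) (n + 1/2) z * poly h (z + of_real (n + 1/2)))"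
    by (rule ressum_shift_half[symmetric])
  also have "\<dots> = val_poly B N (smult (- 1) q)"
    unfolding val_poly_def
  proof (rule ressum_cong[OF lattice_discrete])
    fix n z assume nz: "n \<in> coset (N 1)" "z \<notin> lattice B \<union> uminus ` lattice B"
    define w where "w = z + of_real n"
    define K where "K = kern B (half_shift N U) (n + 1/2) z"
    have K: "K * ((A r1 - 1 - w) * (A r2 - 1 - w) * (A r3 - 1 - w)) =
      ((A u1 + w) * (A u2 + w) * (A u3 + w) * (A u4 + w) * (A u5 + w)) * kern B N n z"
      using kern_half_shift[OF ok nz UR] dist
      unfolding K_def w_def A_def U_def R_def by (simp add: mult_ac)
    have "z + of_real (n + 1/2) = w + 1/2" by (simp add: w_def)
    moreover have "poly [:1/2 - A k, 1:] (w + 1/2) = - (A k - 1 - w)" for k by (simp add: field_simps)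
    moreover have "poly [:A r1 + A r2 + A r3 - 3/2, 1:] (w + 1/2) = \<sigma> + w" by (simp add: \<sigma>_def field_simps)
    ultimately have "K * poly h (z + of_real (n + 1/2)) =
        K * ((A r1 - 1 - w) * (A r2 - 1 - w) * (A r3 - 1 - w)) * (- (\<sigma> + w))"
      unfolding h_def
      by (simp only: poly_mult mult_minus_left mult_minus_right minus_minus mult_ac)
    also have "\<dots> = kern B N n z * poly (smult (- 1) q) w"
      unfolding K by (simp add: q_def algebra_simps)
    finally show "K * poly h (z + of_real (n + 1/2)) = kern B N n z * poly (smult (- 1) q) (z + of_real n)"
      unfolding w_def .
  qed
  also have "\<dots> = - val_poly B N q"
    using val_poly_smult[OF assms(1,2) degq, of "- 1"] by simp
  finally show ?thesis unfolding c_def U_def q_def .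
qed

text \<open>Here the sum of all \<open>A k\<close> is 3 - 2 = 1, so \<sigma> is minus the sum of the
  five \<open>A u\<close>, and the sextic of \<open>val_half_shift\<close> has no w ^ 5 term. Its
  odd part is thus a combination of the cubics of the unit shifts at u1 and u2. The coefficients are
  found at w = A u1 and w = A u2, where one cubic vanishes and the sextic is zero at - w; the factor
  A u1 ^ 2 - A u2 ^ 2 clears denominators.\<close>

lemma three_term_half_shift:
  assumes "generic B" "index_ok N" "(\<Sum>k\<in>{1..8}. N k) = 3" "(\<Sum>k\<in>{1..8}. B k) = - 2"
    and dist: "distinct [u1, u2, u3, u4, u5, r1, r2, r3]"
    and set8: "{u1, u2, u3, u4, u5, r1, r2, r3} = {1..8}"
  defines "A \<equiv> \<lambda>k. B k + of_real (N k)"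
  defines "\<sigma> \<equiv> A r1 + A r2 + A r3 - 1"
  shows "(A r1 + A r2 - 1) * (A r1 + A r3 - 1) * (A r2 + A r3 - 1) * (A u1 ^ 2 - A u2 ^ 2) *
       val B (half_shift N {u1, u2, u3, u4, u5}) =
     (A u1 + \<sigma>) * (A u1 + A u2) * (A u1 + A u3) * (A u1 + A u4) * (A u1 + A u5) * val B (bump N u2) -
     (A u2 + \<sigma>) * (A u2 + A u1) * (A u2 + A u3) * (A u2 + A u4) * (A u2 + A u5) * val B (bump N u1)"
proof -
  define k1 where "k1 = (A u1 + \<sigma>) * (A u1 + A u2) * (A u1 + A u3) * (A u1 + A u4) * (A u1 + A u5)"
  define k2 where "k2 = (A u2 + \<sigma>) * (A u2 + A u1) * (A u2 + A u3) * (A u2 + A u4) * (A u2 + A u5)"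
  define V where "V = val B (half_shift N {u1, u2, u3, u4, u5})"
  define q where "q = [:A u1, 1:] * [:A u2, 1:] * [:A u3, 1:] * [:A u4, 1:] * [:A u5, 1:] * [:\<sigma>, 1:]"
  define e where "e = (\<lambda>k. [:0, (A k) ^ 2, 0, - 1:])"
  define \<delta> where "\<delta> = A u1 ^ 2 - A u2 ^ 2"
  have u: "u1 \<in> {1..8}" "u2 \<in> {1..8}" using set8 by auto
  have "(\<Sum>k\<in>{1..8}. A k) = 1" unfolding A_def sum.distrib of_real_sum[symmetric] using assms(3,4) by simp
  hence "A u1 + A u2 + A u3 + A u4 + A u5 + A r1 + A r2 + A r3 = 1"
    unfolding set8[symmetric] using dist by (simp add: add_ac)
  hence \<sigma>: "\<sigma> = - (A u1 + A u2 + A u3 + A u4 + A u5)" unfolding \<sigma>_def by (simp add: algebra_simps add_eq_0_iff2)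
  have deg: "real (degree (e k)) + 2 * (\<Sum>k\<in>{1..8}. N k) \<le> 13" for k
    using assms(3) by (simp add: e_def)
  have degq: "real (degree q) + 2 * (\<Sum>k\<in>{1..8}. N k) \<le> 13"
    using assms(3) by (simp add: q_def degree_mult_eq)
  have degq': "real (degree (smult \<delta> q)) + 2 * (\<Sum>k\<in>{1..8}. N k) \<le> 13"
    using degq degree_smult_le[of \<delta> q] by linarith
  have dege: "real (degree (smult (- k1) (e u2) + smult k2 (e u1))) + 2 * (\<Sum>k\<in>{1..8}. N k) \<le> 13"
    using assms(3) by (simp add: e_def)
  have "(A r1 + A r2 - 1) * (A r1 + A r3 - 1) * (A r2 + A r3 - 1) * V = - val_poly B N q"
    using val_half_shift[OF assms(1-6)] unfolding V_def q_def \<sigma>_def A_def .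
  moreover define c where "c = (A r1 + A r2 - 1) * (A r1 + A r3 - 1) * (A r2 + A r3 - 1)"
  ultimately have "c * V = - val_poly B N q" by simp
  moreover have "c * \<delta> * V = \<delta> * (c * V)" by (simp only: mult_ac)
  ultimately have "c * \<delta> * V = - (\<delta> * val_poly B N q)" by simp
  also have "\<delta> * val_poly B N q = val_poly B N (smult \<delta> q)"
    by (rule val_poly_smult[OF assms(1,2) degq, symmetric])
  also have "\<dots> = val_poly B N (smult (- k1) (e u2) + smult k2 (e u1))"
  proof (rule val_poly_odd_part[OF assms(1,2) degq' dege])
    fix x
    \<comment> \<open>Only the symmetric functions of \<open>A u3\<close>, \<open>A u4\<close>,
      \<open>A u5\<close> matter, which leaves a polynomial identity in six variables.\<close>
    define s1 s2 s3 where "s1 = A u3 + A u4 + A u5" and "s2 = A u3 * A u4 + A u3 * A u5 + A u4 * A u5"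
      and "s3 = A u3 * A u4 * A u5"
    have P: "(A u3 + y) * (A u4 + y) * (A u5 + y) = y ^ 3 + s1 * y ^ 2 + s2 * y + s3" for y
      unfolding s1_def s2_def s3_def by algebra
    have \<sigma>': "\<sigma> = - (A u1 + A u2 + s1)" by (simp add: \<sigma> s1_def)
    have q: "poly q y = (A u1 + y) * (A u2 + y) * (\<sigma> + y) * (y ^ 3 + s1 * y ^ 2 + s2 * y + s3)" for y
      unfolding P[symmetric] q_def poly_mult by (simp add: mult_ac)
    have k1: "k1 = (A u1 + \<sigma>) * (A u1 + A u2) * (A u1 ^ 3 + s1 * A u1 ^ 2 + s2 * A u1 + s3)"
      unfolding P[symmetric] k1_def by (simp add: algebra_simps)
    have k2: "k2 = (A u2 + \<sigma>) * (A u2 + A u1) * (A u2 ^ 3 + s1 * A u2 ^ 2 + s2 * A u2 + s3)"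
      unfolding P[symmetric] k2_def by (simp add: algebra_simps)
    have e: "poly (e k) x = A k ^ 2 * x - x ^ 3" for k
      by (simp add: e_def algebra_simps power2_eq_square power3_eq_cube)
    show "poly (smult \<delta> q) x - poly (smult \<delta> q) (- x) = 2 * poly (smult (- k1) (e u2) + smult k2 (e u1)) x"
      unfolding poly_smult poly_add q e k1 k2 \<delta>_def \<sigma>' by algebra
  qed
  also have "\<dots> = - k1 * val_poly B N (e u2) + k2 * val_poly B N (e u1)"
    by (rule val_poly_lincomb[OF assms(1,2) deg deg])
  finally show ?thesis
    using val_upd[OF assms(1,2) u(1)] val_upd[OF assms(1,2) u(2)]
    unfolding k1_def[symmetric] k2_def[symmetric] V_def[symmetric] \<delta>_def[symmetric] c_def[symmetric] by (simp add: e_def A_def)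
qed

section \<open>The reflected sum\<close>

text \<open>This is (s k - M k) / 2: the shifts of a k by X / 2 and of N k by 1 - L / 2 combine so
  that only the block sum of \<open>B\<close> remains.\<close>

definition refl_B :: "(nat \<Rightarrow> complex) \<Rightarrow> nat \<Rightarrow> complex" where
  "refl_B B k = (if k \<le> 4 then B k - 1/2 - (\<Sum>j\<in>{1..4}. B j) / 2
                 else B k + 1/2 + (\<Sum>j\<in>{1..4}. B j) / 2)"

text \<open>Up to the factor \<open>16 \<pi> \<i>\<close>, the two sides of the theorem are \<open>val B N\<close> and \<open>refl_val B N\<close>.\<close>

definition refl_val :: "(nat \<Rightarrow> complex) \<Rightarrow> (nat \<Rightarrow> real) \<Rightarrow> complex" where
  "refl_val B N = (-1) powi \<lfloor>Lsum N\<rfloor> * (\<Prod>(j, k)\<in>pairsP. gq (B j + B k) (N j + N k)) *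
     val (refl_B B) (Mshift N)"

text \<open>Either half of the index set may play the role of the x block. A relation proved once
  thus serves both halves and all orderings within them.\<close>

definition blocks :: "nat \<Rightarrow> nat \<Rightarrow> nat \<Rightarrow> nat \<Rightarrow> nat \<Rightarrow> nat \<Rightarrow> nat \<Rightarrow> nat \<Rightarrow> bool" where
  "blocks x1 x2 x3 x4 y1 y2 y3 y4 \<longleftrightarrow> distinct [x1, x2, x3, x4, y1, y2, y3, y4] \<and>
     ({x1, x2, x3, x4} \<subseteq> {1..4} \<and> {y1, y2, y3, y4} \<subseteq> {5..8} \<or>
      {x1, x2, x3, x4} \<subseteq> {5..8} \<and> {y1, y2, y3, y4} \<subseteq> {1..4})"

definition pairprod :: "(nat \<Rightarrow> complex) \<Rightarrow> (nat \<Rightarrow> real) \<Rightarrow> nat \<Rightarrow> nat \<Rightarrow> nat \<Rightarrow> nat \<Rightarrow> complex" where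
  "pairprod B N i j k l =
     gq (B i + B j) (N i + N j) * gq (B i + B k) (N i + N k) * gq (B i + B l) (N i + N l) *
     gq (B j + B k) (N j + N k) * gq (B j + B l) (N j + N l) * gq (B k + B l) (N k + N l)"

lemma atLeastAtMost_1_4: "{1..4::nat} = {1, 2, 3, 4}" and atLeastAtMost_1_8: "{1..8::nat} = {1, 2, 3, 4, 5, 6, 7, 8}"
  by auto

lemma sum_1_4: "(\<Sum>k\<in>{1..4::nat}. f k) = f 1 + f 2 + f 3 + f 4"
  and sum_1_8: "(\<Sum>k\<in>{1..8::nat}. f k) = f 1 + f 2 + f 3 + f 4 + f 5 + f 6 + f 7 + (f 8 :: 'a :: comm_monoid_add)"
  by (simp_all add: atLeastAtMost_1_4 atLeastAtMost_1_8 add_ac del: One_nat_def)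

lemma pairprod_perm:
  assumes "distinct [i, j, k, l]" "{i, j, k, l} \<subseteq> {a, b, c, d}"
  shows "pairprod B N i j k l = pairprod B N a b c d"
proof -
  have "i = a \<or> i = b \<or> i = c \<or> i = d" "j = a \<or> j = b \<or> j = c \<or> j = d"
    "k = a \<or> k = b \<or> k = c \<or> k = d" "l = a \<or> l = b \<or> l = c \<or> l = d" using assms(2) by auto
  with assms(1) show ?thesis
    by (elim disjE) (simp_all add: pairprod_def add.commute mult_ac)
qed

lemma prod_pairsP: "(\<Prod>(j, k)\<in>pairsP. gq (B j + B k) (N j + N k)) = pairprod B N 1 2 3 4 * pairprod B N 5 6 7 8"
proof -
  have P: "pairsP = {(1,2), (1,3), (1,4), (2,3), (2,4), (3,4), (5,6), (5,7), (5,8), (6,7), (6,8), (7,8)}"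
  proof -
    have "1 \<le> j \<and> j < k \<and> k \<le> 4 \<longleftrightarrow> j = 1 \<and> k = 2 \<or> j = 1 \<and> k = 3 \<or> j = 1 \<and> k = 4 \<or>
        j = 2 \<and> k = 3 \<or> j = 2 \<and> k = 4 \<or> j = 3 \<and> k = 4"
      "5 \<le> j \<and> j < k \<and> k \<le> 8 \<longleftrightarrow> j = 5 \<and> k = 6 \<or> j = 5 \<and> k = 7 \<or> j = 5 \<and> k = 8 \<or>
        j = 6 \<and> k = 7 \<or> j = 6 \<and> k = 8 \<or> j = 7 \<and> k = 8" for j k :: nat by presburger+
    thus ?thesis unfolding pairsP_def by auto
  qed
  show ?thesis unfolding P by (simp add: pairprod_def mult_ac)
qed

text \<open>Doubling an integer combination of \<open>refl_B B\<close> clears the halves and yields,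
  up to the integer \<open>D\<close>, an integer combination of \<open>B\<close> with coefficients
  \<open>c'\<close>. Genericity makes \<open>c'\<close> constant, and this forces \<open>c\<close>
  to be constant.\<close>

lemma generic_refl_B:
  assumes "generic B" shows "generic (refl_B B)"
  unfolding generic_def
proof (intro allI impI notI)
  fix c :: "nat \<Rightarrow> int"
  assume c: "\<exists>i\<in>{1..8}. \<exists>j\<in>{1..8}. c i \<noteq> c j"
    and rat: "(\<Sum>k\<in>{1..8}. of_int (c k) * refl_B B k) \<in> \<rat>"
  define D where "D = c 1 + c 2 + c 3 + c 4 - c 5 - c 6 - c 7 - c 8"
  define c' where "c' = (\<lambda>k. if k \<le> 4 then 2 * c k - D else 2 * c k)"
  have "(\<Sum>k\<in>{1..8}. of_int (c' k) * B k) = 2 * (\<Sum>k\<in>{1..8}. of_int (c k) * refl_B B k) + of_int D"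
    unfolding sum_1_8 c'_def refl_B_def sum_1_4 D_def by (simp add: field_simps)
  also have "\<dots> \<in> \<rat>" using rat by (intro Rats_add Rats_mult) auto
  finally have rat': "(\<Sum>k\<in>{1..8}. of_int (c' k) * B k) \<in> \<rat>" .
  have "c' k = c' 8" if "k \<in> {1..8}" for k
    using generic_lincomb[OF assms that, of 8 c'] rat' by fastforce
  from this[of 1] this[of 2] this[of 3] this[of 4] this[of 5] this[of 6] this[of 7]
  have "2 * c 1 - D = 2 * c 8" "2 * c 2 - D = 2 * c 8" "2 * c 3 - D = 2 * c 8" "2 * c 4 - D = 2 * c 8"
    "c 5 = c 8" "c 6 = c 8" "c 7 = c 8" by (simp_all add: c'_def)
  \<comment> \<open>The first four entries of \<open>c\<close> equal c 8 + D / 2, so the definition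
    of \<open>D\<close> reads D = 2 * D, and D = 0.\<close>
  hence "c k = c 8" if "k \<in> {1, 2, 3, 4, 5, 6, 7, 8}" for k using that unfolding D_def by auto
  with c show False unfolding atLeastAtMost_1_8 by metis
qed

lemma sum_refl_B: "(\<Sum>k\<in>{1..8}. refl_B B k) = (\<Sum>k\<in>{1..8}. B k)"
  unfolding sum_1_8 refl_B_def sum_1_4 by (simp add: field_simps)

context
  fixes x1 x2 x3 x4 y1 y2 y3 y4 :: nat
  assumes bl: "blocks x1 x2 x3 x4 y1 y2 y3 y4"
begin

lemma blocks_distinct: "distinct [x1, x2, x3, x4, y1, y2, y3, y4]"
  using bl by (simp add: blocks_def)

lemma blocks_cases:
  obtains "{x1, x2, x3, x4} = {1..4}" "{y1, y2, y3, y4} = {5..8}" |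
    "{x1, x2, x3, x4} = {5..8}" "{y1, y2, y3, y4} = {1..4}"
proof -
  have c: "card {x1, x2, x3, x4} = 4" "card {y1, y2, y3, y4} = 4"
    using blocks_distinct by simp_all
  have "{x1, x2, x3, x4} = S" if "{x1, x2, x3, x4} \<subseteq> S" "finite S" "card S = 4" for S
    using card_subset_eq[OF that(2,1)] that(3) c(1) by simp
  moreover have "{y1, y2, y3, y4} = S" if "{y1, y2, y3, y4} \<subseteq> S" "finite S" "card S = 4" for S
    using card_subset_eq[OF that(2,1)] that(3) c(2) by simp
  ultimately show ?thesis using bl that unfolding blocks_def
    by (elim conjE disjE) simp_all
qed

lemma blocks_set: "{x1, x2, x3, x4, y1, y2, y3, y4} = {1..8}"
proof -
  have "{x1, x2, x3, x4, y1, y2, y3, y4} = {x1, x2, x3, x4} \<union> {y1, y2, y3, y4}"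
    by auto
  also have "\<dots> = {1..4} \<union> {5..8}" by (rule blocks_cases) (simp_all only: Un_commute)
  also have "\<dots> = {1..8}" by auto
  finally show ?thesis .
qed

lemma blocks_sum: "(\<Sum>k\<in>{1..8}. f k) = f x1 + f x2 + f x3 + f x4 + f y1 + f y2 + f y3 + (f y4 :: 'a :: comm_monoid_add)"
  unfolding blocks_set[symmetric] using blocks_distinct by (simp add: add_ac)

lemma blocks_sum_lower:
  "(\<Sum>k\<in>{1..4}. f k) = (if x1 \<le> 4 then f x1 + f x2 + f x3 + f x4 else f y1 + f y2 + f y3 + (f y4 :: 'a :: comm_monoid_add))"
proof (rule blocks_cases)
  assume *: "{x1, x2, x3, x4} = {1..4}"
  have "x1 \<in> {1..4}" unfolding *[symmetric] by simp
  hence "x1 \<le> 4" by simp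
  with blocks_distinct show ?thesis unfolding *[symmetric] by (simp add: add_ac)
next
  assume *: "{x1, x2, x3, x4} = {5..8}" and **: "{y1, y2, y3, y4} = {1..4}"
  have "x1 \<in> {5..8}" unfolding *[symmetric] by simp
  hence "\<not> x1 \<le> 4" by simp
  with blocks_distinct show ?thesis unfolding **[symmetric] by (simp add: add_ac)
qed

lemma blocks_le_4:
  "x2 \<le> 4 \<longleftrightarrow> x1 \<le> 4" "x3 \<le> 4 \<longleftrightarrow> x1 \<le> 4" "x4 \<le> 4 \<longleftrightarrow> x1 \<le> 4"
  "y1 \<le> 4 \<longleftrightarrow> \<not> x1 \<le> 4" "y2 \<le> 4 \<longleftrightarrow> \<not> x1 \<le> 4" "y3 \<le> 4 \<longleftrightarrow> \<not> x1 \<le> 4" "y4 \<le> 4 \<longleftrightarrow> \<not> x1 \<le> 4"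
  using bl unfolding blocks_def by auto

lemma pairsP_blocks:
  "(\<Prod>(j, k)\<in>pairsP. gq (B j + B k) (N j + N k)) = pairprod B N x1 x2 x3 x4 * pairprod B N y1 y2 y3 y4"
proof -
  have d: "distinct [x1, x2, x3, x4]" "distinct [y1, y2, y3, y4]" using blocks_distinct by auto
  have s: "{1..4::nat} = {1, 2, 3, 4}" "{5..8::nat} = {5, 6, 7, 8}" by auto
  show ?thesis
  proof (rule blocks_cases)
    assume "{x1, x2, x3, x4} = {1..4}" "{y1, y2, y3, y4} = {5..8}"
    thus ?thesis using pairprod_perm[OF d(1), of 1 2 3 4] pairprod_perm[OF d(2), of 5 6 7 8]
      unfolding prod_pairsP by (simp only: s subset_refl mult.commute)
  next
    assume "{x1, x2, x3, x4} = {5..8}" "{y1, y2, y3, y4} = {1..4}"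
    thus ?thesis using pairprod_perm[OF d(1), of 5 6 7 8] pairprod_perm[OF d(2), of 1 2 3 4]
      unfolding prod_pairsP by (simp only: s subset_refl mult.commute)
  qed
qed

text \<open>The total 4 makes the reflection symmetric in the blocks: if L and L' = 4 - L are the
  two block sums, then -1 + L / 2 = 1 - L' / 2. The total -2 does the same for
  \<open>refl_B\<close>.\<close>

lemma Mshift_blocks:
  assumes "(\<Sum>k\<in>{1..8}. N k) = 4"
  shows "k \<in> {x1, x2, x3, x4} \<Longrightarrow> Mshift N k = N k + 1 - (N x1 + N x2 + N x3 + N x4) / 2"
    "k \<in> {y1, y2, y3, y4} \<Longrightarrow> Mshift N k = N k - 1 + (N x1 + N x2 + N x3 + N x4) / 2"
  using assms unfolding Mshift_def Lsum_def blocks_sum blocks_sum_lower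
  by (auto simp: blocks_le_4 field_simps)

lemma refl_B_blocks:
  assumes "(\<Sum>k\<in>{1..8}. B k) = - 2"
  shows "k \<in> {x1, x2, x3, x4} \<Longrightarrow> refl_B B k = B k - 1/2 - (B x1 + B x2 + B x3 + B x4) / 2"
    "k \<in> {y1, y2, y3, y4} \<Longrightarrow> refl_B B k = B k + 1/2 + (B x1 + B x2 + B x3 + B x4) / 2"
proof -
  have s: "B y1 + B y2 + B y3 + B y4 = - 2 - (B x1 + B x2 + B x3 + B x4)"
    using assms unfolding blocks_sum by (simp add: algebra_simps add_eq_0_iff2)
  show "k \<in> {x1, x2, x3, x4} \<Longrightarrow> refl_B B k = B k - 1/2 - (B x1 + B x2 + B x3 + B x4) / 2"
    "k \<in> {y1, y2, y3, y4} \<Longrightarrow> refl_B B k = B k + 1/2 + (B x1 + B x2 + B x3 + B x4) / 2"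
    unfolding refl_B_def blocks_sum_lower s
    by (auto simp: blocks_le_4 diff_divide_distrib add_divide_distrib)
qed

lemma index_ok_block_sum:
  assumes "index_ok N" shows "N x1 + N x2 + N x3 + N x4 \<in> \<int>" "N y1 + N y2 + N y3 + N y4 \<in> \<int>"
proof -
  have k: "N k - N 1 \<in> \<int>" if "k \<in> {1..8}" for k using assms that by (simp add: index_ok_def on_coset_def)
  have 2: "2 * N 1 \<in> \<int>" using assms by (simp add: index_ok_def on_coset_def)
  have x: "x1 \<in> {1..8}" "x2 \<in> {1..8}" "x3 \<in> {1..8}" "x4 \<in> {1..8}"
    "y1 \<in> {1..8}" "y2 \<in> {1..8}" "y3 \<in> {1..8}" "y4 \<in> {1..8}"
    unfolding blocks_set[symmetric] by simp_all
  have s: "a + b + c + d \<in> \<int>" if "a - N 1 \<in> \<int>" "b - N 1 \<in> \<int>" "c - N 1 \<in> \<int>" "d - N 1 \<in> \<int>" for a b c d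
  proof -
    have "(a - N 1) + (b - N 1) + (c - N 1) + (d - N 1) + 2 * N 1 + 2 * N 1 \<in> \<int>"
      using that 2 by (intro Ints_add)
    thus ?thesis by (simp add: algebra_simps)
  qed
  show "N x1 + N x2 + N x3 + N x4 \<in> \<int>" "N y1 + N y2 + N y3 + N y4 \<in> \<int>"
    by (intro s k x)+
qed

lemma refl_val_blocks:
  assumes "index_ok N" "(\<Sum>k\<in>{1..8}. N k) = 4"
  shows "refl_val B N = (-1) powi \<lfloor>N x1 + N x2 + N x3 + N x4\<rfloor> *
    (pairprod B N x1 x2 x3 x4 * pairprod B N y1 y2 y3 y4) * val (refl_B B) (Mshift N)"
proof -
  obtain l where l: "N x1 + N x2 + N x3 + N x4 = of_int l" using index_ok_block_sum[OF assms(1)] by (auto elim: Ints_cases)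
  have y: "N y1 + N y2 + N y3 + N y4 = of_int (4 - l)" using assms(2) l unfolding blocks_sum by simp
  \<comment> \<open>The two block sums add up to 4, so they have the same parity.\<close>
  have "(-1::complex) powi (4 - l) = (-1) powi l" by (simp add: power_int_minus_left)
  hence "(-1::complex) powi \<lfloor>Lsum N\<rfloor> = (-1) powi \<lfloor>N x1 + N x2 + N x3 + N x4\<rfloor>"
    unfolding Lsum_def blocks_sum_lower l y by simp
  thus ?thesis unfolding refl_val_def pairsP_blocks by simp
qed

end

text \<open>The reflection adapted to index sum 3. The constant 1/2, in place of the 1 of
  \<open>Mshift\<close>, makes raising an index of the x block before reflecting the same as raising
  it afterwards.\<close>

definition refl_base :: "nat \<Rightarrow> nat \<Rightarrow> nat \<Rightarrow> nat \<Rightarrow> (nat \<Rightarrow> real) \<Rightarrow> nat \<Rightarrow> real" where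
  "refl_base x1 x2 x3 x4 N k = (if k \<in> {x1, x2, x3, x4} then N k + 1/2 - (N x1 + N x2 + N x3 + N x4) / 2
     else N k - 1/2 + (N x1 + N x2 + N x3 + N x4) / 2)"

text \<open>A zero would make B i + B j or B i - B j rational, since N i + N j and N i - N j are
  integers. This permits division by the coefficients in the recurrences.\<close>

lemma generic_nonzero:
  assumes "generic B" "index_ok N" "i \<in> {1..8}" "j \<in> {1..8}" "r \<in> \<int>"
  defines "A \<equiv> \<lambda>k. B k + of_real (N k)"
  shows "A i + A j + of_real r \<noteq> 0" "i \<noteq> j \<Longrightarrow> A i - A j \<noteq> 0"
proof -
  have N: "N i + N j \<in> \<int>" "N i - N j \<in> \<int>"
  proof -
    have "N i - N 1 \<in> \<int>" "N j - N 1 \<in> \<int>" "2 * N 1 \<in> \<int>"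
      using assms(2-4) by (auto simp: index_ok_def on_coset_def)
    hence "(N i - N 1) + (N j - N 1) + 2 * N 1 \<in> \<int>" "(N i - N 1) - (N j - N 1) \<in> \<int>"
      by (blast intro: Ints_add Ints_diff)+
    thus "N i + N j \<in> \<int>" "N i - N j \<in> \<int>" by (simp_all add: algebra_simps)
  qed
  have rat: "- complex_of_real x \<in> \<rat>" if "x \<in> \<int>" for x
    using that Ints_subset_Rats by (auto elim!: Ints_cases)
  show "A i + A j + of_real r \<noteq> 0"
  proof
    assume "A i + A j + of_real r = 0"
    moreover have "B i + B j = (A i + A j + of_real r) - complex_of_real (N i + N j + r)" by (simp add: A_def)
    ultimately have "B i + B j = - complex_of_real (N i + N j + r)" by simp
    thus False using generic_sum2[OF assms(1,3,4)] rat[of "N i + N j + r"] N assms(5) by simp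
  qed
  show "A i - A j \<noteq> 0" if "i \<noteq> j"
  proof
    assume "A i - A j = 0"
    hence "B i - B j = - complex_of_real (N i - N j)" by (simp add: A_def algebra_simps)
    thus False using generic_diff[OF assms(1,3,4) that] rat[of "N i - N j"] N by simp
  qed
qed

lemma gq_pair_step:
  assumes "generic B" "index_ok N" "i \<in> {1..8}" "j \<in> {1..8}"
  shows "gq (B i + B j) (N i + N j + 1) = (B i + of_real (N i) + (B j + of_real (N j))) * gq (B i + B j) (N i + N j)"
    and "gq (B i + B j) (N i + N j) = (B i + of_real (N i) + (B j + of_real (N j)) - 1) * gq (B i + B j) (N i + N j - 1)"
proof -
  have "N i - N 1 \<in> \<int>" "N j - N 1 \<in> \<int>" "2 * N 1 \<in> \<int>"
    using assms(2-4) by (auto simp: index_ok_def on_coset_def)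
  hence "(N i - N 1) + (N j - N 1) + 2 * N 1 \<in> \<int>" by (blast intro: Ints_add)
  hence N: "N i + N j \<in> \<int>" by (simp add: algebra_simps)
  show "gq (B i + B j) (N i + N j + 1) = (B i + of_real (N i) + (B j + of_real (N j))) * gq (B i + B j) (N i + N j)"
    using gq_step[OF N, of "B i + B j"] generic_nonzero(1)[OF assms, of 0] by (simp add: algebra_simps)
  show "gq (B i + B j) (N i + N j) = (B i + of_real (N i) + (B j + of_real (N j)) - 1) * gq (B i + B j) (N i + N j - 1)"
    using gq_back[OF N, of "B i + B j"] generic_nonzero(1)[OF assms, of "- 1"] by (simp add: algebra_simps)
qed

text \<open>The pair sum rises by one, stays or drops by one according to how many of the two
  indices lie in \<open>U\<close>; the last case is solved for the larger index to avoid a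
  division.\<close>

lemma gq_pair_half:
  assumes "generic B" "index_ok N" "p \<in> {1..8}" "q \<in> {1..8}"
  shows "p \<in> U \<Longrightarrow> q \<in> U \<Longrightarrow> gq (B p + B q) (half_shift N U p + half_shift N U q) =
      (B p + of_real (N p) + (B q + of_real (N q))) * gq (B p + B q) (N p + N q)"
    "p \<in> U \<Longrightarrow> q \<notin> U \<Longrightarrow> gq (B p + B q) (half_shift N U p + half_shift N U q) = gq (B p + B q) (N p + N q)"
    "p \<notin> U \<Longrightarrow> q \<notin> U \<Longrightarrow> gq (B p + B q) (N p + N q) =
      (B p + of_real (N p) + (B q + of_real (N q)) - 1) * gq (B p + B q) (half_shift N U p + half_shift N U q)"
proof -
  show "gq (B p + B q) (half_shift N U p + half_shift N U q) =
      (B p + of_real (N p) + (B q + of_real (N q))) * gq (B p + B q) (N p + N q)" if "p \<in> U" "q \<in> U"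
  proof -
    have "half_shift N U p + half_shift N U q = N p + N q + 1" using that by (simp add: half_shift_def)
    thus ?thesis using gq_pair_step(1)[OF assms] by simp
  qed
  show "gq (B p + B q) (half_shift N U p + half_shift N U q) = gq (B p + B q) (N p + N q)" if "p \<in> U" "q \<notin> U"
  proof -
    have "half_shift N U p + half_shift N U q = N p + N q" using that by (simp add: half_shift_def)
    thus ?thesis by simp
  qed
  show "gq (B p + B q) (N p + N q) =
      (B p + of_real (N p) + (B q + of_real (N q)) - 1) * gq (B p + B q) (half_shift N U p + half_shift N U q)" if "p \<notin> U" "q \<notin> U"
  proof -
    have "half_shift N U p + half_shift N U q = N p + N q - 1" using that by (simp add: half_shift_def)
    thus ?thesis using gq_pair_step(2)[OF assms] by simp
  qed
qed

lemma pairprod_upd: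
  assumes "generic B" "index_ok N" "{i, j, k, l} \<subseteq> {1..8}" "distinct [i, j, k, l]"
  defines "A \<equiv> \<lambda>k. B k + of_real (N k)"
  shows "pairprod B (bump N i) i j k l = (A i + A j) * (A i + A k) * (A i + A l) * pairprod B N i j k l"
proof -
  have m: "i \<in> {1..8}" "j \<in> {1..8}" "k \<in> {1..8}" "l \<in> {1..8}" using assms(3) by auto
  have s: "gq (B i + B m) ((bump N i) i + (bump N i) m) = (A i + A m) * gq (B i + B m) (N i + N m)"
    if "m \<in> {1..8}" "m \<noteq> i" for m
  proof -
    have e: "(bump N i) i + (bump N i) m = N i + N m + 1" using that by simp
    show ?thesis unfolding e A_def by (rule gq_pair_step(1)[OF assms(1,2) m(1) that(1)])
  qed
  have "j \<noteq> i" "k \<noteq> i" "l \<noteq> i" using assms(4) by auto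
  thus ?thesis unfolding pairprod_def
    by (simp only: s[OF m(2)] s[OF m(3)] s[OF m(4)] not_False_eq_True) (simp add: mult_ac)
qed

lemma pairprod_upd_other:
  "m \<notin> {i, j, k, l} \<Longrightarrow> pairprod B (bump N m) i j k l = pairprod B N i j k l"
  unfolding pairprod_def by simp

lemma pairprod_half4:
  assumes "generic B" "index_ok N" "{i, j, k, l} \<subseteq> {1..8}" "{i, j, k, l} \<subseteq> U"
  defines "A \<equiv> \<lambda>k. B k + of_real (N k)"
  shows "pairprod B (half_shift N U) i j k l =
    (A i + A j) * (A i + A k) * (A i + A l) * (A j + A k) * (A j + A l) * (A k + A l) * pairprod B N i j k l"
proof -
  have m: "i \<in> {1..8}" "j \<in> {1..8}" "k \<in> {1..8}" "l \<in> {1..8}" using assms(3) by auto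
  have u: "i \<in> U" "j \<in> U" "k \<in> U" "l \<in> U" using assms(4) by auto
  note h = gq_pair_half(1)[OF assms(1,2)]
  show ?thesis unfolding pairprod_def A_def
      h[OF m(1,2) u(1,2)] h[OF m(1,3) u(1,3)] h[OF m(1,4) u(1,4)] h[OF m(2,3) u(2,3)] h[OF m(2,4) u(2,4)] h[OF m(3,4) u(3,4)]
    by (simp only: mult_ac)
qed

lemma pairprod_half3:
  assumes "generic B" "index_ok N" "{i, j, k, l} \<subseteq> {1..8}" "{i, j, k} \<subseteq> U" "l \<notin> U"
  defines "A \<equiv> \<lambda>k. B k + of_real (N k)"
  shows "pairprod B (half_shift N U) i j k l =
    (A i + A j) * (A i + A k) * (A j + A k) * pairprod B N i j k l"
proof -
  have m: "i \<in> {1..8}" "j \<in> {1..8}" "k \<in> {1..8}" "l \<in> {1..8}" using assms(3) by auto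
  have u: "i \<in> U" "j \<in> U" "k \<in> U" using assms(4) by auto
  note h = gq_pair_half(1)[OF assms(1,2)] and h' = gq_pair_half(2)[OF assms(1,2)]
  show ?thesis unfolding pairprod_def A_def
      h[OF m(1,2) u(1,2)] h[OF m(1,3) u(1,3)] h[OF m(2,3) u(2,3)]
      h'[OF m(1,4) u(1) assms(5)] h'[OF m(2,4) u(2) assms(5)] h'[OF m(3,4) u(3) assms(5)]
    by (simp only: mult_ac)
qed

lemma pairprod_half2:
  assumes "generic B" "index_ok N" "{i, j, k, l} \<subseteq> {1..8}" "{i, j} \<subseteq> U" "k \<notin> U" "l \<notin> U"
  defines "A \<equiv> \<lambda>k. B k + of_real (N k)"
  shows "(A k + A l - 1) * pairprod B (half_shift N U) i j k l = (A i + A j) * pairprod B N i j k l"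
proof -
  have m: "i \<in> {1..8}" "j \<in> {1..8}" "k \<in> {1..8}" "l \<in> {1..8}" using assms(3) by auto
  have u: "i \<in> U" "j \<in> U" using assms(4) by auto
  note h = gq_pair_half[OF assms(1,2)]
  show ?thesis unfolding pairprod_def A_def
      h(1)[OF m(1,2) u(1,2)] h(2)[OF m(1,3) u(1) assms(5)] h(2)[OF m(1,4) u(1) assms(6)]
      h(2)[OF m(2,3) u(2) assms(5)] h(2)[OF m(2,4) u(2) assms(6)] h(3)[OF m(3,4) assms(5,6)]
    by (simp only: mult_ac)
qed

lemma pairprod_half1:
  assumes "generic B" "index_ok N" "{i, j, k, l} \<subseteq> {1..8}" "i \<in> U" "j \<notin> U" "k \<notin> U" "l \<notin> U"
  defines "A \<equiv> \<lambda>k. B k + of_real (N k)"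
  shows "(A j + A k - 1) * (A j + A l - 1) * (A k + A l - 1) * pairprod B (half_shift N U) i j k l = pairprod B N i j k l"
proof -
  have m: "i \<in> {1..8}" "j \<in> {1..8}" "k \<in> {1..8}" "l \<in> {1..8}" using assms(3) by auto
  note h = gq_pair_half[OF assms(1,2)]
  show ?thesis unfolding pairprod_def A_def
      h(2)[OF m(1,2) assms(4,5)] h(2)[OF m(1,3) assms(4,6)] h(2)[OF m(1,4) assms(4,7)]
      h(3)[OF m(2,3) assms(5,6)] h(3)[OF m(2,4) assms(5,7)] h(3)[OF m(3,4) assms(6,7)]
    by (simp only: mult_ac)
qed

lemma powi_neg1_add1: "(-1::complex) powi \<lfloor>r + 1\<rfloor> = - ((-1) powi \<lfloor>r\<rfloor>)"
  and powi_neg1_add2: "(-1::complex) powi \<lfloor>r + 2\<rfloor> = (-1) powi \<lfloor>r\<rfloor>"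
  by (simp_all add: power_int_minus_left)

section \<open>Recurrences of the reflected sum\<close>

locale block_point =
  fixes x1 x2 x3 x4 y1 y2 y3 y4 :: nat and B :: "nat \<Rightarrow> complex" and N :: "nat \<Rightarrow> real"
  assumes bl: "blocks x1 x2 x3 x4 y1 y2 y3 y4"
    and B: "generic B" "(\<Sum>k\<in>{1..8}. B k) = - 2"
    and N: "index_ok N" "(\<Sum>k\<in>{1..8}. N k) = 3"
begin

definition "Nr = refl_base x1 x2 x3 x4 N"
definition "A k = B k + of_real (N k)"
definition "Ar k = refl_B B k + of_real (Nr k)"
definition "Y = A x1 + A x2 + A x3 + A x4"
definition "L = N x1 + N x2 + N x3 + N x4"
text \<open>Sign and pair product at the unshifted vector \<open>N\<close>; the prefactors of all
  shifted vectors are compared with it.\<close>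

definition sgn_C :: complex where
  "sgn_C = (-1) powi \<lfloor>L\<rfloor> * (pairprod B N x1 x2 x3 x4 * pairprod B N y1 y2 y3 y4)"
definition "V = val (refl_B B)"

abbreviation "X \<equiv> {x1, x2, x3, x4}"
abbreviation "Z \<equiv> {y1, y2, y3, y4}"
abbreviation "sum4 f \<equiv> f x1 + f x2 + f x3 + f x4"
abbreviation "a1 \<equiv> A x1"
abbreviation "b1 \<equiv> A y1"
abbreviation "a2 \<equiv> A x2"
abbreviation "b2 \<equiv> A y2"
abbreviation "a3 \<equiv> A x3"
abbreviation "b3 \<equiv> A y3"
abbreviation "a4 \<equiv> A x4"
abbreviation "b4 \<equiv> A y4"

lemma mem: "x1 \<in> {1..8}" "x2 \<in> {1..8}" "x3 \<in> {1..8}" "x4 \<in> {1..8}"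
    "y1 \<in> {1..8}" "y2 \<in> {1..8}" "y3 \<in> {1..8}" "y4 \<in> {1..8}"
  unfolding blocks_set[OF bl, symmetric] by simp_all

lemma mem4: "X \<subseteq> {1..8}" "Z \<subseteq> {1..8}"
  using mem by (simp_all del: atLeastAtMost_iff)

lemma dist: "distinct [x1, x2, x3, x4, y1, y2, y3, y4]" by (rule blocks_distinct[OF bl])

lemma Nr: "k \<in> X \<Longrightarrow> Nr k = N k + 1/2 - L / 2" "k \<in> Z \<Longrightarrow> Nr k = N k - 1/2 + L / 2"
  using dist unfolding Nr_def refl_base_def L_def by auto

lemma sum_A: "a1 + a2 + a3 + a4 + b1 + b2 + b3 + b4 = 1"
proof -
  have "(\<Sum>k\<in>{1..8}. A k) = 1" unfolding A_def sum.distrib of_real_sum[symmetric] using N(2) B(2) by simp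
  thus ?thesis unfolding blocks_sum[OF bl] .
qed

lemma Ar: "k \<in> X \<Longrightarrow> Ar k = A k - Y / 2" "k \<in> Z \<Longrightarrow> Ar k = A k + Y / 2"
proof -
  show "Ar k = A k - Y / 2" if k: "k \<in> X"
    unfolding Ar_def refl_B_blocks(1)[OF bl B(2) k] Nr(1)[OF k] A_def Y_def L_def
    by (simp add: add_divide_distrib)
  show "Ar k = A k + Y / 2" if k: "k \<in> Z"
    unfolding Ar_def refl_B_blocks(2)[OF bl B(2) k] Nr(2)[OF k] A_def Y_def L_def
    by (simp add: add_divide_distrib)
qed

lemma sum_Nr: "(\<Sum>k\<in>{1..8}. Nr k) = 3"
  using N(2) unfolding blocks_sum[OF bl] by (simp add: Nr)

lemma index_ok_Nr: "index_ok Nr"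
proof (rule on_coset_index_ok)
  obtain l where l: "L = of_int l" using index_ok_block_sum(1)[OF bl N(1)] unfolding L_def by (auto elim: Ints_cases)
  have ok: "on_coset (N 1) N" using N(1) by (simp add: index_ok_def)
  show "on_coset (N 1 + 1/2 - L / 2) Nr"
    unfolding on_coset_def
  proof (intro conjI ballI)
    have "2 * (N 1 + 1/2 - L / 2) = 2 * N 1 + of_int (1 - l)" by (simp add: l)
    thus "2 * (N 1 + 1/2 - L / 2) \<in> \<int>" using ok unfolding on_coset_def by (metis Ints_add Ints_of_int)
  next
    fix k :: nat assume k: "k \<in> {1..8}"
    hence "N k - N 1 \<in> \<int>" using ok by (simp add: on_coset_def)
    hence "(N k - N 1) + 0 \<in> \<int>" "(N k - N 1) + of_int (l - 1) \<in> \<int>" by (simp, metis Ints_add Ints_of_int)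
    moreover have "k \<in> X \<or> k \<in> Z" using k blocks_set[OF bl] by blast
    moreover have "Nr k - (N 1 + 1/2 - L / 2) = (N k - N 1) + 0" if "k \<in> X"
      unfolding Nr(1)[OF that] by simp
    moreover have "Nr k - (N 1 + 1/2 - L / 2) = (N k - N 1) + of_int (l - 1)" if "k \<in> Z"
      unfolding Nr(2)[OF that] by (simp add: l)
    ultimately show "Nr k - (N 1 + 1/2 - L / 2) \<in> \<int>" by metis
  qed
qed

lemma generic_refl: "generic (refl_B B)" by (rule generic_refl_B[OF B(1)])

lemma sum_refl: "(\<Sum>k\<in>{1..8}. refl_B B k) = - 2" using B(2) by (simp only: sum_refl_B)

lemma refl_point:
  assumes M: "index_ok M" "(\<Sum>k\<in>{1..8}. M k) = 4"
    and K: "\<And>k. k \<in> X \<Longrightarrow> K k = M k + 1 - sum4 M / 2"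
      "\<And>k. k \<in> Z \<Longrightarrow> K k = M k - 1 + sum4 M / 2"
  shows "refl_val B M = (-1) powi \<lfloor>sum4 M\<rfloor> *
    (pairprod B M x1 x2 x3 x4 * pairprod B M y1 y2 y3 y4) * V K"
proof -
  have "val (refl_B B) (Mshift M) = V K"
    unfolding V_def
  proof (rule val_cong)
    fix k :: nat assume "k \<in> {1..8}"
    hence "k \<in> X \<or> k \<in> Z" using blocks_set[OF bl] by blast
    thus "Mshift M k = K k" using K Mshift_blocks[OF bl M(2), of k] by fastforce
  qed
  thus ?thesis using refl_val_blocks[OF bl M] by simp
qed

text \<open>The block sum rises by one, which flips the sign; the three pair factors containing
  \<open>i\<close> go up one step; and by the choice of \<open>refl_base\<close> the reflected
  vector is again a unit shift.\<close>

lemma refl_val_upd_x: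
  assumes "{i, j, k, l} \<subseteq> X" "distinct [i, j, k, l]"
  shows "refl_val B (bump N i) =
    - sgn_C * ((A i + A j) * (A i + A k) * (A i + A l)) * V (bump Nr i)"
proof -
  have i: "i \<in> X" using assms by simp
  have sub: "X \<subseteq> {i, j, k, l}"
  proof -
    have "card {i, j, k, l} = 4" "card X = 4" using assms(2) dist by simp_all
    thus ?thesis using card_subset_eq[OF _ assms(1)] by simp
  qed
  have d: "distinct [x1, x2, x3, x4]" using dist by simp
  have i8: "i \<in> {1..8}" "{i, j, k, l} \<subseteq> {1..8}" using i assms(1) mem4 by blast+
  have sum: "sum4 (bump N i) = L + 1"
    using i dist by (auto simp: L_def)
  have iy: "i \<notin> Z" using i dist by auto
  have "refl_val B (bump N i) = (-1) powi \<lfloor>L + 1\<rfloor> *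
    (pairprod B (bump N i) x1 x2 x3 x4 * pairprod B (bump N i) y1 y2 y3 y4) * V (bump Nr i)"
    unfolding sum[symmetric]
  proof (rule refl_point[OF index_ok_upd[OF N(1)]])
    show "(\<Sum>k\<in>{1..8}. (bump N i) k) = 4" using sum_upd[OF i8(1), of N] N(2) by linarith
    fix k
    show "(bump Nr i) k = (bump N i) k + 1 - sum4 (bump N i) / 2"
      if "k \<in> X" unfolding sum using Nr(1)[OF that] Nr(1)[OF i] by (simp add: field_simps)
    show "(bump Nr i) k = (bump N i) k - 1 + sum4 (bump N i) / 2"
      if "k \<in> Z" unfolding sum using Nr(2)[OF that] that iy by (auto simp: field_simps)
  qed
  also have "pairprod B (bump N i) x1 x2 x3 x4 = pairprod B (bump N i) i j k l"
    by (rule pairprod_perm[OF d sub])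
  also have "\<dots> = (A i + A j) * (A i + A k) * (A i + A l) * pairprod B N i j k l"
    unfolding A_def by (rule pairprod_upd[OF B(1) N(1) i8(2) assms(2)])
  also have "pairprod B N i j k l = pairprod B N x1 x2 x3 x4"
    by (rule pairprod_perm[OF d sub, symmetric])
  also have "pairprod B (bump N i) y1 y2 y3 y4 = pairprod B N y1 y2 y3 y4"
    by (rule pairprod_upd_other[OF iy])
  finally show ?thesis unfolding powi_neg1_add1 sgn_C_def by (simp only: mult_minus_left mult_minus_right mult_ac)
qed

text \<open>The sum of the x block, and with it the sign, does not change. Relative to
  \<open>Nr\<close> the reflected vector is raised by 1/2 on the x block and at y1 and lowered by
  1/2 elsewhere: a unit shift has become a half shift.\<close>

lemma refl_val_upd_y:
  "refl_val B (bump N y1) =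
    sgn_C * ((b1 + b2) * (b1 + b3) * (b1 + b4)) * V (half_shift Nr {x1, x2, x3, x4, y1})"
proof -
  have d: "distinct [y1, y2, y3, y4]" using dist by simp
  have sum: "sum4 (bump N y1) = L"
    using dist by (auto simp: L_def)
  have "refl_val B (bump N y1) = (-1) powi \<lfloor>L\<rfloor> *
    (pairprod B (bump N y1) x1 x2 x3 x4 * pairprod B (bump N y1) y1 y2 y3 y4) *
    V (half_shift Nr {x1, x2, x3, x4, y1})"
    unfolding sum[symmetric]
  proof (rule refl_point[OF index_ok_upd[OF N(1)]])
    show "(\<Sum>k\<in>{1..8}. (bump N y1) k) = 4" using sum_upd[OF mem(5), of N] N(2) by linarith
    fix k
    show "half_shift Nr {x1, x2, x3, x4, y1} k = (bump N y1) k + 1 - sum4 (bump N y1) / 2"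
      if "k \<in> X" unfolding sum unfolding half_shift_def using Nr(1)[OF that] that dist by auto
    show "half_shift Nr {x1, x2, x3, x4, y1} k = (bump N y1) k - 1 + sum4 (bump N y1) / 2"
      if "k \<in> Z" unfolding sum unfolding half_shift_def using Nr(2)[OF that] that dist by auto
  qed
  also have "pairprod B (bump N y1) y1 y2 y3 y4 = (b1 + b2) * (b1 + b3) * (b1 + b4) * pairprod B N y1 y2 y3 y4"
    unfolding A_def by (rule pairprod_upd[OF B(1) N(1) mem4(2) d])
  also have "pairprod B (bump N y1) x1 x2 x3 x4 = pairprod B N x1 x2 x3 x4"
    by (rule pairprod_upd_other) (use dist in auto)
  finally show ?thesis unfolding sgn_C_def by (simp only: mult_minus_left mult_minus_right mult_ac)
qed

text \<open>Three indices of the x block go up and one goes down, so the block sum rises by one and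
  the half shift reflects to the same half shift. The pair y2, y3 is lowered, whence the factor on
  the left.\<close>

lemma refl_val_half_mixed:
  "(b2 + b3 - 1) * refl_val B (half_shift N {x1, x2, x3, y4, y1}) =
    - sgn_C * ((a1 + a2) * (a1 + a3) * (a2 + a3) * (b1 + b4)) *
      V (half_shift Nr {x1, x2, x3, y4, y1})"
proof -
  define U where "U = {x1, x2, x3, y4, y1}"
  have U: "x1 \<in> U" "x2 \<in> U" "x3 \<in> U" "x4 \<notin> U" "y1 \<in> U" "y4 \<in> U" "y2 \<notin> U" "y3 \<notin> U" "U \<subseteq> {1..8}" "card U = 5"
    using dist mem unfolding U_def by (auto simp del: atLeastAtMost_iff)
  have d: "distinct [y1, y2, y3, y4]" "distinct [y1, y4, y2, y3]" using dist by auto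
  have sum: "sum4 (half_shift N U) = L + 1"
    using U by (simp add: half_shift_def L_def)
  have "refl_val B (half_shift N U) = (-1) powi \<lfloor>L + 1\<rfloor> *
    (pairprod B (half_shift N U) x1 x2 x3 x4 * pairprod B (half_shift N U) y1 y2 y3 y4) * V (half_shift Nr U)"
    unfolding sum[symmetric]
  proof (rule refl_point[OF index_ok_half_shift[OF N(1)]])
    show "(\<Sum>k\<in>{1..8}. half_shift N U k) = 4" using sum_half_shift[OF U(9), of N] N(2) U(10) by linarith
    fix k
    show "half_shift Nr U k = half_shift N U k + 1 - (sum4 (half_shift N U)) / 2"
      if "k \<in> X" unfolding sum unfolding half_shift_def using Nr(1)[OF that] by (simp add: field_simps)
    show "half_shift Nr U k = half_shift N U k - 1 + (sum4 (half_shift N U)) / 2"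
      if "k \<in> Z" unfolding sum unfolding half_shift_def using Nr(2)[OF that] by (simp add: field_simps)
  qed
  also have "pairprod B (half_shift N U) x1 x2 x3 x4 = (a1 + a2) * (a1 + a3) * (a2 + a3) * pairprod B N x1 x2 x3 x4"
    unfolding A_def by (rule pairprod_half3[OF B(1) N(1) mem4(1)]) (use U in auto)
  finally have "(b2 + b3 - 1) * refl_val B (half_shift N U) = (-1) powi \<lfloor>L + 1\<rfloor> *
    ((a1 + a2) * (a1 + a3) * (a2 + a3) * pairprod B N x1 x2 x3 x4 *
    ((b2 + b3 - 1) * pairprod B (half_shift N U) y1 y2 y3 y4)) * V (half_shift Nr U)"
    by (simp only: mult_ac)
  also have "pairprod B (half_shift N U) y1 y2 y3 y4 = pairprod B (half_shift N U) y1 y4 y2 y3"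
    by (rule pairprod_perm[OF d(1)]) simp
  also have "(b2 + b3 - 1) * pairprod B (half_shift N U) y1 y4 y2 y3 = (b1 + b4) * pairprod B N y1 y4 y2 y3"
    unfolding A_def by (rule pairprod_half2[OF B(1) N(1)]) (use U mem4(2) in auto)
  also have "pairprod B N y1 y4 y2 y3 = pairprod B N y1 y2 y3 y4"
    by (rule pairprod_perm[OF d(2)]) simp
  finally show ?thesis unfolding U_def powi_neg1_add1 sgn_C_def by (simp only: mult_minus_left mult_minus_right mult_ac)
qed

text \<open>The counterpart of \<open>refl_val_upd_y\<close>: the block sum rises by two, the sign
  is kept, and the half shift reflects to a unit shift at y1.\<close>

lemma refl_val_half_block:
  "(b2 + b3 - 1) * (b2 + b4 - 1) * (b3 + b4 - 1) * refl_val B (half_shift N {x1, x2, x3, x4, y1}) =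
    sgn_C * ((a1 + a2) * (a1 + a3) * (a1 + a4) * (a2 + a3) * (a2 + a4) * (a3 + a4)) *
      V (bump Nr y1)"
proof -
  define U where "U = {x1, x2, x3, x4, y1}"
  have U: "x1 \<in> U" "x2 \<in> U" "x3 \<in> U" "x4 \<in> U" "y1 \<in> U" "y4 \<notin> U" "y2 \<notin> U" "y3 \<notin> U" "U \<subseteq> {1..8}" "card U = 5"
    using dist mem unfolding U_def by (auto simp del: atLeastAtMost_iff)
  have sum: "sum4 (half_shift N U) = L + 2"
    using U by (simp add: half_shift_def L_def)
  have "refl_val B (half_shift N U) = (-1) powi \<lfloor>L + 2\<rfloor> *
    (pairprod B (half_shift N U) x1 x2 x3 x4 * pairprod B (half_shift N U) y1 y2 y3 y4) * V (bump Nr y1)"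
    unfolding sum[symmetric]
  proof (rule refl_point[OF index_ok_half_shift[OF N(1)]])
    show "(\<Sum>k\<in>{1..8}. half_shift N U k) = 4" using sum_half_shift[OF U(9), of N] N(2) U(10) by linarith
    fix k
    show "(bump Nr y1) k = half_shift N U k + 1 - (sum4 (half_shift N U)) / 2"
      if "k \<in> X" unfolding sum unfolding half_shift_def using Nr(1)[OF that] that U dist by (auto simp: field_simps)
    show "(bump Nr y1) k = half_shift N U k - 1 + (sum4 (half_shift N U)) / 2"
      if "k \<in> Z"
    proof -
      have "k \<in> U \<longleftrightarrow> k = y1" using that U by auto
      thus ?thesis unfolding sum unfolding half_shift_def using Nr(2)[OF that] Nr(2)[of y1] by (auto simp: add_divide_distrib)
    qed
  qed
  also have "pairprod B (half_shift N U) x1 x2 x3 x4 =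
      (a1 + a2) * (a1 + a3) * (a1 + a4) * (a2 + a3) * (a2 + a4) * (a3 + a4) * pairprod B N x1 x2 x3 x4"
    unfolding A_def by (rule pairprod_half4[OF B(1) N(1) mem4(1)]) (use U in auto)
  finally have "(b2 + b3 - 1) * (b2 + b4 - 1) * (b3 + b4 - 1) * refl_val B (half_shift N U) = (-1) powi \<lfloor>L + 2\<rfloor> *
    ((a1 + a2) * (a1 + a3) * (a1 + a4) * (a2 + a3) * (a2 + a4) * (a3 + a4) * pairprod B N x1 x2 x3 x4 *
    ((b2 + b3 - 1) * (b2 + b4 - 1) * (b3 + b4 - 1) * pairprod B (half_shift N U) y1 y2 y3 y4)) * V (bump Nr y1)"
    by (simp only: mult_ac)
  also have "(b2 + b3 - 1) * (b2 + b4 - 1) * (b3 + b4 - 1) * pairprod B (half_shift N U) y1 y2 y3 y4 = pairprod B N y1 y2 y3 y4"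
    unfolding A_def by (rule pairprod_half1[OF B(1) N(1) mem4(2)]) (use U in auto)
  finally show ?thesis unfolding U_def powi_neg1_add2 sgn_C_def by (simp only: mult_minus_left mult_minus_right mult_ac)
qed

lemma Ar_sq_diff:
  "i \<in> X \<Longrightarrow> j \<in> X \<Longrightarrow> Ar i ^ 2 - Ar j ^ 2 = (A i - A j) * (A i + A j - Y)"
  "i \<in> X \<Longrightarrow> j \<in> Z \<Longrightarrow> Ar i ^ 2 - Ar j ^ 2 = (A i + A j) * (A i - A j - Y)"
  by (simp_all only: Ar) (simp_all add: power2_eq_square field_simps)

lemma Ar_add:
  "i \<in> X \<Longrightarrow> j \<in> X \<Longrightarrow> Ar i + Ar j = A i + A j - Y"
  "i \<in> X \<Longrightarrow> j \<in> Z \<Longrightarrow> Ar i + Ar j = A i + A j"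
  "i \<in> Z \<Longrightarrow> j \<in> Z \<Longrightarrow> Ar i + Ar j = A i + A j + Y"
  by (simp_all only: Ar) (simp_all add: field_simps)

lemma x_nonzero:
  "a1 + a2 \<noteq> 0" "a1 - a2 \<noteq> 0" "a3 + a4 \<noteq> 0"
proof -
  have "x1 \<noteq> x2" using dist by simp
  thus "a1 + a2 \<noteq> 0" "a1 - a2 \<noteq> 0" "a3 + a4 \<noteq> 0"
    using generic_nonzero[OF B(1) N(1) mem(1,2), of 0] generic_nonzero(1)[OF B(1) N(1) mem(3,4), of 0]
    by (simp_all add: A_def)
qed

lemma y4_eq: "b4 = 1 - (a1 + a2 + a3 + a4 + b1 + b2 + b3)"
  using sum_A by (simp add: algebra_simps)

text \<open>The reflected difference of squares is A i - A j times A i + A j - Y. The second factor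
  is minus the sum of the other two members of the block, and exactly these sums are supplied by the
  pair factors in \<open>refl_val_upd_x\<close>.\<close>

lemma refl_val_same_block:
  "(a1 ^ 2 - a2 ^ 2) * refl_val B (bump N x3) =
     (a1 ^ 2 - a3 ^ 2) * refl_val B (bump N x2) - (a2 ^ 2 - a3 ^ 2) * refl_val B (bump N x1)"
proof -
  define V1 where "V1 = V (bump Nr x1)"
  define V2 where "V2 = V (bump Nr x2)"
  define V3 where "V3 = V (bump Nr x3)"
  have r: "refl_val B (bump N x1) = - sgn_C * ((a1 + a2) * (a1 + a3) * (a1 + a4)) * V1"
    "refl_val B (bump N x2) = - sgn_C * ((a2 + a1) * (a2 + a3) * (a2 + a4)) * V2"
    "refl_val B (bump N x3) = - sgn_C * ((a3 + a1) * (a3 + a2) * (a3 + a4)) * V3"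
    unfolding V1_def V2_def V3_def by (rule refl_val_upd_x; use dist in auto)+
  have "(Ar x1 ^ 2 - Ar x2 ^ 2) * V3 = (Ar x1 ^ 2 - Ar x3 ^ 2) * V2 - (Ar x2 ^ 2 - Ar x3 ^ 2) * V1"
    unfolding V1_def V2_def V3_def V_def Ar_def
    by (rule three_term_unit_shifts[OF generic_refl index_ok_Nr sum_Nr]) (use mem in auto)
  hence "(a1 - a2) * (a1 + a2 - Y) * V3 =
      (a1 - a3) * (a1 + a3 - Y) * V2 - (a2 - a3) * (a2 + a3 - Y) * V1"
    by (simp only: Ar_sq_diff insertI1 insertI2)
  hence "(- sgn_C * (a1 + a2) * (a1 + a3) * (a2 + a3)) * ((a1 - a2) * (a1 + a2 - Y) * V3) =
    (- sgn_C * (a1 + a2) * (a1 + a3) * (a2 + a3)) *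
    ((a1 - a3) * (a1 + a3 - Y) * V2 - (a2 - a3) * (a2 + a3 - Y) * V1)" by simp
  thus ?thesis unfolding r Y_def by algebra
qed

text \<open>The shift at y1 is a half shift on the reflected side, so this unit-shift relation comes
  from \<open>three_term_half_shift\<close> at the reflected parameters. The common factor a3 + a4 =
  Y - a1 - a2 is cancelled.\<close>

lemma refl_val_cross_block:
  "(a1 ^ 2 - a2 ^ 2) * refl_val B (bump N y1) =
     (a1 ^ 2 - b1 ^ 2) * refl_val B (bump N x2) - (a2 ^ 2 - b1 ^ 2) * refl_val B (bump N x1)"
proof -
  define V1 where "V1 = V (bump Nr x1)"
  define V2 where "V2 = V (bump Nr x2)"
  define W where "W = V (half_shift Nr {x1, x2, x3, x4, y1})"
  have r: "refl_val B (bump N x1) = - sgn_C * ((a1 + a2) * (a1 + a3) * (a1 + a4)) * V1"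
    "refl_val B (bump N x2) = - sgn_C * ((a2 + a1) * (a2 + a3) * (a2 + a4)) * V2"
    unfolding V1_def V2_def by (rule refl_val_upd_x; use dist in auto)+
  have rW: "refl_val B (bump N y1) = sgn_C * ((b1 + b2) * (b1 + b3) * (b1 + b4)) * W"
    unfolding W_def by (rule refl_val_upd_y)
  have d: "distinct [x1, x2, x3, x4, y1, y2, y3, y4]" by (rule dist)
  have "(Ar y2 + Ar y3 - 1) * (Ar y2 + Ar y4 - 1) * (Ar y3 + Ar y4 - 1) * (Ar x1 ^ 2 - Ar x2 ^ 2) * W =
     (Ar x1 + (Ar y2 + Ar y3 + Ar y4 - 1)) * (Ar x1 + Ar x2) * (Ar x1 + Ar x3) * (Ar x1 + Ar x4) * (Ar x1 + Ar y1) * V2 -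
     (Ar x2 + (Ar y2 + Ar y3 + Ar y4 - 1)) * (Ar x2 + Ar x1) * (Ar x2 + Ar x3) * (Ar x2 + Ar x4) * (Ar x2 + Ar y1) * V1"
    unfolding V1_def V2_def W_def V_def Ar_def
    by (rule three_term_half_shift[OF generic_refl index_ok_Nr sum_Nr sum_refl d blocks_set[OF bl]])
  \<comment> \<open>As the sum of all \<open>A k\<close> is 1, the factor with the reflected
    \<sigma> becomes a1 - b1, which together with a1 + b1 gives the required a1 ^ 2 - b1 ^
    2.\<close>
  moreover have "Ar x1 + (Ar y2 + Ar y3 + Ar y4 - 1) = a1 - b1" "Ar x2 + (Ar y2 + Ar y3 + Ar y4 - 1) = a2 - b1"
    by (simp_all only: Ar insertI1 insertI2 y4_eq Y_def) (simp_all add: field_simps)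
  ultimately have "(b2 + b3 + Y - 1) * (b2 + b4 + Y - 1) * (b3 + b4 + Y - 1) * ((a1 - a2) * (a1 + a2 - Y)) * W =
     (a1 - b1) * (a1 + a2 - Y) * (a1 + a3 - Y) * (a1 + a4 - Y) * (a1 + b1) * V2 -
     (a2 - b1) * (a2 + a1 - Y) * (a2 + a3 - Y) * (a2 + a4 - Y) * (a2 + b1) * V1"
    by (simp only: Ar_sq_diff Ar_add insertI1 insertI2)
  hence "(a3 + a4) * ((b1 + b2) * (b1 + b3) * (b1 + b4) * (a1 - a2) * W) =
    (a3 + a4) * (- ((a1 - b1) * (a2 + a4) * (a2 + a3) * (a1 + b1) * V2) +
      (a2 - b1) * (a1 + a4) * (a1 + a3) * (a2 + b1) * V1)"
    unfolding y4_eq Y_def by algebra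
  hence "(b1 + b2) * (b1 + b3) * (b1 + b4) * (a1 - a2) * W =
    - ((a1 - b1) * (a2 + a4) * (a2 + a3) * (a1 + b1) * V2) +
      (a2 - b1) * (a1 + a4) * (a1 + a3) * (a2 + b1) * V1"
    using x_nonzero(3) mult_left_cancel by blast
  hence "(sgn_C * (a1 + a2)) * ((b1 + b2) * (b1 + b3) * (b1 + b4) * (a1 - a2) * W) =
    (sgn_C * (a1 + a2)) * (- ((a1 - b1) * (a2 + a4) * (a2 + a3) * (a1 + b1) * V2) +
      (a2 - b1) * (a1 + a4) * (a1 + a3) * (a2 + b1) * V1)" by simp
  thus ?thesis unfolding r rW by algebra
qed

text \<open>The mixed half-shift relation is its own mirror image: a sum over one x and one y is
  unchanged by reflection, while a1 + a2, a1 + a3, a2 + a3 and b2 + b3 - 1 turn into minus the sum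
  of the complementary pair, which the prefactors exchange.\<close>

lemma refl_val_half_mixed_rel:
  "(a4 + b2 - 1) * (a4 + b3 - 1) * (b2 + b3 - 1) * (a1 ^ 2 - a2 ^ 2) *
       refl_val B (half_shift N {x1, x2, x3, y4, y1}) =
     (a1 + (a4 + b2 + b3 - 1)) * (a1 + a2) * (a1 + a3) * (a1 + b4) * (a1 + b1) * refl_val B (bump N x2) -
     (a2 + (a4 + b2 + b3 - 1)) * (a2 + a1) * (a2 + a3) * (a2 + b4) * (a2 + b1) * refl_val B (bump N x1)"
proof -
  define V1 where "V1 = V (bump Nr x1)"
  define V2 where "V2 = V (bump Nr x2)"
  define W where "W = V (half_shift Nr {x1, x2, x3, y4, y1})"
  define R where "R = refl_val B (half_shift N {x1, x2, x3, y4, y1})"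
  define p1 where "p1 = (a1 + (a4 + b2 + b3 - 1)) * (a1 + b4) * (a1 + b1)"
  define p2 where "p2 = (a2 + (a4 + b2 + b3 - 1)) * (a2 + b4) * (a2 + b1)"
  define d where "d = (a4 + b2 - 1) * (a4 + b3 - 1)"
  have r: "refl_val B (bump N x1) = - sgn_C * ((a1 + a2) * (a1 + a3) * (a1 + a4)) * V1"
    "refl_val B (bump N x2) = - sgn_C * ((a2 + a1) * (a2 + a3) * (a2 + a4)) * V2"
    unfolding V1_def V2_def by (rule refl_val_upd_x; use dist in auto)+
  have rW: "(b2 + b3 - 1) * R = - sgn_C * ((a1 + a2) * (a1 + a3) * (a2 + a3) * (b1 + b4)) * W"
    unfolding W_def R_def by (rule refl_val_half_mixed)
  have dd: "distinct [x1, x2, x3, y4, y1, x4, y2, y3]" using dist by auto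
  have ss: "{x1, x2, x3, y4, y1, x4, y2, y3} = {1..8}" unfolding blocks_set[OF bl, symmetric] by auto
  have "(Ar x4 + Ar y2 - 1) * (Ar x4 + Ar y3 - 1) * (Ar y2 + Ar y3 - 1) * (Ar x1 ^ 2 - Ar x2 ^ 2) * W =
     (Ar x1 + (Ar x4 + Ar y2 + Ar y3 - 1)) * (Ar x1 + Ar x2) * (Ar x1 + Ar x3) * (Ar x1 + Ar y4) * (Ar x1 + Ar y1) * V2 -
     (Ar x2 + (Ar x4 + Ar y2 + Ar y3 - 1)) * (Ar x2 + Ar x1) * (Ar x2 + Ar x3) * (Ar x2 + Ar y4) * (Ar x2 + Ar y1) * V1"
    unfolding V1_def V2_def W_def V_def Ar_def
    by (rule three_term_half_shift[OF generic_refl index_ok_Nr sum_Nr sum_refl dd ss])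
  moreover have "Ar x1 + (Ar x4 + Ar y2 + Ar y3 - 1) = a1 + (a4 + b2 + b3 - 1)"
    "Ar x2 + (Ar x4 + Ar y2 + Ar y3 - 1) = a2 + (a4 + b2 + b3 - 1)"
    by (simp_all only: Ar insertI1 insertI2) (simp_all add: field_simps)
  ultimately have "(a4 + b2 - 1) * (a4 + b3 - 1) * (b2 + b3 + Y - 1) * ((a1 - a2) * (a1 + a2 - Y)) * W =
     (a1 + (a4 + b2 + b3 - 1)) * (a1 + a2 - Y) * (a1 + a3 - Y) * (a1 + b4) * (a1 + b1) * V2 -
     (a2 + (a4 + b2 + b3 - 1)) * (a2 + a1 - Y) * (a2 + a3 - Y) * (a2 + b4) * (a2 + b1) * V1"
    by (simp only: Ar_sq_diff Ar_add insertI1 insertI2)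
  moreover have "b2 + b3 + Y - 1 = - (b1 + b4)" unfolding y4_eq Y_def by simp
  moreover have "a1 + a2 - Y = - (a3 + a4)" "a1 + a3 - Y = - (a2 + a4)"
    "a2 + a1 - Y = - (a3 + a4)" "a2 + a3 - Y = - (a1 + a4)" unfolding Y_def by simp_all
  ultimately have "(a4 + b2 - 1) * (a4 + b3 - 1) * (- (b1 + b4)) * ((a1 - a2) * (- (a3 + a4))) * W =
     (a1 + (a4 + b2 + b3 - 1)) * (- (a3 + a4)) * (- (a2 + a4)) * (a1 + b4) * (a1 + b1) * V2 -
     (a2 + (a4 + b2 + b3 - 1)) * (- (a3 + a4)) * (- (a1 + a4)) * (a2 + b4) * (a2 + b1) * V1"
    by simp
  hence "(a3 + a4) * (d * (b1 + b4) * (a1 - a2) * W) =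
     (a3 + a4) * (p1 * (a2 + a4) * V2 - p2 * (a1 + a4) * V1)"
    unfolding d_def p1_def p2_def by algebra
  hence "d * (b1 + b4) * (a1 - a2) * W = p1 * (a2 + a4) * V2 - p2 * (a1 + a4) * V1"
    using x_nonzero(3) mult_left_cancel by blast
  hence "(- sgn_C * (a1 + a2) * (a1 + a3) * (a2 + a3) * (a1 + a2)) * (d * (b1 + b4) * (a1 - a2) * W) =
    (- sgn_C * (a1 + a2) * (a1 + a3) * (a2 + a3) * (a1 + a2)) *
    (p1 * (a2 + a4) * V2 - p2 * (a1 + a4) * V1)" by simp
  hence "d * ((b2 + b3 - 1) * R) * (a1 ^ 2 - a2 ^ 2) =
    p1 * (a1 + a2) * (a1 + a3) * refl_val B (bump N x2) -
    p2 * (a2 + a1) * (a2 + a3) * refl_val B (bump N x1)"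
    unfolding r rW by algebra
  thus ?thesis unfolding R_def[symmetric] d_def p1_def p2_def by algebra
qed

text \<open>The mirror image of \<open>refl_val_cross_block\<close>: the half shift becomes a unit
  shift, so the relation comes from \<open>three_term_unit_shifts\<close> at the reflected
  parameters.\<close>

lemma refl_val_half_block_rel:
  "(b2 + b3 - 1) * (b2 + b4 - 1) * (b3 + b4 - 1) * (a1 ^ 2 - a2 ^ 2) *
       refl_val B (half_shift N {x1, x2, x3, x4, y1}) =
     (a1 + (b2 + b3 + b4 - 1)) * (a1 + a2) * (a1 + a3) * (a1 + a4) * (a1 + b1) * refl_val B (bump N x2) -
     (a2 + (b2 + b3 + b4 - 1)) * (a2 + a1) * (a2 + a3) * (a2 + a4) * (a2 + b1) * refl_val B (bump N x1)"
proof -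
  define V1 where "V1 = V (bump Nr x1)"
  define V2 where "V2 = V (bump Nr x2)"
  define W where "W = V (bump Nr y1)"
  define R where "R = refl_val B (half_shift N {x1, x2, x3, x4, y1})"
  define c where "c = (b2 + b3 - 1) * (b2 + b4 - 1) * (b3 + b4 - 1)"
  have r: "refl_val B (bump N x1) = - sgn_C * ((a1 + a2) * (a1 + a3) * (a1 + a4)) * V1"
    "refl_val B (bump N x2) = - sgn_C * ((a2 + a1) * (a2 + a3) * (a2 + a4)) * V2"
    unfolding V1_def V2_def by (rule refl_val_upd_x; use dist in auto)+
  have rW: "c * R = sgn_C * ((a1 + a2) * (a1 + a3) * (a1 + a4) * (a2 + a3) * (a2 + a4) * (a3 + a4)) * W"
    unfolding W_def R_def c_def by (rule refl_val_half_block)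
  have "(Ar x1 ^ 2 - Ar x2 ^ 2) * W = (Ar x1 ^ 2 - Ar y1 ^ 2) * V2 - (Ar x2 ^ 2 - Ar y1 ^ 2) * V1"
    unfolding V1_def V2_def W_def V_def Ar_def
    by (rule three_term_unit_shifts[OF generic_refl index_ok_Nr sum_Nr]) (use mem in auto)
  hence "(a1 - a2) * (a1 + a2 - Y) * W =
      (a1 + b1) * (a1 - b1 - Y) * V2 - (a2 + b1) * (a2 - b1 - Y) * V1"
    by (simp only: Ar_sq_diff insertI1 insertI2)
  hence "(- sgn_C * (a1 + a2) * (a1 + a2) * (a1 + a3) * (a1 + a4) * (a2 + a3) * (a2 + a4)) *
      ((a1 - a2) * (a1 + a2 - Y) * W) =
    (- sgn_C * (a1 + a2) * (a1 + a2) * (a1 + a3) * (a1 + a4) * (a2 + a3) * (a2 + a4)) *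
      ((a1 + b1) * (a1 - b1 - Y) * V2 - (a2 + b1) * (a2 - b1 - Y) * V1)" by simp
  moreover have "a1 + (b2 + b3 + b4 - 1) = a1 - b1 - Y" "a2 + (b2 + b3 + b4 - 1) = a2 - b1 - Y"
    unfolding y4_eq Y_def by simp_all
  moreover have "a1 + a2 - Y = - (a3 + a4)" unfolding Y_def by simp
  ultimately have "(c * R) * (a1 ^ 2 - a2 ^ 2) =
     (a1 + (b2 + b3 + b4 - 1)) * (a1 + a2) * (a1 + a3) * (a1 + a4) * (a1 + b1) * refl_val B (bump N x2) -
     (a2 + (b2 + b3 + b4 - 1)) * (a2 + a1) * (a2 + a3) * (a2 + a4) * (a2 + b1) * refl_val B (bump N x1)"
    unfolding r rW by algebra
  thus ?thesis unfolding R_def[symmetric] c_def by (simp only: mult_ac)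
qed

end

section \<open>Connectedness of the index lattice\<close>

text \<open>The centre has index sum 3, so its eight unit shifts have the sum 4 of the theorem.
  Equality at all eight together is the property that can be passed on to neighbouring
  centres.\<close>

definition good :: "(nat \<Rightarrow> complex) \<Rightarrow> (nat \<Rightarrow> real) \<Rightarrow> bool" where
  "good B N \<longleftrightarrow> index_ok N \<and> (\<Sum>k\<in>{1..8}. N k) = 3 \<and>
     (\<forall>i\<in>{1..8}. val B (bump N i) = refl_val B (bump N i))"

lemma refl_val_cong:
  assumes "\<And>k. k \<in> {1..8} \<Longrightarrow> N k = N' k" shows "refl_val B N = refl_val B N'"
proof -
  have L: "Lsum N = Lsum N'" unfolding Lsum_def by (intro sum.cong) (use assms in auto)
  have "pairprod B N 1 2 3 4 = pairprod B N' 1 2 3 4" "pairprod B N 5 6 7 8 = pairprod B N' 5 6 7 8"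
    unfolding pairprod_def by (simp_all add: assms)
  moreover have "val (refl_B B) (Mshift N) = val (refl_B B) (Mshift N')"
    by (rule val_cong) (simp add: Mshift_def L assms)
  ultimately show ?thesis unfolding refl_val_def prod_pairsP L by simp
qed

lemma index_ok_cong:
  assumes "\<And>k. k \<in> {1..8} \<Longrightarrow> N k = N' k" "index_ok N" shows "index_ok N'"
  using assms(2) assms(1)[symmetric] unfolding index_ok_def on_coset_def by simp

lemma good_cong:
  assumes "\<And>k. k \<in> {1..8} \<Longrightarrow> N k = N' k" "good B N" shows "good B N'"
  unfolding good_def
proof (intro conjI ballI)
  have "index_ok N" using assms(2) by (simp add: good_def)
  thus "index_ok N'" by (rule index_ok_cong[rotated]) (rule assms(1))
  show "(\<Sum>k\<in>{1..8}. N' k) = 3" using assms unfolding good_def by (metis (no_types, lifting) sum.cong)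
  fix i :: nat assume i: "i \<in> {1..8}"
  have e: "(bump N i) k = (bump N' i) k" if "k \<in> {1..8}" for k using assms(1) that i by auto
  have "val B (bump N i) = val B (bump N' i)"
    "refl_val B (bump N i) = refl_val B (bump N' i)"
    by (rule val_cong refl_val_cong, erule e)+
  thus "val B (bump N' i) = refl_val B (bump N' i)"
    using assms(2) i unfolding good_def by metis
qed

lemma blocks_perm:
  assumes "blocks x1 x2 x3 x4 y1 y2 y3 y4"
  shows "blocks x1 x2 x4 x3 y1 y2 y3 y4" "blocks x1 x2 x3 x4 y2 y1 y3 y4"
    "blocks x1 x2 x3 x4 y3 y1 y2 y4" "blocks x1 x2 x3 x4 y4 y1 y2 y3" "blocks y1 y2 y3 y4 x1 x2 x3 x4"
  using assms unfolding blocks_def by (auto simp del: atLeastAtMost_iff)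

lemma (in block_point) eq_of_two:
  assumes "val B (bump N x1) = refl_val B (bump N x1)"
    "val B (bump N x2) = refl_val B (bump N x2)"
  shows "val B (bump N x3) = refl_val B (bump N x3)"
    "val B (bump N y1) = refl_val B (bump N y1)"
proof -
  have nz: "A x1 ^ 2 - A x2 ^ 2 \<noteq> 0"
    using x_nonzero by (simp add: power2_eq_square square_diff_square_factored)
  have "(A x1 ^ 2 - A x2 ^ 2) * val B (bump N k) =
     (A x1 ^ 2 - A k ^ 2) * val B (bump N x2) - (A x2 ^ 2 - A k ^ 2) * val B (bump N x1)"
    if "k \<in> {1..8}" for k
    unfolding A_def by (rule three_term_unit_shifts[OF B(1) N]) (use mem that in auto)
  from this[OF mem(3)] this[OF mem(5)]
  have "(A x1 ^ 2 - A x2 ^ 2) * val B (bump N x3) = (A x1 ^ 2 - A x2 ^ 2) * refl_val B (bump N x3)"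
    "(A x1 ^ 2 - A x2 ^ 2) * val B (bump N y1) = (A x1 ^ 2 - A x2 ^ 2) * refl_val B (bump N y1)"
    unfolding refl_val_same_block refl_val_cross_block by (simp_all add: assms)
  thus "val B (bump N x3) = refl_val B (bump N x3)"
    "val B (bump N y1) = refl_val B (bump N y1)" using nz by simp_all
qed

text \<open>On both sides the unit shifts obey the same three-term relations, and the leading
  coefficient A x1 ^ 2 - A x2 ^ 2 is nonzero by genericity; two values in one block therefore
  determine the rest.\<close>

lemma good_of_two:
  assumes bl: "blocks x1 x2 x3 x4 y1 y2 y3 y4" and "generic B" "(\<Sum>k\<in>{1..8}. B k) = - 2"
    and "index_ok N" "(\<Sum>k\<in>{1..8}. N k) = 3"
    and eq: "val B (bump N x1) = refl_val B (bump N x1)"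
    "val B (bump N x2) = refl_val B (bump N x2)"
  shows "good B N"
  unfolding good_def
proof (intro conjI ballI)
  fix i :: nat assume "i \<in> {1..8}"
  hence i: "i = x1 \<or> i = x2 \<or> i = x3 \<or> i = x4 \<or> i = y1 \<or> i = y2 \<or> i = y3 \<or> i = y4"
    using blocks_set[OF bl] by blast
  note e = block_point.eq_of_two[OF block_point.intro[OF _ assms(2-5)] eq]
  \<comment> \<open>A permutation within a block brings each remaining index to the place of x3 or
    y1.\<close>
  show "val B (bump N i) = refl_val B (bump N i)"
    using i eq e[OF bl] e[OF blocks_perm(1)[OF bl]] e[OF blocks_perm(2)[OF bl]]
      e[OF blocks_perm(3)[OF bl]] e[OF blocks_perm(4)[OF bl]] by (elim disjE) simp_all
qed (use assms in auto)

lemma (in block_point) eq_half_mixed: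
  assumes "good B N"
  shows "val B (half_shift N {x1, x2, x3, y4, y1}) = refl_val B (half_shift N {x1, x2, x3, y4, y1})"
proof -
  have e: "val B (bump N x1) = refl_val B (bump N x1)"
    "val B (bump N x2) = refl_val B (bump N x2)" using assms mem unfolding good_def by blast+
  have dd: "distinct [x1, x2, x3, y4, y1, x4, y2, y3]" using dist by auto
  have ss: "{x1, x2, x3, y4, y1, x4, y2, y3} = {1..8}" unfolding blocks_set[OF bl, symmetric] by auto
  define c where "c = (A x4 + A y2 - 1) * (A x4 + A y3 - 1) * (A y2 + A y3 - 1) * (A x1 ^ 2 - A x2 ^ 2)"
  have "A i + A j - 1 \<noteq> 0" if "i \<in> {1..8}" "j \<in> {1..8}" for i j
    using generic_nonzero(1)[OF B(1) N(1) that, of "- 1"] by (simp add: A_def)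
  hence "c \<noteq> 0" using x_nonzero mem unfolding c_def
    by (simp add: power2_eq_square square_diff_square_factored del: atLeastAtMost_iff)
  moreover have "c * val B (half_shift N {x1, x2, x3, y4, y1}) = c * refl_val B (half_shift N {x1, x2, x3, y4, y1})"
    unfolding c_def refl_val_half_mixed_rel
    using three_term_half_shift[OF B(1) N B(2) dd ss] unfolding A_def[symmetric] e .
  ultimately show ?thesis by simp
qed

lemma (in block_point) eq_half_block:
  assumes "good B N"
  shows "val B (half_shift N {x1, x2, x3, x4, y1}) = refl_val B (half_shift N {x1, x2, x3, x4, y1})"
proof -
  have e: "val B (bump N x1) = refl_val B (bump N x1)"
    "val B (bump N x2) = refl_val B (bump N x2)" using assms mem unfolding good_def by blast+
  define c where "c = (A y2 + A y3 - 1) * (A y2 + A y4 - 1) * (A y3 + A y4 - 1) * (A x1 ^ 2 - A x2 ^ 2)"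
  have "A i + A j - 1 \<noteq> 0" if "i \<in> {1..8}" "j \<in> {1..8}" for i j
    using generic_nonzero(1)[OF B(1) N(1) that, of "- 1"] by (simp add: A_def)
  hence "c \<noteq> 0" using x_nonzero mem unfolding c_def
    by (simp add: power2_eq_square square_diff_square_factored del: atLeastAtMost_iff)
  moreover have "c * val B (half_shift N {x1, x2, x3, x4, y1}) = c * refl_val B (half_shift N {x1, x2, x3, x4, y1})"
    unfolding c_def refl_val_half_block_rel
    using three_term_half_shift[OF B(1) N B(2) dist blocks_set[OF bl]] unfolding A_def[symmetric] e .
  ultimately show ?thesis by simp
qed

lemma half_shift_upd: "r \<notin> T \<Longrightarrow> (half_shift N T)(r := half_shift N T r + 1) = half_shift N (insert r T)"
  by (auto simp: half_shift_def fun_eq_iff)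

text \<open>Raising y1 or y2 after the four-element half shift gives a five-element half shift,
  where equality is already known. These are two unit shifts in the y block, so
  \<open>good_of_two\<close> applies with the blocks exchanged.\<close>

lemma good_half_shift:
  assumes bl: "blocks x1 x2 x3 x4 y1 y2 y3 y4" and B: "generic B" "(\<Sum>k\<in>{1..8}. B k) = - 2" and g: "good B N"
  shows "good B (half_shift N {x1, x2, x3, x4})" "good B (half_shift N {x1, x2, x3, y4})"
proof -
  have N: "index_ok N" "(\<Sum>k\<in>{1..8}. N k) = 3" using g unfolding good_def by auto
  note d = blocks_distinct[OF bl]
  have bl2: "blocks x1 x2 x3 x4 y2 y1 y3 y4" by (rule blocks_perm(2)[OF bl])
  note bp = block_point.intro[OF bl B N] and bp2 = block_point.intro[OF bl2 B N]
  note m = block_point.mem[OF bp]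
  have sub: "{x1, x2, x3, x4} \<subseteq> {1..8}" "{x1, x2, x3, y4} \<subseteq> {1..8}" using m by (simp_all del: atLeastAtMost_iff)
  have card: "card {x1, x2, x3, x4} = 4" "card {x1, x2, x3, y4} = 4" using d by simp_all
  have s: "(\<Sum>k\<in>{1..8}. half_shift N {x1, x2, x3, x4} k) = 3" "(\<Sum>k\<in>{1..8}. half_shift N {x1, x2, x3, y4} k) = 3"
    using sum_half_shift[OF sub(1), of N] sum_half_shift[OF sub(2), of N] N(2) card by linarith+
  note fin = good_of_two[OF blocks_perm(5)[OF bl] B index_ok_half_shift[OF N(1)]]
  have i: "insert y1 {x1, x2, x3, x4} = {x1, x2, x3, x4, y1}" "insert y2 {x1, x2, x3, x4} = {x1, x2, x3, x4, y2}"
    "insert y1 {x1, x2, x3, y4} = {x1, x2, x3, y4, y1}" "insert y2 {x1, x2, x3, y4} = {x1, x2, x3, y4, y2}" by auto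
  have n: "y1 \<notin> {x1, x2, x3, x4}" "y2 \<notin> {x1, x2, x3, x4}" "y1 \<notin> {x1, x2, x3, y4}" "y2 \<notin> {x1, x2, x3, y4}" using d by auto
  show "good B (half_shift N {x1, x2, x3, x4})"
    by (rule fin) (simp_all only: s(1) half_shift_upd[OF n(1)] half_shift_upd[OF n(2)] i
      block_point.eq_half_block[OF bp g] block_point.eq_half_block[OF bp2 g])
  show "good B (half_shift N {x1, x2, x3, y4})"
    by (rule fin) (simp_all only: s(2) half_shift_upd[OF n(3)] half_shift_upd[OF n(4)] i
      block_point.eq_half_mixed[OF bp g] block_point.eq_half_mixed[OF bp2 g])
qed

text \<open>The half shifts along y1, y2, y3, y4 and along x1, x2, x3, y4 are composed. They cancel
  except at x4, where both lower, and at y4, where both raise.\<close>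

lemma good_move_across:
  assumes bl: "blocks x1 x2 x3 x4 y1 y2 y3 y4" and B: "generic B" "(\<Sum>k\<in>{1..8}. B k) = - 2" and g: "good B N"
  shows "good B (N(x4 := N x4 - 1, y4 := N y4 + 1))"
proof (rule good_cong)
  have "good B (half_shift N {y1, y2, y3, y4})" by (rule good_half_shift(1)[OF blocks_perm(5)[OF bl] B g])
  thus "good B (half_shift (half_shift N {y1, y2, y3, y4}) {x1, x2, x3, y4})" by (rule good_half_shift(2)[OF bl B])
  fix k :: nat assume "k \<in> {1..8}"
  hence "k = x1 \<or> k = x2 \<or> k = x3 \<or> k = x4 \<or> k = y1 \<or> k = y2 \<or> k = y3 \<or> k = y4"
    using blocks_set[OF bl] by blast
  thus "half_shift (half_shift N {y1, y2, y3, y4}) {x1, x2, x3, y4} k = (N(x4 := N x4 - 1, y4 := N y4 + 1)) k"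
    using blocks_distinct[OF bl] by (elim disjE) (auto simp: half_shift_def)
qed

lemma blocks_exist:
  assumes "i \<in> {1..4}" "j \<in> {5..8}"
  obtains x1 x2 x3 y1 y2 y3 where "blocks x1 x2 x3 i y1 y2 y3 j"
proof -
  have "i = 1 \<or> i = 2 \<or> i = 3 \<or> i = 4" using assms by auto
  then obtain x1 x2 x3 where x: "distinct [x1, x2, x3, i]" "{x1, x2, x3, i} \<subseteq> {1..4}"
  proof (elim disjE)
    assume "i = 1" thus ?thesis using that[of 2 3 4] by simp
  next
    assume "i = 2" thus ?thesis using that[of 1 3 4] by simp
  next
    assume "i = 3" thus ?thesis using that[of 1 2 4] by simp
  next
    assume "i = 4" thus ?thesis using that[of 1 2 3] by simp
  qed
  have "j = 5 \<or> j = 6 \<or> j = 7 \<or> j = 8" using assms by auto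
  then obtain y1 y2 y3 where y: "distinct [y1, y2, y3, j]" "{y1, y2, y3, j} \<subseteq> {5..8}"
  proof (elim disjE)
    assume "j = 5" thus ?thesis using that[of 6 7 8] by simp
  next
    assume "j = 6" thus ?thesis using that[of 5 7 8] by simp
  next
    assume "j = 7" thus ?thesis using that[of 5 6 8] by simp
  next
    assume "j = 8" thus ?thesis using that[of 5 6 7] by simp
  qed
  have "{1..4} \<inter> {5..8::nat} = {}" by auto
  hence "blocks x1 x2 x3 i y1 y2 y3 j" unfolding blocks_def using x y by auto
  thus ?thesis by (rule that)
qed

lemma good_move:
  assumes B: "generic B" "(\<Sum>k\<in>{1..8}. B k) = - 2" and g: "good B N" and ij: "i \<in> {1..8}" "j \<in> {1..8}" "i \<noteq> j"
  shows "good B (N(i := N i - 1, j := N j + 1))"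
proof -
  have across: "good B (N(i := N i - 1, j := N j + 1))"
    if "(i \<in> {1..4} \<and> j \<in> {5..8}) \<or> (i \<in> {5..8} \<and> j \<in> {1..4})" "good B N" for i j N
    using that(1)
  proof
    assume "i \<in> {1..4} \<and> j \<in> {5..8}"
    then obtain x1 x2 x3 y1 y2 y3 where "blocks x1 x2 x3 i y1 y2 y3 j" using blocks_exist by metis
    thus ?thesis by (rule good_move_across[OF _ B that(2)])
  next
    assume "i \<in> {5..8} \<and> j \<in> {1..4}"
    then obtain x1 x2 x3 y1 y2 y3 where "blocks x1 x2 x3 j y1 y2 y3 i" using blocks_exist by metis
    hence "blocks y1 y2 y3 i x1 x2 x3 j" by (rule blocks_perm(5))
    thus ?thesis by (rule good_move_across[OF _ B that(2)])
  qed
  show ?thesis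
  proof (cases "(i \<in> {1..4} \<and> j \<in> {5..8}) \<or> (i \<in> {5..8} \<and> j \<in> {1..4})")
    case True
    thus ?thesis by (rule across[OF _ g])
  next
    case False
    \<comment> \<open>Both indices lie in one block; the move goes through an index \<open>m\<close>
      of the other block.\<close>
    define m :: nat where "m = (if i \<le> 4 then 5 else 1)"
    have m: "(i \<in> {1..4} \<and> m \<in> {5..8}) \<or> (i \<in> {5..8} \<and> m \<in> {1..4})"
      "(m \<in> {1..4} \<and> j \<in> {5..8}) \<or> (m \<in> {5..8} \<and> j \<in> {1..4})"
      using False ij by (auto simp: m_def)
    define N1 where "N1 = N(i := N i - 1, m := N m + 1)"
    have "good B N1" unfolding N1_def by (rule across[OF m(1) g])
    from across[OF m(2) this] have "good B (N1(m := N1 m - 1, j := N1 j + 1))" .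
    moreover have "N1(m := N1 m - 1, j := N1 j + 1) = N(i := N i - 1, j := N j + 1)"
      using m ij by (auto simp: N1_def fun_eq_iff)
    ultimately show ?thesis by simp
  qed
qed

text \<open>A nonzero \<open>d\<close> of sum zero has entries of both signs, and a move between two
  such indices lowers the sum of the absolute values by two.\<close>

lemma good_reachable:
  assumes B: "generic B" "(\<Sum>k\<in>{1..8}. B k) = - 2" and "good B M"
    and "\<And>k. k \<in> {1..8} \<Longrightarrow> N k = M k + of_int (d k)" "(\<Sum>k\<in>{1..8}. d k) = 0"
  shows "good B N"
  using assms(3-5)
proof (induction "\<Sum>k\<in>{1..8}. nat \<bar>d k\<bar>" arbitrary: d M rule: less_induct)
  case less
  show ?case
  proof (cases "\<exists>k\<in>{1..8}. d k \<noteq> 0")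
    case False
    thus ?thesis using good_cong[OF _ less.prems(1), of N] less.prems(2) by simp
  next
    case True
    have "\<exists>i\<in>{1..8}. d i < 0"
    proof (rule ccontr)
      assume "\<not> ?thesis"
      hence "\<forall>k\<in>{1..8}. d k = 0" using less.prems(3) sum_nonneg_eq_0_iff[of "{1..8}" d] by (simp add: not_less)
      thus False using True by blast
    qed
    then obtain i where i: "i \<in> {1..8}" "d i < 0" by blast
    have "\<exists>j\<in>{1..8}. d j > 0"
    proof (rule ccontr)
      assume "\<not> ?thesis"
      hence "\<forall>k\<in>{1..8}. d k = 0" using less.prems(3) sum_nonneg_eq_0_iff[of "{1..8}" "\<lambda>k. - d k"]
        by (simp add: not_less sum_negf)
      thus False using True by blast
    qed
    then obtain j where j: "j \<in> {1..8}" "d j > 0" by blast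
    have ij: "i \<noteq> j" using i j by auto
    define d' where "d' = d(i := d i + 1, j := d j - 1)"
    define M' where "M' = M(i := M i - 1, j := M j + 1)"
    have split: "sum f {1..8} = f i + (f j + sum f ({1..8} - {i} - {j}))" for f :: "nat \<Rightarrow> 'c :: comm_monoid_add"
      using i j ij by (subst sum.remove[of _ i], simp, simp, subst sum.remove[of _ j]) auto
    have rest: "sum (\<lambda>k. h (d' k)) ({1..8} - {i} - {j}) = sum (\<lambda>k. h (d k)) ({1..8} - {i} - {j})" for h :: "int \<Rightarrow> 'c :: comm_monoid_add"
      by (intro sum.cong) (auto simp: d'_def)
    show ?thesis
    proof (rule less.hyps)
      show "good B M'" unfolding M'_def by (rule good_move[OF B less.prems(1) i(1) j(1) ij])
      show "N k = M' k + of_int (d' k)" if "k \<in> {1..8}" for k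
        using less.prems(2)[OF that] ij by (auto simp: M'_def d'_def)
      show "(\<Sum>k\<in>{1..8}. d' k) = 0"
        using less.prems(3) rest[of "\<lambda>x. x"] ij unfolding split by (simp add: d'_def)
      show "(\<Sum>k\<in>{1..8}. nat \<bar>d' k\<bar>) < (\<Sum>k\<in>{1..8}. nat \<bar>d k\<bar>)"
        unfolding split[of "\<lambda>k. nat \<bar>d' k\<bar>"] split[of "\<lambda>k. nat \<bar>d k\<bar>"] rest[of "\<lambda>x. nat \<bar>x\<bar>"]
        using i j ij by (simp add: d'_def)
    qed
  qed
qed

section \<open>Residue sums over the actual poles\<close>

definition summand :: "(nat \<Rightarrow> complex) \<Rightarrow> (nat \<Rightarrow> real) \<Rightarrow> real \<Rightarrow> complex \<Rightarrow> complex" where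
  "summand B N n z = kern B N n z * (z + of_real n)"

lemma poles_in_summand:
  assumes "on_coset \<nu> N" "n \<in> coset \<nu>" "(\<Sum>k\<in>{1..8}. N k) = 4"
  shows "poles_in (kern_poles B N n) (uminus ` kern_poles B N (- n)) (summand B N n)"
  using poles_in_kern[OF assms(1,2), of "[:0, 1:]"] assms(3) unfolding summand_def by simp

text \<open>In contrast to the sum over \<open>lattice B\<close>, this remains the right quantity
  when the lattice meets its negative, as long as the actual plus-poles and minus-poles are
  disjoint.\<close>

definition res_sum :: "(nat \<Rightarrow> complex) \<Rightarrow> (nat \<Rightarrow> real) \<Rightarrow> real \<Rightarrow> complex" where
  "res_sum B N n = (\<Sum>p\<in>kern_poles B N n. residue (summand B N n) p)"

lemma res_sum_eq_0:
  assumes "on_coset \<nu> N" "n \<in> coset \<nu>" "(\<Sum>k\<in>{1..8}. N k) = 4"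
    and "(\<forall>k\<in>{1..8}. 1 \<le> N k + n) \<or> (\<forall>k\<in>{1..8}. 1 \<le> N k - n)"
  shows "res_sum B N n = 0"
  using assms(4)
proof
  assume "\<forall>k\<in>{1..8}. 1 \<le> N k + n"
  thus ?thesis unfolding res_sum_def using kern_poles_empty[of N n B] by (simp del: atLeastAtMost_iff)
next
  assume "\<forall>k\<in>{1..8}. 1 \<le> N k - n"
  hence "kern_poles B N (- n) = {}" by (intro kern_poles_empty) auto
  thus ?thesis unfolding res_sum_def using sum_residues_eq_0[OF poles_in_summand[OF assms(1-3), of B]] by simp
qed

lemma res_on_summand:
  assumes "generic B" "on_coset \<nu> N" "n \<in> coset \<nu>" "(\<Sum>k\<in>{1..8}. N k) = 4"
  shows "res_on (lattice B) (summand B N n) = res_sum B N n"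
  unfolding res_sum_def
proof (rule res_on_eq_sum[OF poles_in_summand[OF assms(2-4)] kern_poles_subset])
  show "lattice B \<inter> uminus ` kern_poles B N (- n) = {}"
    using lattice_disjoint[OF assms(1)] kern_poles_subset[of B N "- n"] by blast
qed

text \<open>Beyond the bound either the plus-poles or the minus-poles are absent. The range depends
  on \<open>N\<close> only, so limits in \<open>B\<close> may be taken term by term.\<close>

definition res_total :: "(nat \<Rightarrow> complex) \<Rightarrow> (nat \<Rightarrow> real) \<Rightarrow> complex" where
  "res_total B N = (\<Sum>n\<in>{n \<in> coset (N 1). \<bar>n\<bar> < 1 + (\<Sum>k\<in>{1..8}. \<bar>N k\<bar>)}. res_sum B N n)"

lemma res_sum_far:
  assumes "on_coset \<nu> N" "n \<in> coset \<nu>" "(\<Sum>k\<in>{1..8}. N k) = 4" "1 + (\<Sum>k\<in>{1..8}. \<bar>N k\<bar>) \<le> \<bar>n\<bar>"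
  shows "res_sum B N n = 0"
proof (rule res_sum_eq_0[OF assms(1-3)])
  have N: "\<bar>N k\<bar> \<le> (\<Sum>k\<in>{1..8}. \<bar>N k\<bar>)" if "k \<in> {1..8}" for k
    using that by (intro member_le_sum) auto
  have "1 \<le> N k + \<bar>n\<bar>" if "k \<in> {1..8}" for k using N[OF that] assms(4) by linarith
  thus "(\<forall>k\<in>{1..8}. 1 \<le> N k + n) \<or> (\<forall>k\<in>{1..8}. 1 \<le> N k - n)"
    by (cases "n \<ge> 0") auto
qed

lemma res_total_eq_infsum:
  assumes "on_coset \<nu> N" "(\<Sum>k\<in>{1..8}. N k) = 4"
  shows "res_total B N = (\<Sum>\<^sub>\<infinity>n\<in>coset \<nu>. res_sum B N n)"
proof -
  have "N 1 - \<nu> \<in> \<int>" using assms by (simp add: on_coset_def)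
  hence c: "coset (N 1) = coset \<nu>" by (rule coset_cong)
  have "infsum (res_sum B N) (coset \<nu>) = infsum (res_sum B N) {n \<in> coset \<nu>. \<bar>n\<bar> < 1 + (\<Sum>k\<in>{1..8}. \<bar>N k\<bar>)}"
    by (rule infsum_cong_neutral) (use res_sum_far[OF assms(1) _ assms(2)] in force)+
  thus ?thesis unfolding res_total_def c by (simp add: finite_coset_bounded)
qed

lemma val_eq_res_total:
  assumes "generic B" "index_ok N" "(\<Sum>k\<in>{1..8}. N k) = 4"
  shows "val B N = res_total B N"
proof -
  have ok: "on_coset (N 1) N" using assms(2) by (simp add: index_ok_def)
  have "val B N = (\<Sum>\<^sub>\<infinity>n\<in>coset (N 1). res_on (lattice B) (summand B N n))"
    unfolding val_def val_poly_def ressum_def summand_def by simp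
  also have "\<dots> = (\<Sum>\<^sub>\<infinity>n\<in>coset (N 1). res_sum B N n)"
    by (intro infsum_cong res_on_summand[OF assms(1) ok _ assms(3)])
  finally show ?thesis unfolding res_total_eq_infsum[OF ok assms(3)] .
qed

section \<open>The two base cases\<close>

lemma prod_1_8: "(\<Prod>k\<in>{1..8::nat}. f k) = f 1 * f 2 * f 3 * f 4 * f 5 * f 6 * f 7 * (f 8 :: 'a :: comm_monoid_mult)"
  by (simp add: atLeastAtMost_1_8 mult_ac del: One_nat_def)

lemma coset_half_cases: "n \<in> coset (1/2) \<Longrightarrow> n \<ge> 1/2 \<or> n \<le> - 1/2"
  and coset_half_far: "n \<in> coset (1/2) \<Longrightarrow> n \<noteq> 1/2 \<Longrightarrow> n \<noteq> - 1/2 \<Longrightarrow> n \<ge> 3/2 \<or> n \<le> - 3/2"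
proof -
  show "n \<ge> 1/2 \<or> n \<le> - 1/2" if "n \<in> coset (1/2)" for n
  proof -
    obtain i where i: "n - 1/2 = of_int i" using \<open>n \<in> coset (1/2)\<close> by (auto simp: coset_def elim: Ints_cases)
    have "i \<ge> 0 \<or> i \<le> - 1" by linarith
    hence "real_of_int i \<ge> 0 \<or> real_of_int i \<le> - 1" by linarith
    thus ?thesis using i by linarith
  qed
  show "n \<ge> 3/2 \<or> n \<le> - 3/2" if "n \<in> coset (1/2)" "n \<noteq> 1/2" "n \<noteq> - 1/2" for n
  proof -
    obtain i where i: "n - 1/2 = of_int i" using \<open>n \<in> coset (1/2)\<close> by (auto simp: coset_def elim: Ints_cases)
    have "i \<noteq> 0" "i \<noteq> - 1" using i that by auto
    hence "i \<ge> 1 \<or> i \<le> - 2" by linarith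
    hence "real_of_int i \<ge> 1 \<or> real_of_int i \<le> - 2" by linarith
    thus ?thesis using i by linarith
  qed
qed

text \<open>Every n \<ge> 1/2 leaves no plus-poles and every n \<le> - 1/2 no minus-poles; on this
  coset one of the two always holds.\<close>

lemma res_total_half:
  assumes "\<And>k. k \<in> {1..8} \<Longrightarrow> N k = 1/2"
  shows "res_total B N = 0"
proof -
  have z: "N k - 1/2 = 0" if "k \<in> {1..8}" for k using assms[OF that] by simp
  have ok: "on_coset (1/2) N" unfolding on_coset_def by (intro conjI ballI) (simp, simp only: z Ints_0)
  have "(\<Sum>k\<in>{1..8}. N k) = (\<Sum>k\<in>{1..8::nat}. 1/2)" by (intro sum.cong refl assms)
  hence s: "(\<Sum>k\<in>{1..8}. N k) = 4" by simp
  have "res_sum B N n = 0" if "n \<in> coset (1/2)" for n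
  proof (rule res_sum_eq_0[OF ok that s])
    have "1 \<le> N k + n" if "1/2 \<le> n" "k \<in> {1..8}" for k using assms[OF that(2)] that(1) by linarith
    moreover have "1 \<le> N k - n" if "n \<le> - 1/2" "k \<in> {1..8}" for k using assms[OF that(2)] that(1) by linarith
    ultimately show "(\<forall>k\<in>{1..8}. 1 \<le> N k + n) \<or> (\<forall>k\<in>{1..8}. 1 \<le> N k - n)"
      using coset_half_cases[OF \<open>n \<in> coset (1/2)\<close>] by blast
  qed
  thus ?thesis unfolding res_total_eq_infsum[OF ok s] by (simp add: infsum_0)
qed

definition base_N :: "nat \<Rightarrow> real" where
  "base_N k = (if k = 1 then 3/2 else if k = 2 then - 1/2 else 1/2)"

lemma gq_2: "gq b 2 = 1 + b" and gq_m1: "gq b (- 1) = 1 / (b * (b - 1))"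
proof -
  have "\<lfloor>2 - 1 :: real\<rfloor> = 1" "\<lfloor>- 1 - 1 :: real\<rfloor> = - 2" unfolding floor_eq_iff by simp_all
  thus "gq b 2 = 1 + b" "gq b (- 1) = 1 / (b * (b - 1))"
    unfolding gq_def pochR_def poch_def by (simp_all add: numeral_2_eq_2)
qed

lemma base_N_facts: "on_coset (1/2) base_N" "(\<Sum>k\<in>{1..8}. base_N k) = 4" "index_ok base_N"
proof -
  show ok: "on_coset (1/2) base_N" unfolding on_coset_def by (auto simp: base_N_def)
  show "(\<Sum>k\<in>{1..8}. base_N k) = 4" unfolding sum_1_8 by (simp add: base_N_def)
  show "index_ok base_N" by (rule on_coset_index_ok[OF ok])
qed

lemma summand_reflect: "summand B N (- n) (- z) = summand B N n z"
  unfolding summand_def kern_uminus by (simp add: algebra_simps)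

text \<open>Only n = 1/2 and n = - 1/2 contribute, and they contribute equally by reflection. At n =
  1/2 the sole plus-pole is z = - B 2, from the index 2 with N 2 + n = 0. Its residue carries 1/4,
  which doubles to 1/2.\<close>

lemma val_base:
  assumes "generic B"
  shows "val B base_N = (1 + B 1 - B 2) / 2 /
    ((B 3 + B 2) * (B 4 + B 2) * (B 5 + B 2) * (B 6 + B 2) * (B 7 + B 2) * (B 8 + B 2))"
proof -
  have ok: "on_coset (1/2) base_N" and s: "(\<Sum>k\<in>{1..8}. base_N k) = 4" by (rule base_N_facts)+
  have c: "1/2 \<in> coset (1/2)" "- 1/2 \<in> coset (1/2)" by (simp_all add: coset_def)
  have nz: "B i + B j \<noteq> of_rat r" if "i \<in> {1..8}" "j \<in> {1..8}" for i j r
    using generic_sum2[OF assms that] by (metis Rats_of_rat)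
  have nz2: "B k + B 2 \<noteq> 0" if "k \<in> {1..8}" for k using nz[of k 2 0] that by simp
  have zero: "res_sum B base_N n = 0" if "n \<in> coset (1/2)" "n \<noteq> 1/2" "n \<noteq> - 1/2" for n
    by (rule res_sum_eq_0[OF ok that(1) s]) (use coset_half_far[OF that] in \<open>auto simp: base_N_def\<close>)
  have "val B base_N = (\<Sum>\<^sub>\<infinity>n\<in>coset (1/2). res_sum B base_N n)"
    using val_eq_res_total[OF assms base_N_facts(3) s] res_total_eq_infsum[OF ok s] by simp
  also have "\<dots> = infsum (res_sum B base_N) {1/2, - 1/2}"
    by (rule infsum_cong_neutral) (use zero c in auto)
  also have "\<dots> = res_sum B base_N (1/2) + res_sum B base_N (- 1/2)" by simp
  also have "res_sum B base_N (- 1/2) = res_on (lattice B) (summand B base_N (- 1/2))"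
    by (rule res_on_summand[OF assms ok c(2) s, symmetric])
  also have "summand B base_N (- 1/2) = (\<lambda>z. summand B base_N (1/2) (- z))"
    using summand_reflect[of B base_N "1/2" "- z" for z] by (auto simp: fun_eq_iff)
  also have "res_on (lattice B) \<dots> = res_on (lattice B) (summand B base_N (1/2))"
  proof (rule res_on_reflect[OF lattice_disjoint[OF assms] poles_in_summand[OF ok c(1) s] kern_poles_subset])
    show "uminus ` kern_poles B base_N (- (1/2)) \<subseteq> uminus ` lattice B"
      by (intro image_mono kern_poles_subset)
  qed
  also have "\<dots> = res_sum B base_N (1/2)" by (rule res_on_summand[OF assms ok c(1) s])
  also have "res_sum B base_N (1/2) = residue (summand B base_N (1/2)) (- B 2)"
  proof -
    have "gpoles (B k) (base_N k + 1/2) = {}" if "k \<noteq> 2" for k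
      using that by (intro gpoles_empty) (auto simp: base_N_def)
    moreover have "gpoles (B 2) (base_N 2 + 1/2) = {- B 2}"
    proof -
      have "\<lfloor>base_N 2 + 1/2 - 1\<rfloor> = - 1" unfolding floor_eq_iff by (simp add: base_N_def)
      thus ?thesis unfolding gpoles_def by simp
    qed
    ultimately have "kern_poles B base_N (1/2) = {- B 2}" unfolding kern_poles_def
      by (subst UN_insert[of _ 2 "{1..8} - {2}", symmetric, unfolded insert_Diff_single] | force)+
    thus ?thesis by (simp add: res_sum_def)
  qed
  also have "\<dots> = (1 + B 1 - B 2) / 4 /
    ((B 3 + B 2) * (B 4 + B 2) * (B 5 + B 2) * (B 6 + B 2) * (B 7 + B 2) * (B 8 + B 2))"
  proof -
    define g where "g = (\<lambda>z. z * (z + 1/2) * (1 + B 1 + z) / ((B 2 - z) * (B 2 - z - 1)) /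
      ((B 3 - z) * (B 4 - z) * (B 5 - z) * (B 6 - z) * (B 7 - z) * (B 8 - z)))"
    define S where "S = - ({B 2, B 2 - 1} \<union> B ` {3..8})"
    have S: "open S" unfolding S_def by (intro open_Compl finite_imp_closed) auto
    have mem: "- B 2 \<in> S"
    proof -
      have "- B 2 \<noteq> B k" if "k \<in> {1..8}" for k using nz2[OF that] by (metis add.commute add.right_inverse)
      moreover have "- B 2 \<noteq> B 2 - 1" using nz[of 2 2 1] by (auto simp: algebra_simps add_eq_0_iff)
      moreover have "- B 2 \<noteq> B 2" using \<open>\<And>k. k \<in> {1..8} \<Longrightarrow> - B 2 \<noteq> B k\<close>[of 2] by simp
      moreover have "- B 2 \<notin> B ` {3..8}"
      proof
        assume "- B 2 \<in> B ` {3..8}"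
        then obtain k where "k \<in> {3..8}" "- B 2 = B k" by blast
        thus False using \<open>\<And>k. k \<in> {1..8} \<Longrightarrow> - B 2 \<noteq> B k\<close>[of k] by simp
      qed
      ultimately show ?thesis unfolding S_def by simp
    qed
    have nzS: "B 2 - z \<noteq> 0" "B 2 - z - 1 \<noteq> 0" "k \<in> {3..8} \<Longrightarrow> B k - z \<noteq> 0" if "z \<in> S" for z k
    proof -
      have e: "B 2 - z - 1 = (B 2 - 1) - z" by simp
      show "B 2 - z - 1 \<noteq> 0" unfolding e using that unfolding S_def by auto
      show "B 2 - z \<noteq> 0" "k \<in> {3..8} \<Longrightarrow> B k - z \<noteq> 0" using that unfolding S_def by auto
    qed
    have "g holomorphic_on S" unfolding g_def
      by (intro holomorphic_intros) (simp_all add: nzS del: right_minus_eq)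
    have "summand B base_N (1/2) = (\<lambda>z. g z / (z - (- B 2)))"
    proof
      fix z
      have K: "kern B base_N (1/2) z = z * ((1 + (B 1 + z)) * (1 / (B 2 + z) * (1 / ((B 2 - z) * ((B 2 - z) - 1)))) *
         (1 / (B 3 - z)) * (1 / (B 4 - z)) * (1 / (B 5 - z)) * (1 / (B 6 - z)) * (1 / (B 7 - z)) * (1 / (B 8 - z)))"
        unfolding kern_def prod_1_8 by (simp add: base_N_def gq_2 gq_1 gq_0 gq_m1)
      show "summand B base_N (1/2) z = g z / (z - (- B 2))"
      proof -
        have "z + of_real (1/2) = z + 1/2" "z - (- B 2) = B 2 + z" "1 + (B 1 + z) = 1 + B 1 + z" by simp_all
        thus ?thesis unfolding summand_def g_def K
          by (simp only: divide_inverse inverse_mult_distrib mult_1_left mult_ac)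
      qed
    qed
    hence "residue (summand B base_N (1/2)) (- B 2) = g (- B 2)"
      using residue_simple[OF S mem \<open>g holomorphic_on S\<close>] by simp
    also have "\<dots> = (1 + B 1 - B 2) / 4 /
      ((B 3 + B 2) * (B 4 + B 2) * (B 5 + B 2) * (B 6 + B 2) * (B 7 + B 2) * (B 8 + B 2))"
    proof -
      have "2 * B 2 \<noteq> 0" "2 * B 2 - 1 \<noteq> 0" using nz[of 2 2 0] nz[of 2 2 1] by auto
      \<comment> \<open>At z = - B 2 the factor z w cancels against the two denominator factors of
        index 2 with the opposite sign of z; no parameter is left.\<close>
      hence q: "(- B 2) * (- B 2 + 1/2) / ((B 2 - (- B 2)) * (B 2 - (- B 2) - 1)) = 1 / 4"
        by (simp add: field_simps)
      have "g (- B 2) = ((- B 2) * (- B 2 + 1/2) / ((B 2 - (- B 2)) * (B 2 - (- B 2) - 1))) * (1 + B 1 + (- B 2)) /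
        ((B 3 - (- B 2)) * (B 4 - (- B 2)) * (B 5 - (- B 2)) * (B 6 - (- B 2)) * (B 7 - (- B 2)) * (B 8 - (- B 2)))"
        by (simp only: g_def times_divide_eq_left)
      thus ?thesis unfolding q by simp
    qed
    finally show ?thesis .
  qed
  finally have v: "val B base_N = (1 + B 1 - B 2) / 4 /
    ((B 3 + B 2) * (B 4 + B 2) * (B 5 + B 2) * (B 6 + B 2) * (B 7 + B 2) * (B 8 + B 2)) + (1 + B 1 - B 2) / 4 /
    ((B 3 + B 2) * (B 4 + B 2) * (B 5 + B 2) * (B 6 + B 2) * (B 7 + B 2) * (B 8 + B 2))" .
  have "x / 4 / P + x / 4 / P = x / 2 / P" for x P :: complex
    by (cases "P = 0") (simp_all add: field_simps)
  thus ?thesis unfolding v .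
qed

text \<open>The block sum is 2, so \<open>Mshift\<close> fixes \<open>base_N\<close>. Reflection
  replaces B 3 + B 2 and B 4 + B 2 by - (1 + B 1 + B 4) and - (1 + B 1 + B 3), and the pair product
  compensates exactly for this.\<close>

lemma refl_val_base:
  assumes B: "generic B" "(\<Sum>k\<in>{1..8}. B k) = - 2"
  shows "val B base_N = refl_val B base_N"
proof -
  have M: "val (refl_B B) (Mshift base_N) = val (refl_B B) base_N"
  proof (rule val_cong)
    fix k :: nat
    have "Lsum base_N = 2" unfolding Lsum_def sum_1_4 by (simp add: base_N_def)
    thus "Mshift base_N k = base_N k" by (simp add: Mshift_def)
  qed
  have L: "Lsum base_N = 2" unfolding Lsum_def sum_1_4 by (simp add: base_N_def)
  have pp: "pairprod B base_N 1 2 3 4 = (1 + (B 1 + B 3)) * (1 + (B 1 + B 4)) / ((B 2 + B 3) * (B 2 + B 4))"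
    "pairprod B base_N 5 6 7 8 = 1"
    unfolding pairprod_def by (simp_all add: base_N_def gq_2 gq_1 gq_0)
  have r: "refl_B B 1 - refl_B B 2 = B 1 - B 2" "refl_B B 3 + refl_B B 2 = - (1 + B 1 + B 4)"
    "refl_B B 4 + refl_B B 2 = - (1 + B 1 + B 3)" "refl_B B 5 + refl_B B 2 = B 5 + B 2"
    "refl_B B 6 + refl_B B 2 = B 6 + B 2" "refl_B B 7 + refl_B B 2 = B 7 + B 2" "refl_B B 8 + refl_B B 2 = B 8 + B 2"
    unfolding refl_B_def sum_1_4 by (simp_all add: field_simps)
  have nz: "1 + B 1 + B 4 \<noteq> 0" "1 + B 1 + B 3 \<noteq> 0"
    using generic_nonzero(1)[OF B(1), of "\<lambda>_. 0" 1 4 1] generic_nonzero(1)[OF B(1), of "\<lambda>_. 0" 1 3 1]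
    by (simp_all add: index_ok_def on_coset_def add_ac)
  have v: "val (refl_B B) base_N = (1 + (B 1 - B 2)) / 2 /
    ((1 + B 1 + B 4) * (1 + B 1 + B 3) * (B 5 + B 2) * (B 6 + B 2) * (B 7 + B 2) * (B 8 + B 2))"
    unfolding val_base[OF generic_refl_B[OF B(1)]] r add_diff_eq[symmetric] minus_mult_minus by simp
  have "refl_val B base_N = (1 + (B 1 + B 3)) * (1 + (B 1 + B 4)) / ((B 2 + B 3) * (B 2 + B 4)) *
     ((1 + (B 1 - B 2)) / 2 /
    ((1 + B 1 + B 4) * (1 + B 1 + B 3) * (B 5 + B 2) * (B 6 + B 2) * (B 7 + B 2) * (B 8 + B 2)))"
    unfolding refl_val_def prod_pairsP M L pp v by simp
  also have "\<dots> = val B base_N" unfolding val_base[OF B(1)] using nz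
    by (simp add: divide_simps add_ac)
  finally show ?thesis ..
qed

text \<open>One good centre suffices: raising index 1 or 2 of \<open>N0\<close> gives the two base
  cases. Moves from it reach all half-integral vectors, and one half shift of it is a good centre
  for the integral ones.\<close>

lemma generic_symmetry:
  assumes B: "generic B" "(\<Sum>k\<in>{1..8}. B k) = - 2" and N: "index_ok N" "(\<Sum>k\<in>{1..8}. N k) = 4"
  shows "val B N = refl_val B N"
proof -
  define N0 :: "nat \<Rightarrow> real" where "N0 = (\<lambda>k. if k = 2 then - 1/2 else 1/2)"
  have ok0: "on_coset (1/2) N0" by (auto simp: on_coset_def N0_def)
  have e1: "bump N0 1 = base_N" by (auto simp: N0_def base_N_def fun_eq_iff)
  have half: "(bump N0 2) k = 1/2" for k by (simp add: N0_def)
  have okh: "index_ok (bump N0 2)" by (rule index_ok_upd[OF on_coset_index_ok[OF ok0]])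
  have "Mshift (bump N0 2) k = 1/2" for k
    unfolding Mshift_def Lsum_def half by simp
  hence "val (refl_B B) (Mshift (bump N0 2)) = val (refl_B B) (\<lambda>_. 1/2)" by (rule val_cong)
  also have "\<dots> = 0" using generic_refl_B[OF B(1)]
    by (subst val_eq_res_total) (auto simp: res_total_half index_ok_def on_coset_def)
  finally have "refl_val B (bump N0 2) = 0" by (simp add: refl_val_def)
  moreover have "val B (bump N0 2) = 0"
  proof -
    have "(\<Sum>k\<in>{1..8}. (bump N0 2) k) = 4" unfolding half by simp
    thus ?thesis using val_eq_res_total[OF B(1) okh] res_total_half[of "bump N0 2" B] half by metis
  qed
  ultimately have e2: "val B (bump N0 2) = refl_val B (bump N0 2)" by simp
  have bl: "blocks 1 2 3 4 5 6 7 8" by (simp add: blocks_def)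
  have sum0: "(\<Sum>k\<in>{1..8}. N0 k) = 3" unfolding sum_1_8 by (simp add: N0_def)
  have g0: "good B N0"
    by (rule good_of_two[OF bl B on_coset_index_ok[OF ok0] sum0 _ e2]) (simp only: e1 refl_val_base[OF B])
  have reach: "val B N = refl_val B N" if M: "good B M" and d: "\<And>k. k \<in> {1..8} \<Longrightarrow> N k - M k \<in> \<int>" for M
  proof -
    \<comment> \<open>A centre of index sum 3 that has \<open>N\<close> as its unit shift at
      1.\<close>
    define N' where "N' = N(1 := N 1 - 1)"
    define d where "d = (\<lambda>k. \<lfloor>N' k - M k\<rfloor>)"
    have dk: "N' k = M k + of_int (d k)" if k: "k \<in> {1..8}" for k
    proof -
      have "N' k - M k \<in> \<int>"
      proof (cases "k = 1")
        case True
        have "N 1 - M 1 - 1 \<in> \<int>" using Ints_diff[OF d[of 1] Ints_1] by simp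
        thus ?thesis using True by (simp add: N'_def algebra_simps)
      qed (use d[OF k] in \<open>simp add: N'_def\<close>)
      thus ?thesis unfolding d_def by (auto elim!: Ints_cases simp: algebra_simps)
    qed
    have "(\<Sum>k\<in>{1..8}. N' k) = 3" using N(2) unfolding sum_1_8 by (simp add: N'_def)
    moreover have "(\<Sum>k\<in>{1..8}. M k) = 3" using M by (simp add: good_def)
    moreover have "(\<Sum>k\<in>{1..8}. N' k) = (\<Sum>k\<in>{1..8}. M k + of_int (d k))" using dk by (intro sum.cong) auto
    ultimately have "real_of_int (\<Sum>k\<in>{1..8}. d k) = 0" by (simp add: sum.distrib)
    hence "(\<Sum>k\<in>{1..8}. d k) = 0" by linarith
    with dk have "good B N'" by (intro good_reachable[OF B M, where d = d])
    moreover have "bump N' 1 = N" by (auto simp: N'_def)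
    ultimately show ?thesis unfolding good_def by (metis atLeastAtMost_iff le_refl one_le_numeral)
  qed
  have Nk: "N k - N 1 \<in> \<int>" if "k \<in> {1..8}" for k using N(1) that by (simp add: index_ok_def on_coset_def)
  obtain i where i: "2 * N 1 = of_int i" using N(1) by (auto simp: index_ok_def on_coset_def elim: Ints_cases)
  show ?thesis
  proof (cases "even i")
    case False
    then obtain j where "i = 2 * j + 1" by (auto elim: oddE)
    hence N1: "N 1 - 1/2 = of_int j" using i by simp
    show ?thesis
    proof (rule reach[OF g0])
      fix k :: nat assume k: "k \<in> {1..8}"
      have "(N k - N 1) + of_int j + (if k = 2 then 1 else 0) \<in> \<int>" using Nk[OF k] by (intro Ints_add) auto
      thus "N k - N0 k \<in> \<int>" by (cases "k = 2") (simp_all add: N0_def N1[symmetric] algebra_simps)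
    qed
  next
    case True
    then obtain j where "i = 2 * j" by (auto elim: evenE)
    hence N1: "N 1 = of_int j" using i by simp
    show ?thesis
    proof (rule reach[OF good_half_shift(1)[OF bl B g0]])
      fix k :: nat assume k: "k \<in> {1..8}"
      have "half_shift N0 {1, 2, 3, 4} k \<in> {- 1, 0, 1}" by (auto simp: half_shift_def N0_def)
      hence hs: "half_shift N0 {1, 2, 3, 4} k \<in> \<int>" by auto
      have "(N k - N 1) + of_int j - half_shift N0 {1, 2, 3, 4} k \<in> \<int>" by (rule Ints_diff[OF Ints_add[OF Nk[OF k] Ints_of_int] hs])
      thus "N k - half_shift N0 {1, 2, 3, 4} k \<in> \<int>" by (simp add: N1[symmetric])
    qed
  qed
qed

section \<open>Contour integrals as residues\<close>

lemma cseg_ends: "pathstart (cseg \<gamma> R) = \<gamma> (- R)" "pathfinish (cseg \<gamma> R) = \<gamma> R"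
  by (simp_all add: pathstart_def pathfinish_def cseg_def)

lemma path_image_cseg: "path_image (cseg \<gamma> R) \<subseteq> range \<gamma>"
  by (auto simp: path_image_def cseg_def)

text \<open>A common point would have winding number both 1 and 0. The existence of contours thus
  supplies the disjointness that stands in for genericity.\<close>

lemma sep_contour_disjoint:
  assumes "sep_contour \<gamma> P Q" shows "P \<inter> Q = {}"
proof (rule ccontr)
  assume "P \<inter> Q \<noteq> {}"
  then obtain p where p: "p \<in> P" "p \<in> Q" by blast
  obtain R0 where
    "\<forall>p\<in>P. \<forall>R\<ge>R0. norm p < R \<longrightarrow> winding_number (cseg \<gamma> R +++ part_circlepath 0 R 0 pi) p = 1"
    "\<forall>p\<in>Q. \<forall>R\<ge>R0. norm p < R \<longrightarrow> winding_number (cseg \<gamma> R +++ part_circlepath 0 R 0 pi) p = 0"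
    using assms unfolding sep_contour_def by (elim exE conjE) (rule that)
  hence R0:
    "\<And>p R. p \<in> P \<Longrightarrow> R \<ge> R0 \<Longrightarrow> norm p < R \<Longrightarrow> winding_number (cseg \<gamma> R +++ part_circlepath 0 R 0 pi) p = 1"
    "\<And>p R. p \<in> Q \<Longrightarrow> R \<ge> R0 \<Longrightarrow> norm p < R \<Longrightarrow> winding_number (cseg \<gamma> R +++ part_circlepath 0 R 0 pi) p = 0"
    by simp_all
  define R where "R = max R0 (norm p + 1)"
  have "R \<ge> R0" "norm p < R" by (simp_all add: R_def less_max_iff_disj)
  from R0(1)[OF p(1) this] R0(2)[OF p(2) this] show False by simp
qed

text \<open>The contour is closed by the upper half circle. The loop winds once around
  \<open>P\<close> and not around \<open>Q\<close>, and the arc contributes at most pi C /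
  R.\<close>

lemma cint_eq_residues:
  assumes sep: "sep_contour \<gamma> P Q" and f: "poles_in P Q f"
  shows "cint f \<gamma> = 2 * pi * \<i> * (\<Sum>p\<in>P. residue f p)"
proof -
  have fin: "finite P" "finite Q" and hol: "f holomorphic_on - (P \<union> Q)" using f by (auto simp: poles_in_def)
  obtain C R1 where CR: "C > 0" "R1 > 0" "\<And>z. norm z \<ge> R1 \<Longrightarrow> norm (f z) \<le> C / norm z ^ 2"
    using f unfolding poles_in_def by (elim conjE) (rule bigo_inverse_square_bound, assumption, rule that)
  obtain R0 where R: "R0 > 0 \<and> (\<forall>t. R0 \<le> \<bar>t\<bar> \<longrightarrow> \<gamma> t = of_real t) \<and>
        (\<forall>R\<ge>R0. valid_path (cseg \<gamma> R)) \<and> (\<forall>p\<in>P \<union> Q. p \<notin> range \<gamma>) \<and>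
        (\<forall>p\<in>P. \<forall>R\<ge>R0. norm p < R \<longrightarrow> winding_number (cseg \<gamma> R +++ part_circlepath 0 R 0 pi) p = 1) \<and>
        (\<forall>p\<in>Q. \<forall>R\<ge>R0. norm p < R \<longrightarrow> winding_number (cseg \<gamma> R +++ part_circlepath 0 R 0 pi) p = 0)"
    using sep unfolding sep_contour_def by (elim exE conjE) (rule that, intro conjI)
  hence R0: "R0 > 0" "\<And>t. R0 \<le> \<bar>t\<bar> \<Longrightarrow> \<gamma> t = of_real t" "\<And>R. R \<ge> R0 \<Longrightarrow> valid_path (cseg \<gamma> R)"
    "\<And>p. p \<in> P \<union> Q \<Longrightarrow> p \<notin> range \<gamma>"
    "\<And>p R. p \<in> P \<Longrightarrow> R \<ge> R0 \<Longrightarrow> norm p < R \<Longrightarrow> winding_number (cseg \<gamma> R +++ part_circlepath 0 R 0 pi) p = 1"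
    "\<And>p R. p \<in> Q \<Longrightarrow> R \<ge> R0 \<Longrightarrow> norm p < R \<Longrightarrow> winding_number (cseg \<gamma> R +++ part_circlepath 0 R 0 pi) p = 0"
    by simp_all
  obtain R2 where R2: "\<And>p. p \<in> P \<union> Q \<Longrightarrow> norm p < R2"
    using finite_imp_bounded[of "P \<union> Q"] fin unfolding bounded_pos_less by blast
  have PQ: "P \<inter> Q = {}" by (rule sep_contour_disjoint[OF sep])
  have opn: "open (- (P \<union> Q))" using fin by (intro open_Compl finite_imp_closed) auto
  define I where "I = 2 * pi * \<i> * (\<Sum>p\<in>P. residue f p)"
  have main: "norm (contour_integral (cseg \<gamma> R) f - I) \<le> C * pi / R" if R: "R > max R0 (max R1 (max R2 1))" for R
  proof -
    have Rs: "R \<ge> R0" "R \<ge> R1" "R > R2" "R > 0" using R by auto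
    define arc where "arc = part_circlepath 0 R 0 pi"
    have ends: "\<gamma> R = of_real R" "\<gamma> (- R) = - of_real R" using R0(2)[of R] R0(2)[of "- R"] Rs R0(1) by auto
    have arc_ends: "pathstart arc = of_real R" "pathfinish arc = - of_real R"
      by (simp_all add: arc_def)
    have vp: "valid_path (cseg \<gamma> R)" "valid_path arc" using R0(3)[OF Rs(1)] by (simp_all add: arc_def)
    have pa: "path_image arc \<subseteq> - (P \<union> Q)"
    proof
      fix z assume "z \<in> path_image arc"
      hence "norm z = R" using in_path_image_part_circlepath[of z 0 R 0 pi] Rs(4) by (simp add: arc_def)
      thus "z \<in> - (P \<union> Q)" using R2 Rs(3) by force
    qed
    have pc: "path_image (cseg \<gamma> R) \<subseteq> - (P \<union> Q)" using path_image_cseg[of \<gamma> R] R0(4) by blast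
    have int: "f contour_integrable_on (cseg \<gamma> R)" "f contour_integrable_on arc"
      using contour_integrable_holomorphic_simple[OF hol opn] vp pa pc by auto
    have join: "pathfinish (cseg \<gamma> R) = pathstart arc" by (simp add: cseg_ends ends arc_ends)
    have "contour_integral (cseg \<gamma> R +++ arc) f =
        2 * pi * \<i> * (\<Sum>p\<in>P \<union> Q. winding_number (cseg \<gamma> R +++ arc) p * residue f p)"
    proof (rule Residue_theorem[of UNIV])
      show "valid_path (cseg \<gamma> R +++ arc)" by (rule valid_path_join[OF vp join])
      show "pathfinish (cseg \<gamma> R +++ arc) = pathstart (cseg \<gamma> R +++ arc)"
        by (simp add: cseg_ends ends arc_ends)
      show "path_image (cseg \<gamma> R +++ arc) \<subseteq> UNIV - (P \<union> Q)"
        using path_image_join_subset[of "cseg \<gamma> R" arc] pa pc by blast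
    qed (use fin hol in \<open>auto simp: Compl_eq_Diff_UNIV\<close>)
    also have "(\<Sum>p\<in>P \<union> Q. winding_number (cseg \<gamma> R +++ arc) p * residue f p) =
      (\<Sum>p\<in>P. winding_number (cseg \<gamma> R +++ arc) p * residue f p) +
      (\<Sum>p\<in>Q. winding_number (cseg \<gamma> R +++ arc) p * residue f p)"
      by (rule sum.union_disjoint[OF fin PQ])
    also have "(\<Sum>p\<in>Q. winding_number (cseg \<gamma> R +++ arc) p * residue f p) = 0"
    proof (rule sum.neutral, rule ballI)
      fix q assume q: "q \<in> Q"
      hence "norm q < R" using R2[of q] Rs by auto
      from R0(6)[OF q Rs(1) this] show "winding_number (cseg \<gamma> R +++ arc) q * residue f q = 0" by (simp add: arc_def)
    qed
    also have "(\<Sum>p\<in>P. winding_number (cseg \<gamma> R +++ arc) p * residue f p) = (\<Sum>p\<in>P. residue f p)"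
    proof (rule sum.cong[OF refl])
      fix q assume q: "q \<in> P"
      hence "norm q < R" using R2[of q] Rs by auto
      from R0(5)[OF q Rs(1) this] show "winding_number (cseg \<gamma> R +++ arc) q * residue f q = residue f q" by (simp add: arc_def)
    qed
    finally have "contour_integral (cseg \<gamma> R +++ arc) f = I" by (simp add: I_def)
    hence "contour_integral (cseg \<gamma> R) f - I = - contour_integral arc f"
      using contour_integral_join[OF int vp] by (simp add: algebra_simps)
    hence "norm (contour_integral (cseg \<gamma> R) f - I) = norm (contour_integral arc f)" by simp
    also have "\<dots> \<le> C / R ^ 2 * R * \<bar>pi - 0\<bar>"
      unfolding arc_def
    proof (rule contour_integral_bound_part_circlepath)
      show "f contour_integrable_on part_circlepath 0 R 0 pi" using int(2) by (simp add: arc_def)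
      fix x assume "x \<in> path_image (part_circlepath 0 R 0 pi)"
      hence "norm x = R" using in_path_image_part_circlepath[of x 0 R 0 pi] Rs(4) by simp
      thus "norm (f x) \<le> C / R ^ 2" using CR(3)[of x] Rs by simp
    qed (use CR Rs in auto)
    also have "\<dots> = C * pi / R" using Rs by (simp add: power2_eq_square)
    finally show ?thesis .
  qed
  have "((\<lambda>R. contour_integral (cseg \<gamma> R) f) \<longlongrightarrow> I) at_top"
  proof (rule Lim_transform2)
    show "((\<lambda>R. I) \<longlongrightarrow> I) at_top" by simp
    show "((\<lambda>R. I - contour_integral (cseg \<gamma> R) f) \<longlongrightarrow> 0) at_top"
    proof (rule Lim_null_comparison)
      show "eventually (\<lambda>R. norm (I - contour_integral (cseg \<gamma> R) f) \<le> C * pi / R) at_top"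
        using eventually_gt_at_top[of "max R0 (max R1 (max R2 1))"]
        by eventually_elim (use main in \<open>auto simp: norm_minus_commute\<close>)
      show "((\<lambda>R. C * pi / R) \<longlongrightarrow> 0) at_top" by real_asymp
    qed
  qed
  thus ?thesis unfolding cint_def I_def by (rule tendsto_Lim[rotated]) simp
qed

text \<open>In the coordinate \<open>z = (y - n) / 2\<close> the parameters enter only through
  \<open>B k = (a k - N k) / 2\<close> and the poles do not depend on \<open>n\<close> modulo \<open>\<int>\<close>.\<close>

definition half_diff :: "(nat \<Rightarrow> complex) \<Rightarrow> (nat \<Rightarrow> real) \<Rightarrow> nat \<Rightarrow> complex" where
  "half_diff a N k = (a k - of_real (N k)) / 2"

lemma integrand_eq_summand:
  "integrand N a n y = 4 * summand (half_diff a N) N n ((y - of_real n) / 2)"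
proof -
  have p: "1 + (a k - of_real (N k) + (y - of_real n)) / 2 = 1 + (half_diff a N k + (y - of_real n) / 2)"
    "1 + (a k - of_real (N k) - (y - of_real n)) / 2 = 1 + (half_diff a N k - (y - of_real n) / 2)"
    "N k - 1 + n = N k + n - 1" "N k - 1 - n = N k - n - 1" for k
    by (simp_all add: half_diff_def add_divide_distrib diff_divide_distrib)
  \<comment> \<open>This is (y - n) (y + n) = 2 z * 2 w, the source of the factor 4.\<close>
  have y: "y\<^sup>2 - (of_real n)\<^sup>2 = 4 * ((y - of_real n) / 2 * ((y - of_real n) / 2 + of_real n))"
    by (simp add: field_simps power2_eq_square)
  show ?thesis unfolding integrand_def summand_def kern_def gq_def p y by (simp only: mult_ac)
qed

lemma poch_poles_iff: "1 + (b + z) \<in> poch_poles (m - 1) \<longleftrightarrow> z \<in> gpoles b m"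
proof
  assume "1 + (b + z) \<in> poch_poles (m - 1)"
  then obtain i where i: "i \<in> {1..nat (- \<lfloor>m - 1\<rfloor>)}" "1 + (b + z) = of_nat i" unfolding poch_poles_def by blast
  have "z = of_nat i - 1 - b" unfolding i(2)[symmetric] by simp
  thus "z \<in> gpoles b m" unfolding gpoles_def using i(1) by (rule image_eqI)
next
  assume "z \<in> gpoles b m"
  then obtain i where i: "i \<in> {1..nat (- \<lfloor>m - 1\<rfloor>)}" "z = of_nat i - 1 - b" unfolding gpoles_def by blast
  hence "1 + (b + z) = of_nat i" by simp
  moreover have "1 \<le> i \<and> i \<le> nat (- \<lfloor>m - 1\<rfloor>)" using i(1) by (simp only: atLeastAtMost_iff)
  hence "\<lfloor>m - 1\<rfloor> < 0" by linarith
  ultimately show "1 + (b + z) \<in> poch_poles (m - 1)" unfolding poch_poles_def using i(1) by blast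
qed

lemma plus_poles_eq:
  "plus_poles N a n = (\<lambda>z. 2 * z + of_real n) ` kern_poles (half_diff a N) N n"
proof -
  have e: "y \<in> (\<lambda>z. 2 * z + of_real n) ` S \<longleftrightarrow> (y - of_real n) / 2 \<in> S" for y :: complex and S
    by (auto simp: image_iff field_simps intro!: bexI[of _ "(y - of_real n) / 2"])
  have p: "1 + (a k - of_real (N k) + (y - of_real n)) / 2 = 1 + (half_diff a N k + (y - of_real n) / 2)"
    "N k - 1 + n = N k + n - 1" for k y
    by (simp_all add: half_diff_def add_divide_distrib diff_divide_distrib)
  show ?thesis
    unfolding set_eq_iff e plus_poles_def kern_poles_def p mem_Collect_eq UN_iff poch_poles_iff
    by simp
qed

lemma minus_poles_eq:
  "minus_poles N a n = (\<lambda>z. 2 * z + of_real n) ` uminus ` kern_poles (half_diff a N) N (- n)"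
proof -
  have e: "y \<in> (\<lambda>z. 2 * z + of_real n) ` S \<longleftrightarrow> (y - of_real n) / 2 \<in> S" for y :: complex and S
    by (auto simp: image_iff field_simps intro!: bexI[of _ "(y - of_real n) / 2"])
  have p: "1 + (a k - of_real (N k) - (y - of_real n)) / 2 = 1 + (half_diff a N k + - ((y - of_real n) / 2))"
    "N k - 1 - n = N k + - n - 1" for k y
    by (simp_all add: half_diff_def add_divide_distrib diff_divide_distrib)
  show ?thesis
    unfolding set_eq_iff e mem_uminus_image minus_poles_def kern_poles_def p mem_Collect_eq UN_iff poch_poles_iff
    by simp
qed

lemma poles_in_affine:
  assumes "poles_in P Q f"
  shows "poles_in ((\<lambda>z. 2 * z + c) ` P) ((\<lambda>z. 2 * z + c) ` Q) (\<lambda>y. 4 * f ((y - c) / 2))"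
  unfolding poles_in_def
proof (intro conjI)
  have "(f \<circ> (\<lambda>y. (y - c) / 2)) holomorphic_on - ((\<lambda>z. 2 * z + c) ` P \<union> (\<lambda>z. 2 * z + c) ` Q)"
  proof (rule holomorphic_on_compose_gen)
    show "f holomorphic_on - (P \<union> Q)" using assms by (simp add: poles_in_def)
    show "(\<lambda>y. (y - c) / 2) ` (- ((\<lambda>z. 2 * z + c) ` P \<union> (\<lambda>z. 2 * z + c) ` Q)) \<subseteq> - (P \<union> Q)"
    proof
      fix w assume "w \<in> (\<lambda>y. (y - c) / 2) ` (- ((\<lambda>z. 2 * z + c) ` P \<union> (\<lambda>z. 2 * z + c) ` Q))"
      then obtain y where y: "y \<notin> (\<lambda>z. 2 * z + c) ` (P \<union> Q)" "w = (y - c) / 2" by blast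
      have "y = 2 * w + c" by (simp add: y(2) diff_divide_distrib)
      thus "w \<in> - (P \<union> Q)" using y(1) by blast
    qed
  qed (intro holomorphic_intros, auto)
  thus "(\<lambda>y. 4 * f ((y - c) / 2)) holomorphic_on - ((\<lambda>z. 2 * z + c) ` P \<union> (\<lambda>z. 2 * z + c) ` Q)"
    unfolding o_def by (intro holomorphic_on_mult holomorphic_on_const)
  have lin: "(\<lambda>y. - c / 2 + (1 / 2) * y) \<in> \<Theta>[at_infinity](\<lambda>y. y)" by (rule bigtheta_linear) simp
  have "filterlim (\<lambda>y. (y - c) / 2) at_infinity at_infinity"
  proof -
    have "filterlim (\<lambda>y. norm ((y - c) / 2)) at_top at_infinity"
      unfolding filterlim_at_top eventually_at_infinity
    proof (intro allI exI impI)
      fix Z :: real and y :: complex assume "2 * Z + norm c \<le> norm y"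
      thus "Z \<le> norm ((y - c) / 2)" using norm_triangle_ineq2[of y c] by (simp add: norm_divide)
    qed
    thus ?thesis by (rule filterlim_norm_at_top_imp_at_infinity)
  qed
  from landau_o.big.compose[OF _ this, of f "\<lambda>z. 1 / z^2"] assms
  have "(\<lambda>y. f ((y - c) / 2)) \<in> O[at_infinity](\<lambda>y. 1 / ((y - c) / 2) ^ 2)" by (simp add: poles_in_def)
  also have "(\<lambda>y. 1 / ((y - c) / 2) ^ 2) \<in> \<Theta>[at_infinity](\<lambda>y. 1 / y ^ 2)"
  proof -
    have i: "(\<lambda>y. inverse ((- c / 2 + (1 / 2) * y) * (- c / 2 + (1 / 2) * y))) \<in> \<Theta>[at_infinity](\<lambda>y. inverse (y * y))"
      unfolding bigtheta_inverse by (intro landau_theta.mult lin)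
    have "(y - c) / 2 = - c / 2 + (1 / 2) * y" for y by (simp add: field_simps)
    hence e: "1 / ((y - c) / 2) ^ 2 = inverse ((- c / 2 + (1 / 2) * y) * (- c / 2 + (1 / 2) * y))"
      "1 / y ^ 2 = inverse (y * y)" for y by (simp_all only: power2_eq_square inverse_eq_divide)
    show ?thesis unfolding e(1) unfolding e(2) by (rule i)
  qed
  finally show "(\<lambda>y. 4 * f ((y - c) / 2)) \<in> O[at_infinity](\<lambda>y. 1 / y ^ 2)" by simp
qed (use assms in \<open>auto simp: poles_in_def\<close>)

text \<open>The factor 8 is the 4 in front of \<open>f\<close> times the 2 from dy = 2 dz.\<close>

lemma residue_affine:
  assumes "poles_in P Q f"
  shows "residue (\<lambda>y. 4 * f ((y - c) / 2)) (2 * p + c) = 8 * residue f p"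
proof -
  define S where "S = - (P \<union> Q - {p})"
  have "finite (P \<union> Q - {p})" using assms by (simp add: poles_in_def)
  hence S: "open S" "p \<in> S" unfolding S_def by (simp_all only: open_Compl finite_imp_closed) simp
  have hol: "f holomorphic_on S - {p}" using assms unfolding S_def poles_in_def by (auto elim: holomorphic_on_subset)
  obtain r where r: "r > 0" "cball p r \<subseteq> S" using S by (auto simp: open_contains_cball)
  have 1: "(f has_contour_integral (2 * pi * \<i> * residue f p)) (circlepath p r)"
    by (rule base_residue[OF S r(1) hol r(2)])
  define T where "T = (\<lambda>y. (y - c) / 2) -` S"
  have T: "open T" unfolding T_def using S(1) by (intro open_vimage continuous_intros) auto
  have "((\<lambda>y. 4 * f ((y - c) / 2)) has_contour_integral (2 * pi * \<i> * residue (\<lambda>y. 4 * f ((y - c) / 2)) (2 * p + c))) (circlepath (2 * p + c) (2 * r))"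
  proof (rule base_residue[OF T])
    show "2 * p + c \<in> T" using S by (simp add: T_def)
    show "2 * r > 0" using r by simp
    have "(f \<circ> (\<lambda>y. (y - c) / 2)) holomorphic_on T - {2 * p + c}"
      by (rule holomorphic_on_compose_gen[OF _ hol]) (auto simp: T_def field_simps intro!: holomorphic_intros)
    thus "(\<lambda>y. 4 * f ((y - c) / 2)) holomorphic_on T - {2 * p + c}"
      unfolding o_def by (intro holomorphic_on_mult holomorphic_on_const)
    show "cball (2 * p + c) (2 * r) \<subseteq> T"
    proof
      fix y assume "y \<in> cball (2 * p + c) (2 * r)"
      hence "norm (2 * p + c - y) \<le> 2 * r" by (simp add: dist_norm)
      moreover have "2 * p + c - y = 2 * (p - (y - c) / 2)" by (simp add: field_simps)
      ultimately have "2 * norm (p - (y - c) / 2) \<le> 2 * r" by (metis norm_mult norm_numeral)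
      thus "y \<in> T" using r(2) by (auto simp: T_def dist_norm)
    qed
  qed
  moreover have "((\<lambda>y. 4 * f ((y - c) / 2)) has_contour_integral 8 * (2 * pi * \<i> * residue f p)) (circlepath (2 * p + c) (2 * r))"
  proof -
    have "((\<lambda>x. 8 * (f (circlepath p r x) * vector_derivative (circlepath p r) (at x within {0..1}))) has_integral
        8 * (2 * pi * \<i> * residue f p)) {0..1}"
      using 1 unfolding has_contour_integral_def by (rule has_integral_mult_right)
    moreover have "8 * (f (circlepath p r x) * vector_derivative (circlepath p r) (at x within {0..1})) =
       4 * f ((circlepath (2 * p + c) (2 * r) x - c) / 2) * vector_derivative (circlepath (2 * p + c) (2 * r)) (at x within {0..1})"
      if "x \<in> {0..1}" for x
    proof -
      have "(circlepath (2 * p + c) (2 * r) x - c) / 2 = circlepath p r x" by (simp add: circlepath field_simps)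
      thus ?thesis using that by (simp add: vector_derivative_circlepath01)
    qed
    ultimately show ?thesis unfolding has_contour_integral_def by (subst (asm) has_integral_cong) auto
  qed
  ultimately have "2 * pi * \<i> * residue (\<lambda>y. 4 * f ((y - c) / 2)) (2 * p + c) = 8 * (2 * pi * \<i> * residue f p)"
    by (rule has_contour_integral_unique)
  hence "(2 * pi * \<i>) * residue (\<lambda>y. 4 * f ((y - c) / 2)) (2 * p + c) = (2 * pi * \<i>) * (8 * residue f p)"
    by (simp only: mult_ac)
  thus ?thesis by (subst (asm) mult_cancel_left) simp
qed

text \<open>The constant is 2 pi i from the residue theorem times the 8 of
  \<open>residue_affine\<close>.\<close>

lemma cint_integrand:
  assumes "on_coset \<nu> N" "n \<in> coset \<nu>" "(\<Sum>k\<in>{1..8}. N k) = 4"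
    and "sep_contour \<gamma> (plus_poles N a n) (minus_poles N a n)"
  shows "cint (integrand N a n) \<gamma> = 16 * pi * \<i> * res_sum (half_diff a N) N n"
proof -
  define B where "B = half_diff a N"
  note pl = poles_in_summand[OF assms(1-3), of B]
  have int: "integrand N a n = (\<lambda>y. 4 * summand B N n ((y - of_real n) / 2))"
    by (auto simp: fun_eq_iff integrand_eq_summand B_def)
  have "cint (integrand N a n) \<gamma> = 2 * pi * \<i> * (\<Sum>p\<in>plus_poles N a n. residue (integrand N a n) p)"
    by (rule cint_eq_residues[OF assms(4)])
       (unfold plus_poles_eq minus_poles_eq int B_def[symmetric], rule poles_in_affine[OF pl])
  also have "(\<Sum>p\<in>plus_poles N a n. residue (integrand N a n) p) =
      (\<Sum>p\<in>kern_poles B N n. residue (integrand N a n) (2 * p + of_real n))"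
    unfolding plus_poles_eq B_def[symmetric]
    by (rule sum.reindex_cong[of "\<lambda>z. 2 * z + of_real n"]) (auto simp: inj_on_def)
  also have "\<dots> = 8 * res_sum B N n"
    unfolding int residue_affine[OF pl] res_sum_def by (rule sum_distrib_left[symmetric])
  finally show ?thesis by (simp add: B_def)
qed

section \<open>Continuity in the parameters\<close>

lemma continuous_on_gq: "continuous_on (- gpoles 0 m) (\<lambda>b. gq b m)"
  using holomorphic_on_imp_continuous_on[OF gq_holomorphic[of 0 m]] by simp

lemma mem_gpoles_iff: "z \<in> gpoles b m \<longleftrightarrow> b + z \<in> gpoles 0 m"
proof -
  have "z = of_nat i - 1 - b \<longleftrightarrow> b + z = of_nat i - 1" for i by (auto simp: algebra_simps)
  thus ?thesis unfolding gpoles_def image_iff by simp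
qed

lemma summand_jointly_continuous:
  assumes cont: "\<And>k. k \<in> {1..8} \<Longrightarrow> continuous_on T (\<lambda>t. B t k)"
    and off: "\<And>t z. t \<in> T \<Longrightarrow> z \<in> K \<Longrightarrow> z \<notin> kern_poles (B t) N n \<union> uminus ` kern_poles (B t) N (- n)"
  shows "continuous_on (T \<times> K) (\<lambda>(t, z). summand (B t) N n z)"
proof -
  have B: "continuous_on (T \<times> K) (\<lambda>x. B (fst x) k)" if "k \<in> {1..8}" for k
    by (rule continuous_on_compose2[OF cont[OF that]]) (auto intro: continuous_intros)
  have p: "continuous_on (T \<times> K) (\<lambda>x. gq (B (fst x) k + snd x) (N k + n))" if k: "k \<in> {1..8}" for k
  proof (rule continuous_on_compose2[OF continuous_on_gq])
    show "continuous_on (T \<times> K) (\<lambda>x. B (fst x) k + snd x)" by (intro continuous_intros B[OF k])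
    show "(\<lambda>x. B (fst x) k + snd x) ` (T \<times> K) \<subseteq> - gpoles 0 (N k + n)"
      using off k unfolding kern_poles_def by (force simp: mem_gpoles_iff[of _ "B _ k"] simp del: atLeastAtMost_iff)
  qed
  have m: "continuous_on (T \<times> K) (\<lambda>x. gq (B (fst x) k - snd x) (N k - n))" if k: "k \<in> {1..8}" for k
  proof (rule continuous_on_compose2[OF continuous_on_gq])
    show "continuous_on (T \<times> K) (\<lambda>x. B (fst x) k - snd x)" by (intro continuous_intros B[OF k])
    show "(\<lambda>x. B (fst x) k - snd x) ` (T \<times> K) \<subseteq> - gpoles 0 (N k - n)"
    proof clarify
      fix t z assume tz: "t \<in> T" "z \<in> K" "B (fst (t, z)) k - snd (t, z) \<in> gpoles 0 (N k - n)"
      hence "- z \<in> gpoles (B t k) (N k - n)" by (simp add: mem_gpoles_iff[of _ "B t k"])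
      hence "- z \<in> kern_poles (B t) N (- n)" using k unfolding kern_poles_def by auto
      thus False using off[OF tz(1,2)] by (auto simp: mem_uminus_image)
    qed
  qed
  have "continuous_on (T \<times> K) (\<lambda>x. summand (B (fst x)) N n (snd x))"
    unfolding summand_def kern_def by (intro continuous_intros p m)
  thus ?thesis by (simp add: case_prod_unfold)
qed

text \<open>The residues at the poles near \<open>c\<close> are a circle integral around \<open>c\<close>, which depends
  continuously on the parameter even where poles of the same kind collide.\<close>

lemma res_sum_tendsto:
  fixes B :: "real \<Rightarrow> nat \<Rightarrow> complex"
  assumes cont: "\<And>k. k \<in> {1..8} \<Longrightarrow> continuous_on UNIV (\<lambda>t. B t k)"
    and N: "on_coset \<nu> N" "n \<in> coset \<nu>" "(\<Sum>k\<in>{1..8}. N k) = 4"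
    and disj: "kern_poles (B 0) N n \<inter> uminus ` kern_poles (B 0) N (- n) = {}"
  shows "((\<lambda>t. res_sum (B t) N n) \<longlongrightarrow> res_sum (B 0) N n) (at 0)"
proof -
  define P where "P t = kern_poles (B t) N n" for t
  define Q where "Q t = uminus ` kern_poles (B t) N (- n)" for t
  have fin: "finite (P t)" "finite (Q t)" for t by (simp_all add: P_def Q_def)
  have pl: "poles_in (P t) (Q t) (summand (B t) N n)" for t
    unfolding P_def Q_def by (rule poles_in_summand[OF N])
  \<comment> \<open>The distance 2 e makes the discs of radius e around the limiting poles disjoint;
    for small t each pole stays within e / 2 of a limiting one and hence off the circles.\<close>
  have "\<exists>e>0. \<forall>p\<in>P 0 \<union> Q 0. \<forall>q\<in>P 0 \<union> Q 0. p \<noteq> q \<longrightarrow> 2 * e \<le> dist p q"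
  proof -
    define D where "D = (\<lambda>(p, q). dist p q) ` {(p, q). p \<in> P 0 \<union> Q 0 \<and> q \<in> P 0 \<union> Q 0 \<and> p \<noteq> q}"
    have "finite D" unfolding D_def
      by (rule finite_imageI, rule finite_subset[of _ "(P 0 \<union> Q 0) \<times> (P 0 \<union> Q 0)"]) (use fin in auto)
    hence f: "finite (insert 1 D)" by simp
    define e where "e = Min (insert 1 D) / 2"
    have "\<forall>d\<in>insert 1 D. d > 0" by (auto simp: D_def)
    hence "e > 0" using Min_in[OF f] by (auto simp: e_def)
    moreover have "2 * e \<le> dist p q" if "p \<in> P 0 \<union> Q 0" "q \<in> P 0 \<union> Q 0" "p \<noteq> q" for p q
    proof -
      have "dist p q \<in> insert 1 D" using that by (auto simp: D_def)
      thus ?thesis using Min_le[OF f] by (simp add: e_def)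
    qed
    ultimately show ?thesis by blast
  qed
  then obtain e where e: "e > 0" "\<And>p q. p \<in> P 0 \<union> Q 0 \<Longrightarrow> q \<in> P 0 \<union> Q 0 \<Longrightarrow> p \<noteq> q \<Longrightarrow> 2 * e \<le> dist p q"
    by blast
  have "eventually (\<lambda>t. \<forall>k\<in>{1..8}. dist (B t k) (B 0 k) < e / 2) (nhds 0)"
  proof (intro eventually_ball_finite ballI)
    fix k :: nat assume "k \<in> {1..8}"
    hence "isCont (\<lambda>t. B t k) 0" using cont[of k] continuous_on_eq_continuous_at[of UNIV] by auto
    hence "((\<lambda>t. B t k) \<longlongrightarrow> B 0 k) (nhds 0)" using tendsto_at_iff_tendsto_nhds[of "\<lambda>t. B t k" 0] by (simp add: isCont_def)
    from tendstoD[OF this, of "e/2"] e(1)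
    show "eventually (\<lambda>t. dist (B t k) (B 0 k) < e / 2) (nhds 0)" by simp
  qed simp
  then obtain d where d: "d > 0" "\<And>t k. \<bar>t\<bar> < d \<Longrightarrow> k \<in> {1..8} \<Longrightarrow> dist (B t k) (B 0 k) < e / 2"
    unfolding eventually_nhds_metric by (auto simp: dist_real_def simp del: atLeastAtMost_iff)
  have near: "\<exists>q\<in>kern_poles (B 0) N m. dist p q < e / 2" if p: "p \<in> kern_poles (B t) N m" and t: "\<bar>t\<bar> < d" for p t m
  proof -
    obtain k i where ki: "k \<in> {1..8}" "i \<in> {1..nat (- \<lfloor>N k + m - 1\<rfloor>)}" "p = of_nat i - 1 - B t k"
      using p unfolding kern_poles_def gpoles_def by blast
    have "of_nat i - 1 - B 0 k \<in> kern_poles (B 0) N m"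
      unfolding kern_poles_def gpoles_def using ki(1,2) by blast
    moreover have "dist p (of_nat i - 1 - B 0 k) < e / 2"
      using d(2)[OF t ki(1)] unfolding ki(3) by (simp add: dist_norm norm_minus_commute)
    ultimately show ?thesis by blast
  qed
  have nearP: "\<exists>q\<in>P 0. dist p q < e / 2" if "p \<in> P t" "\<bar>t\<bar> < d" for p t
    using near that unfolding P_def by blast
  have nearQ: "\<exists>q\<in>Q 0. dist p q < e / 2" if p: "p \<in> Q t" and t: "\<bar>t\<bar> < d" for p t
  proof -
    have "- p \<in> kern_poles (B t) N (- n)" using p by (simp add: Q_def mem_uminus_image)
    then obtain q where q: "q \<in> kern_poles (B 0) N (- n)" "dist (- p) q < e / 2" using near t by blast
    have "dist p (- q) = dist (- p) q" by (metis dist_minus minus_minus)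
    thus ?thesis using q by (intro bexI[of _ "- q"]) (auto simp: Q_def)
  qed
  have PQ0: "P 0 \<inter> Q 0 = {}" using disj by (simp add: P_def Q_def)
  have off_sphere: "dist z p > e / 2" if "z \<in> sphere c e" "c \<in> P 0 \<union> Q 0" "p \<in> P 0 \<union> Q 0" for z c p
  proof (cases "p = c")
    case True
    thus ?thesis using that(1) e(1) by (simp add: dist_commute)
  next
    case False
    have "2 * e \<le> dist c p" using e(2)[OF that(2,3)] False by simp
    also have "\<dots> \<le> dist c z + dist z p" by (rule dist_triangle)
    finally show ?thesis using that(1) e(1) by simp
  qed
  have off: "z \<notin> P t \<union> Q t" if t: "\<bar>t\<bar> < d" and z: "z \<in> sphere c e" "c \<in> P 0" for t z c
  proof
    assume "z \<in> P t \<union> Q t"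
    then obtain q where "q \<in> P 0 \<union> Q 0" "dist z q < e / 2" using nearP nearQ t by blast
    thus False using off_sphere[OF z(1), of q] z(2) by fastforce
  qed
  \<comment> \<open>Each plus-pole lies in exactly one of the discs around the points of
    \<open>P 0\<close>, and by disjointness at t = 0 no minus-pole lies in any of them.\<close>
  have split: "res_sum (B t) N n = (\<Sum>c\<in>P 0. contour_integral (circlepath c e) (summand (B t) N n)) / (2 * pi * \<i>)"
    if t: "\<bar>t\<bar> < d" for t
  proof -
    have circ: "contour_integral (circlepath c e) (summand (B t) N n) =
        2 * pi * \<i> * (\<Sum>p\<in>P t. if dist c p < e then residue (summand (B t) N n) p else 0)" if c: "c \<in> P 0" for c
    proof -
      have "contour_integral (circlepath c e) (summand (B t) N n) =
        2 * pi * \<i> * (\<Sum>p\<in>P t \<union> Q t. winding_number (circlepath c e) p * residue (summand (B t) N n) p)"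
      proof (rule Residue_theorem[of UNIV])
        show "summand (B t) N n holomorphic_on UNIV - (P t \<union> Q t)"
          using pl[of t] by (simp add: poles_in_def Compl_eq_Diff_UNIV)
        show "path_image (circlepath c e) \<subseteq> UNIV - (P t \<union> Q t)" using off[OF t _ c] e(1) by auto
      qed (use fin in auto)
      also have "(\<Sum>p\<in>P t \<union> Q t. winding_number (circlepath c e) p * residue (summand (B t) N n) p) =
        (\<Sum>p\<in>P t. if dist c p < e then residue (summand (B t) N n) p else 0)"
      proof (rule sum.mono_neutral_cong_right)
        show "\<forall>p\<in>P t \<union> Q t - P t. winding_number (circlepath c e) p * residue (summand (B t) N n) p = 0"
        proof
          fix p assume "p \<in> P t \<union> Q t - P t"
          then obtain q where q: "q \<in> Q 0" "dist p q < e / 2" using nearQ t by blast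
          have "c \<noteq> q" using c q(1) PQ0 by blast
          hence "2 * e \<le> dist c q" using e(2) c q(1) by blast
          hence "dist c p > e" using q(2) dist_triangle[of c q p] e(1) by simp
          hence "winding_number (circlepath c e) p = 0"
            by (intro winding_number_zero_outside[of _ "cball c e"]) (use e(1) in auto)
          thus "winding_number (circlepath c e) p * residue (summand (B t) N n) p = 0" by simp
        qed
        fix p assume p: "p \<in> P t"
        show "winding_number (circlepath c e) p * residue (summand (B t) N n) p =
            (if dist c p < e then residue (summand (B t) N n) p else 0)"
        proof (cases "dist c p < e")
          case True
          hence "winding_number (circlepath c e) p = 1"
            by (intro winding_number_circlepath) (simp add: dist_norm norm_minus_commute)
          thus ?thesis using True by simp
        next
          case False
          moreover have "p \<notin> sphere c e" using off[OF t _ c] p by blast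
          ultimately have "dist c p > e" by simp
          hence "winding_number (circlepath c e) p = 0"
            by (intro winding_number_zero_outside[of _ "cball c e"]) (use e(1) in auto)
          thus ?thesis using False by simp
        qed
      qed (use fin in auto)
      finally show ?thesis .
    qed
    have "(\<Sum>c\<in>P 0. contour_integral (circlepath c e) (summand (B t) N n)) =
      (\<Sum>c\<in>P 0. 2 * pi * \<i> * (\<Sum>p\<in>P t. if dist c p < e then residue (summand (B t) N n) p else 0))"
      by (intro sum.cong circ refl)
    also have "\<dots> = 2 * pi * \<i> * (\<Sum>p\<in>P t. \<Sum>c\<in>P 0. if dist c p < e then residue (summand (B t) N n) p else 0)"
      by (subst sum.swap) (simp add: sum_distrib_left)
    also have "(\<Sum>p\<in>P t. \<Sum>c\<in>P 0. if dist c p < e then residue (summand (B t) N n) p else 0) =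
        (\<Sum>p\<in>P t. residue (summand (B t) N n) p)"
    proof (rule sum.cong[OF refl])
      fix p assume "p \<in> P t"
      then obtain q where q: "q \<in> P 0" "dist p q < e / 2" using nearP t by blast
      have "dist c p < e \<longleftrightarrow> c = q" if "c \<in> P 0" for c
      proof
        assume "dist c p < e"
        hence "dist c q < 2 * e" using q(2) dist_triangle[of c q p] e(1) by simp
        thus "c = q" using e(2)[of c q] that q(1) by force
      qed (use q e(1) in \<open>simp add: dist_commute\<close>)
      hence "(\<Sum>c\<in>P 0. if dist c p < e then residue (summand (B t) N n) p else 0) =
        (\<Sum>c\<in>P 0. if c = q then residue (summand (B t) N n) p else 0)" by (intro sum.cong) auto
      thus "(\<Sum>c\<in>P 0. if dist c p < e then residue (summand (B t) N n) p else 0) = residue (summand (B t) N n) p"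
        using q(1) fin by simp
    qed
    finally show ?thesis unfolding res_sum_def P_def[symmetric] by simp
  qed
  have lim: "((\<lambda>t. contour_integral (circlepath c e) (summand (B t) N n)) \<longlongrightarrow>
      contour_integral (circlepath c e) (summand (B 0) N n)) (at 0)" if c: "c \<in> P 0" for c
  proof (rule contour_integral_uniform_limit_circlepath(2))
    define T where "T = {- (d / 2)..d / 2}"
    have T: "\<bar>t\<bar> < d" if "t \<in> T" for t using that d(1) by (auto simp: T_def)
    \<comment> \<open>Joint continuity on a compact set yields convergence that is uniform on the
      circle.\<close>
    have cT: "continuous_on (T \<times> sphere c e) (\<lambda>(t, z). summand (B t) N n z)"
      by (rule summand_jointly_continuous)
         (use continuous_on_subset[OF cont] off[OF T _ c] in \<open>auto simp: P_def Q_def simp del: atLeastAtMost_iff\<close>)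
    have evT: "eventually (\<lambda>t. t \<in> T) (at 0)"
      unfolding eventually_at using d(1) by (intro exI[of _ "d / 2"]) (auto simp: T_def dist_real_def)
    show "eventually (\<lambda>t. summand (B t) N n contour_integrable_on circlepath c e) (at 0)"
      using evT
    proof eventually_elim
      case (elim t)
      have "continuous_on (sphere c e) (summand (B t) N n)"
      proof (rule continuous_on_subset[OF holomorphic_on_imp_continuous_on])
        show "summand (B t) N n holomorphic_on - (P t \<union> Q t)" using pl[of t] by (simp add: poles_in_def)
        show "sphere c e \<subseteq> - (P t \<union> Q t)" using off[OF T[OF elim] _ c] by blast
      qed
      thus ?case using e(1) by (intro contour_integrable_continuous_circlepath) simp
    qed
    have "compact (T \<times> sphere c e)" by (intro compact_Times) (auto simp: T_def)
    with cT have u: "uniformly_continuous_on (T \<times> sphere c e) (\<lambda>(t, z). summand (B t) N n z)"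
      by (rule compact_uniformly_continuous)
    show "uniform_limit (sphere c e) (\<lambda>t. summand (B t) N n) (summand (B 0) N n) (at 0)"
    proof (rule uniform_limitI)
      fix r :: real assume "r > 0"
      then obtain s where s: "s > 0" "\<And>x y. x \<in> T \<times> sphere c e \<Longrightarrow> y \<in> T \<times> sphere c e \<Longrightarrow> dist y x < s \<Longrightarrow>
          dist (case y of (t, z) \<Rightarrow> summand (B t) N n z) (case x of (t, z) \<Rightarrow> summand (B t) N n z) < r"
        using u unfolding uniformly_continuous_on_def by metis
      have "eventually (\<lambda>t. dist t 0 < s) (at (0::real))" using s(1) eventually_at by blast
      with evT show "eventually (\<lambda>t. \<forall>z\<in>sphere c e. dist (summand (B t) N n z) (summand (B 0) N n z) < r) (at 0)"
      proof eventually_elim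
        case (elim t)
        have "0 \<in> T" using d(1) by (simp add: T_def)
        thus ?case using s(2)[of "(0, _)" "(t, _)"] elim by (auto simp: dist_Pair_Pair)
      qed
    qed
  qed (use e(1) in auto)
  have "((\<lambda>t. (\<Sum>c\<in>P 0. contour_integral (circlepath c e) (summand (B t) N n)) / (2 * pi * \<i>)) \<longlongrightarrow>
     (\<Sum>c\<in>P 0. contour_integral (circlepath c e) (summand (B 0) N n)) / (2 * pi * \<i>)) (at 0)"
    by (intro tendsto_intros lim) auto
  moreover have "eventually (\<lambda>t. (\<Sum>c\<in>P 0. contour_integral (circlepath c e) (summand (B t) N n)) / (2 * pi * \<i>) =
      res_sum (B t) N n) (at 0)"
    unfolding eventually_at using d(1) split by (intro exI[of _ d]) (simp add: dist_real_def)
  ultimately show ?thesis using split[of 0] d(1) by (simp add: tendsto_cong)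
qed

text \<open>The powers t, ..., t ^ 7 are linearly independent, so no integer relation persists along
  the curve; the last coordinate keeps the sum of all eight fixed.\<close>

definition moment_curve :: "(nat \<Rightarrow> complex) \<Rightarrow> real \<Rightarrow> nat \<Rightarrow> complex" where
  "moment_curve B t k = (if k = 8 then B k - (\<Sum>j\<in>{1..7::nat}. of_real t ^ j) else B k + of_real t ^ k)"

lemma moment_curve_0: "k \<noteq> 0 \<Longrightarrow> moment_curve B 0 k = B k"
  by (auto simp: moment_curve_def power_0_left)

lemma continuous_moment_curve: "continuous_on S (\<lambda>t. moment_curve B t k)"
  unfolding moment_curve_def by (cases "k = 8") (auto intro!: continuous_intros)

lemma sum_1_7: "(\<Sum>k\<in>{1..7::nat}. f k) = f 1 + f 2 + f 3 + f 4 + f 5 + f 6 + (f 7 :: 'a :: comm_monoid_add)"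
proof -
  have "{1..7::nat} = {1, 2, 3, 4, 5, 6, 7}" by auto
  thus ?thesis by (simp add: add_ac del: One_nat_def)
qed

lemma sum_moment_curve: "(\<Sum>k\<in>{1..8}. moment_curve B t k) = (\<Sum>k\<in>{1..8}. B k)"
  unfolding sum_1_8 by (simp add: moment_curve_def sum_1_7 del: One_nat_def)

text \<open>An integer combination of the coordinates is a nonconstant polynomial in \<open>t\<close> unless all its
  coefficients agree, so it is rational for at most countably many \<open>t\<close>.\<close>

lemma countable_nongeneric: "countable {t. \<not> generic (moment_curve B t)}"
proof -
  \<comment> \<open>Integer lists and rational values range over a countable type. As coordinate 8
    carries - t ^ k for every k, the coefficient of t ^ k is the difference of the entries k and
    8.\<close>
  define p :: "int list \<Rightarrow> rat \<Rightarrow> complex poly" where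
    "p cs q = (\<Sum>k\<in>{1..7}. monom (of_int (cs ! k - cs ! 8)) k) + [:(\<Sum>k\<in>{1..8}. of_int (cs ! k) * B k) - of_rat q:]"
    for cs q
  define Z where "Z = (\<lambda>(cs, q). if p cs q = 0 then {} else {t. poly (p cs q) (complex_of_real t) = 0})"
  have poly_p: "poly (p cs q) (of_real t) = (\<Sum>k\<in>{1..8}. of_int (cs ! k) * moment_curve B t k) - of_rat q" for cs q t
    unfolding p_def sum_1_8 by (simp add: poly_monom sum_1_7 moment_curve_def algebra_simps del: One_nat_def)
  have "{t. \<not> generic (moment_curve B t)} \<subseteq> (\<Union>x\<in>UNIV. Z x)"
  proof
    fix t assume "t \<in> {t. \<not> generic (moment_curve B t)}"
    then obtain c :: "nat \<Rightarrow> int" where c: "\<exists>i\<in>{1..8}. \<exists>j\<in>{1..8}. c i \<noteq> c j"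
      and rat: "(\<Sum>k\<in>{1..8}. of_int (c k) * moment_curve B t k) \<in> \<rat>" unfolding generic_def by blast
    from rat obtain q where q: "(\<Sum>k\<in>{1..8}. of_int (c k) * moment_curve B t k) = of_rat q" by (elim Rats_cases)
    define cs where "cs = map c [0..<9]"
    have cs: "cs ! k = c k" if "k \<in> {1..8}" for k using that unfolding cs_def by (subst nth_map) auto
    have "(\<Sum>k\<in>{1..8}. of_int (cs ! k) * moment_curve B t k) = (\<Sum>k\<in>{1..8}. of_int (c k) * moment_curve B t k)"
      using cs by (intro sum.cong) auto
    hence "poly (p cs q) (of_real t) = 0" using poly_p q by simp
    moreover have "p cs q \<noteq> 0"
    proof
      assume "p cs q = 0"
      have "coeff (p cs q) k = of_int (cs ! k - cs ! 8)" if k: "k \<in> {1..7}" for k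
      proof -
        have "coeff (p cs q) k = (\<Sum>j\<in>{1..7}. if j = k then of_int (cs ! j - cs ! 8) else 0)"
          unfolding p_def using k by (simp add: coeff_sum coeff_pCons split: nat.split)
        thus ?thesis using k by simp
      qed
      hence "c k = c 8" if "k \<in> {1..7}" for k
        using \<open>p cs q = 0\<close> that cs[of k] cs[of 8] by (auto simp: of_int_diff[symmetric] simp del: of_int_diff)
      moreover have "k \<in> {1..7} \<or> k = 8" if "k \<in> {1..8}" for k :: nat using that by auto
      ultimately have "c k = c 8" if "k \<in> {1..8}" for k using that by blast
      thus False using c by metis
    qed
    ultimately have "t \<in> Z (cs, q)" by (simp add: Z_def)
    thus "t \<in> (\<Union>x\<in>UNIV. Z x)" by blast
  qed
  moreover have "countable (Z x)" for x
  proof (cases x)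
    case (Pair cs q)
    have "finite {t. poly (p cs q) (complex_of_real t) = 0}" if "p cs q \<noteq> 0"
    proof (rule finite_imageD)
      show "finite (complex_of_real ` {t. poly (p cs q) (complex_of_real t) = 0})"
        by (rule finite_subset[OF _ poly_roots_finite[OF that]]) auto
    qed (auto simp: inj_on_def)
    thus ?thesis unfolding Pair Z_def by (auto intro: countable_finite)
  qed
  hence "countable (\<Union>x\<in>UNIV. Z x)" by (intro countable_UN) auto
  ultimately show ?thesis by (rule countable_subset)
qed

text \<open>Each open neighbourhood of 0 is uncountable, whereas only countably many t are
  nongeneric.\<close>

lemma generic_islimpt: "(0::real) islimpt {t. generic (moment_curve B t)}"
  unfolding islimpt_def
proof (intro allI impI)
  fix T :: "real set" assume T: "0 \<in> T" "open T"
  have "countable (insert 0 {t. \<not> generic (moment_curve B t)})" using countable_nongeneric by simp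
  from open_minus_countable[OF this _ T(2)] T(1)
  show "\<exists>y\<in>{t. generic (moment_curve B t)}. y \<in> T \<and> y \<noteq> 0" by blast
qed

section \<open>Limits of both sides of the identity\<close>

lemma res_total_tendsto:
  assumes cont: "\<And>k. k \<in> {1..8} \<Longrightarrow> continuous_on UNIV (\<lambda>t. B t k)"
    and N: "index_ok N" "(\<Sum>k\<in>{1..8}. N k) = 4"
    and disj: "\<And>n. n \<in> coset (N 1) \<Longrightarrow> kern_poles (B 0) N n \<inter> uminus ` kern_poles (B 0) N (- n) = {}"
  shows "((\<lambda>t. res_total (B t) N) \<longlongrightarrow> res_total (B 0) N) (at (0::real))"
  unfolding res_total_def
  by (intro tendsto_sum res_sum_tendsto[OF cont _ _ N(2) disj]) (use N(1) in \<open>auto simp: index_ok_def\<close>)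

lemma res_sum_cong:
  assumes "\<And>k. k \<in> {1..8} \<Longrightarrow> B k = B' k" shows "res_sum B N n = res_sum B' N n"
proof -
  have "kern_poles B N n = kern_poles B' N n" unfolding kern_poles_def using assms by simp
  moreover have "summand B N n = summand B' N n"
    unfolding summand_def kern_def by (intro ext arg_cong2[of _ _ _ _ "(*)"] refl prod.cong) (use assms in auto)
  ultimately show ?thesis by (simp add: res_sum_def)
qed

lemma kern_poles_cong:
  assumes "\<And>k. k \<in> {1..8} \<Longrightarrow> B k = B' k" shows "kern_poles B N n = kern_poles B' N n"
  unfolding kern_poles_def using assms by simp

definition coefficient :: "(nat \<Rightarrow> complex) \<Rightarrow> (nat \<Rightarrow> real) \<Rightarrow> complex" where
  "coefficient B N = (-1) powi \<lfloor>Lsum N\<rfloor> * (\<Prod>(j, k)\<in>pairsP. gq (B j + B k) (N j + N k))"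

lemma pairsP_mem: "(j, k) \<in> pairsP \<Longrightarrow> j \<in> {1..8} \<and> k \<in> {1..8}"
  by (auto simp: pairsP_def)

text \<open>A pole of the prefactor forces a plus-pole and a minus-pole of the summand with
  \<open>n = - N k\<close> to coincide.\<close>

lemma prefactor_pole:
  assumes jk: "j \<in> {1..8}" "k \<in> {1..8}" and N: "index_ok N"
    and pole: "B j + B k \<in> gpoles 0 (N j + N k)"
  shows "- B k \<in> kern_poles B N (- N k) \<inter> uminus ` kern_poles B N (N k)"
proof -
  obtain i where i: "1 \<le> i" "i \<le> nat (- \<lfloor>N j + N k - 1\<rfloor>)" "B j + B k = of_nat i - 1"
    using pole unfolding gpoles_def by auto
  have "\<lfloor>N k + - N k - 1\<rfloor> = - 1" unfolding floor_eq_iff by simp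
  hence 1: "- B k \<in> gpoles (B k) (N k + - N k)" unfolding gpoles_def by simp
  have 2: "B k \<in> gpoles (B j) (N j + N k)"
    unfolding gpoles_def by (rule image_eqI[of _ _ i]) (use i in \<open>auto simp: algebra_simps\<close>)
  have "- B k \<in> kern_poles B N (- N k)" unfolding kern_poles_def by (rule UN_I[OF jk(2)], rule 1)
  moreover have "B k \<in> kern_poles B N (N k)" unfolding kern_poles_def by (rule UN_I[OF jk(1)], rule 2)
  ultimately show ?thesis by (simp add: mem_uminus_image)
qed

lemma coefficient_tendsto:
  fixes B :: "real \<Rightarrow> nat \<Rightarrow> complex"
  assumes cont: "\<And>k. k \<in> {1..8} \<Longrightarrow> continuous_on UNIV (\<lambda>t. B t k)"
    and np: "\<And>j k. (j, k) \<in> pairsP \<Longrightarrow> B 0 j + B 0 k \<notin> gpoles 0 (N j + N k)"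
  shows "((\<lambda>t. coefficient (B t) N) \<longlongrightarrow> coefficient (B 0) N) (at 0)"
proof -
  have "((\<lambda>t. gq (B t j + B t k) (N j + N k)) \<longlongrightarrow> gq (B 0 j + B 0 k) (N j + N k)) (at 0)"
    if jk: "(j, k) \<in> pairsP" for j k
  proof -
    have opn: "open (- gpoles 0 (N j + N k))" by (intro open_Compl finite_imp_closed) simp
    have "isCont (\<lambda>b. gq b (N j + N k)) (B 0 j + B 0 k)"
      using continuous_on_gq[of "N j + N k"] np[OF jk] unfolding continuous_on_eq_continuous_at[OF opn] by blast
    moreover have "((\<lambda>t. B t j + B t k) \<longlongrightarrow> B 0 j + B 0 k) (at 0)"
      using cont[of j] cont[of k] pairsP_mem[OF jk]
      by (intro tendsto_add) (auto simp: continuous_on_def)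
    ultimately show ?thesis by (rule isCont_tendsto_compose)
  qed
  thus ?thesis unfolding coefficient_def
    by (intro tendsto_mult tendsto_const tendsto_prod) auto
qed

text \<open>Both sides agree at the generic points of the curve, which accumulate at 0, and converge
  there. Disjointness of plus-poles and minus-poles is used for the two residue sums and, through
  \<open>prefactor_pole\<close>, for the prefactor.\<close>

lemma res_total_symmetry:
  assumes B: "(\<Sum>k\<in>{1..8}. B k) = - 2" and N: "index_ok N" "(\<Sum>k\<in>{1..8}. N k) = 4"
    and M: "index_ok (Mshift N)" "(\<Sum>k\<in>{1..8}. Mshift N k) = 4"
    and dN: "\<And>n. n \<in> coset (N 1) \<Longrightarrow> kern_poles B N n \<inter> uminus ` kern_poles B N (- n) = {}"
    and dM: "\<And>n. n \<in> coset (Mshift N 1) \<Longrightarrow>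
      kern_poles (refl_B B) (Mshift N) n \<inter> uminus ` kern_poles (refl_B B) (Mshift N) (- n) = {}"
  shows "res_total B N = coefficient B N * res_total (refl_B B) (Mshift N)"
proof -
  define C where "C = moment_curve B"
  have C0: "C 0 k = B k" if "k \<in> {1..8}" for k using that moment_curve_0[of k B] by (simp add: C_def)
  have cont: "continuous_on UNIV (\<lambda>t. C t k)" for k unfolding C_def by (rule continuous_moment_curve)
  have contR: "continuous_on UNIV (\<lambda>t. refl_B (C t) k)" for k
    unfolding refl_B_def by (cases "k \<le> 4") (auto intro!: continuous_intros cont)
  have R0: "refl_B (C 0) k = refl_B B k" if "k \<in> {1..8}" for k
    unfolding refl_B_def sum_1_4 using that C0 by simp
  have tot: "res_total (C 0) N = res_total B N" "res_total (refl_B (C 0)) (Mshift N) = res_total (refl_B B) (Mshift N)"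
    unfolding res_total_def by (intro sum.cong refl res_sum_cong, use C0 R0 in blast)+
  have np: "C 0 j + C 0 k \<notin> gpoles 0 (N j + N k)" if jk: "(j, k) \<in> pairsP" for j k
  proof
    have m: "j \<in> {1..8}" "k \<in> {1..8}" using pairsP_mem[OF jk] by auto
    assume "C 0 j + C 0 k \<in> gpoles 0 (N j + N k)"
    hence "B j + B k \<in> gpoles 0 (N j + N k)" using C0 m by simp
    from prefactor_pole[OF m N(1) this]
    have "- B k \<in> kern_poles B N (- N k) \<inter> uminus ` kern_poles B N (- (- N k))" by simp
    moreover have "- N k \<in> coset (N 1)"
    proof (rule coset_uminus)
      show "2 * N 1 \<in> \<int>" "N k \<in> coset (N 1)" using N(1) m by (auto simp: index_ok_def on_coset_def coset_def)
    qed
    ultimately show False using dN by blast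
  qed
  have coef: "coefficient (C 0) N = coefficient B N"
    unfolding coefficient_def prod_pairsP pairprod_def using C0 by simp
  define G where "G = {t. generic (C t)}"
  have nt: "\<not> trivial_limit (at (0::real) within G)"
    unfolding trivial_limit_within G_def C_def using generic_islimpt by simp
  have l1: "((\<lambda>t. res_total (C t) N) \<longlongrightarrow> res_total B N) (at 0)"
    unfolding tot(1)[symmetric]
    by (rule res_total_tendsto[OF cont N]) (use dN kern_poles_cong[OF C0] in auto)
  have l2: "((\<lambda>t. res_total (refl_B (C t)) (Mshift N)) \<longlongrightarrow> res_total (refl_B B) (Mshift N)) (at 0)"
    unfolding tot(2)[symmetric]
    by (rule res_total_tendsto[OF contR M]) (use dM kern_poles_cong[OF R0] in auto)
  have l3: "((\<lambda>t. coefficient (C t) N) \<longlongrightarrow> coefficient B N) (at 0)"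
    unfolding coef[symmetric] by (rule coefficient_tendsto[OF cont np])
  have "((\<lambda>t. coefficient (C t) N * res_total (refl_B (C t)) (Mshift N)) \<longlongrightarrow>
      coefficient B N * res_total (refl_B B) (Mshift N)) (at 0 within G)"
    using tendsto_mult[OF l3 l2] by (rule tendsto_within_subset) simp
  moreover have "eventually (\<lambda>t. coefficient (C t) N * res_total (refl_B (C t)) (Mshift N) = res_total (C t) N) (at 0 within G)"
    unfolding eventually_at_filter
  proof (rule always_eventually, intro allI impI)
    fix t assume "t \<noteq> 0" "t \<in> G"
    hence g: "generic (C t)" by (simp add: G_def)
    have s: "(\<Sum>k\<in>{1..8}. C t k) = - 2" using B unfolding C_def by (simp only: sum_moment_curve)
    show "coefficient (C t) N * res_total (refl_B (C t)) (Mshift N) = res_total (C t) N"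
      using generic_symmetry[OF g s N] val_eq_res_total[OF g N] val_eq_res_total[OF generic_refl_B[OF g] M]
      unfolding refl_val_def coefficient_def by simp
  qed
  ultimately have "((\<lambda>t. res_total (C t) N) \<longlongrightarrow> coefficient B N * res_total (refl_B B) (Mshift N)) (at 0 within G)"
    by (simp add: tendsto_cong)
  moreover have "((\<lambda>t. res_total (C t) N) \<longlongrightarrow> res_total B N) (at 0 within G)"
    using l1 by (rule tendsto_within_subset) simp
  ultimately show ?thesis by (rule tendsto_unique[OF nt, symmetric])
qed

theorem theorem2:
  fixes \<nu> \<mu> :: real and Nk :: "nat \<Rightarrow> real" and a :: "nat \<Rightarrow> complex"
    and \<gamma>N \<gamma>M :: "real \<Rightarrow> real \<Rightarrow> complex"
  assumes nu: "\<nu> \<in> {0, 1/2}"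
    and Nk_in: "\<forall>k\<in>{1..8::nat}. Nk k - \<nu> \<in> \<int>"
    and sumN: "(\<Sum>k\<in>{1..8::nat}. Nk k) = 4"
    and suma: "(\<Sum>k\<in>{1..8::nat}. a k) = 0"
    and mu: "\<mu> \<in> {0, 1/2}"
    and mu_even: "even \<lfloor>Lsum Nk\<rfloor> \<longrightarrow> \<mu> = \<nu>"
    and mu_odd: "odd \<lfloor>Lsum Nk\<rfloor> \<longrightarrow> \<mu> \<noteq> \<nu>"
    and contN: "\<forall>n. n - \<nu> \<in> \<int> \<longrightarrow>
                  sep_contour (\<gamma>N n) (plus_poles Nk a n) (minus_poles Nk a n)"
    and contM: "\<forall>m. m - \<mu> \<in> \<int> \<longrightarrow>
                  sep_contour (\<gamma>M m) (plus_poles (Mshift Nk) (sshift a) m)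
                                     (minus_poles (Mshift Nk) (sshift a) m)"
  shows "(\<Sum>\<^sub>\<infinity>n\<in>{n. n - \<nu> \<in> \<int>}. cint (integrand Nk a n) (\<gamma>N n)) =
         (-1) powi \<lfloor>Lsum Nk\<rfloor> *
         (\<Prod>(j, k)\<in>pairsP. pochR (1 + (a j + a k - of_real (Nk j) - of_real (Nk k)) / 2)
                                   (Nk j + Nk k - 1)) *
         (\<Sum>\<^sub>\<infinity>m\<in>{m. m - \<mu> \<in> \<int>}.
             cint (integrand (Mshift Nk) (sshift a) m) (\<gamma>M m))"
proof -
  define B where "B = half_diff a Nk"
  have "2 * \<nu> = 0 \<or> 2 * \<nu> = 1" "2 * \<mu> = 0 \<or> 2 * \<mu> = 1" using nu mu by auto
  hence two: "2 * \<nu> \<in> \<int>" "2 * \<mu> \<in> \<int>" by (metis Ints_0 Ints_1)+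
  have okN: "on_coset \<nu> Nk" using two Nk_in by (simp add: on_coset_def)
  have iN: "index_ok Nk" by (rule on_coset_index_ok[OF okN])
  have bl: "blocks 1 2 3 4 5 6 7 8" by (simp add: blocks_def)
  obtain l where l: "Lsum Nk = of_int l"
    using index_ok_block_sum(1)[OF bl iN] unfolding Lsum_def sum_1_4 by (auto elim: Ints_cases)
  have parity: "even l \<Longrightarrow> \<mu> = \<nu>" "odd l \<Longrightarrow> \<mu> \<noteq> \<nu>" using mu_even mu_odd by (simp_all add: l)
  \<comment> \<open>The parity conditions on \<mu> amount to this: \<mu> - \<nu> and L / 2 agree
    modulo the integers, which places the reflected indices in the coset of \<mu>.\<close>
  have "(\<mu> - \<nu>) - of_int l / 2 \<in> \<int>"
  proof (cases "even l")
    case True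
    then obtain r where "l = 2 * r" by (auto elim: evenE)
    thus ?thesis using parity(1)[OF True] by simp
  next
    case False
    then obtain r where r: "l = 2 * r + 1" by (auto elim: oddE)
    have "\<mu> - \<nu> = 1/2 \<or> \<mu> - \<nu> = - 1/2" using mu nu parity(2)[OF False] by auto
    hence "(\<mu> - \<nu>) - of_int l / 2 = of_int (- r) \<or> (\<mu> - \<nu>) - of_int l / 2 = of_int (- r - 1)"
      by (auto simp: r field_simps)
    thus ?thesis by (metis Ints_of_int)
  qed
  hence "- ((\<mu> - \<nu>) - of_int l / 2) \<in> \<int>" by (rule Ints_minus)
  hence mul: "\<nu> - \<mu> + of_int l / 2 \<in> \<int>" by (simp add: algebra_simps)
  have okM: "on_coset \<mu> (Mshift Nk)"
    unfolding on_coset_def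
  proof (intro conjI ballI)
    show "2 * \<mu> \<in> \<int>" by (rule two)
    fix k :: nat assume "k \<in> {1..8}"
    hence k: "Nk k - \<nu> \<in> \<int>" using Nk_in by blast
    have "Mshift Nk k - \<mu> = (Nk k - \<nu>) + (\<nu> - \<mu> + of_int l / 2) + of_int (if k \<le> 4 then 1 - l else - 1)"
      unfolding Mshift_def l by (simp add: field_simps)
    also have "\<dots> \<in> \<int>" by (intro Ints_add k mul Ints_of_int)
    finally show "Mshift Nk k - \<mu> \<in> \<int>" .
  qed
  have iM: "index_ok (Mshift Nk)" by (rule on_coset_index_ok[OF okM])
  have sumM: "(\<Sum>k\<in>{1..8}. Mshift Nk k) = 4"
    using sumN unfolding sum_1_8 Mshift_def by simp
  have cN: "coset (Nk 1) = coset \<nu>" and cM: "coset (Mshift Nk 1) = coset \<mu>"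
    using okN okM by (auto intro!: coset_cong simp: on_coset_def)
  have sumB: "(\<Sum>k\<in>{1..8}. B k) = - 2"
  proof -
    have "(\<Sum>k\<in>{1..8}. B k) = ((\<Sum>k\<in>{1..8}. a k) - of_real (\<Sum>k\<in>{1..8}. Nk k)) / 2"
      unfolding B_def half_diff_def by (simp add: sum_subtractf sum_divide_distrib[symmetric])
    thus ?thesis unfolding sumN suma by simp
  qed
  have reflB: "half_diff (sshift a) (Mshift Nk) = refl_B B"
  proof
    fix k
    have s: "(\<Sum>j\<in>{1..4}. B j) = ((\<Sum>j\<in>{1..4}. a j) - of_real (Lsum Nk)) / 2"
      unfolding B_def half_diff_def Lsum_def by (simp add: sum_subtractf sum_divide_distrib[symmetric])
    show "half_diff (sshift a) (Mshift Nk) k = refl_B B k"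
      unfolding refl_B_def s unfolding half_diff_def sshift_def Mshift_def Let_def B_def
      by (simp add: field_simps)
  qed
  \<comment> \<open>The contours enter the limit argument only here, through the separation of the
    two kinds of poles.\<close>
  have disjoint: "kern_poles (half_diff b K) K n \<inter> uminus ` kern_poles (half_diff b K) K (- n) = {}"
    if "sep_contour \<gamma> (plus_poles K b n) (minus_poles K b n)" for \<gamma> b K n
    using sep_contour_disjoint[OF that] unfolding plus_poles_eq minus_poles_eq by blast
  have "res_total B Nk = coefficient B Nk * res_total (refl_B B) (Mshift Nk)"
  proof (rule res_total_symmetry[OF sumB iN sumN iM sumM])
    show "kern_poles B Nk n \<inter> uminus ` kern_poles B Nk (- n) = {}" if "n \<in> coset (Nk 1)" for n
      using disjoint[of "\<gamma>N n" Nk a n] contN that[unfolded cN, unfolded coset_def] unfolding B_def by blast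
    show "kern_poles (refl_B B) (Mshift Nk) n \<inter> uminus ` kern_poles (refl_B B) (Mshift Nk) (- n) = {}"
      if "n \<in> coset (Mshift Nk 1)" for n
      using disjoint[of "\<gamma>M n" "Mshift Nk" "sshift a" n] contM that[unfolded cM, unfolded coset_def] unfolding reflB by blast
  qed
  moreover have "(\<Sum>\<^sub>\<infinity>n\<in>{n. n - \<nu> \<in> \<int>}. cint (integrand Nk a n) (\<gamma>N n)) = 16 * pi * \<i> * res_total B Nk"
  proof -
    have "(\<Sum>\<^sub>\<infinity>n\<in>coset \<nu>. cint (integrand Nk a n) (\<gamma>N n)) = (\<Sum>\<^sub>\<infinity>n\<in>coset \<nu>. 16 * pi * \<i> * res_sum B Nk n)"
      using contN unfolding B_def by (intro infsum_cong cint_integrand[OF okN _ sumN]) (auto simp: coset_def)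
    thus ?thesis unfolding res_total_eq_infsum[OF okN sumN] by (simp add: infsum_cmult_right' coset_def)
  qed
  moreover have "(\<Sum>\<^sub>\<infinity>m\<in>{m. m - \<mu> \<in> \<int>}. cint (integrand (Mshift Nk) (sshift a) m) (\<gamma>M m)) =
      16 * pi * \<i> * res_total (refl_B B) (Mshift Nk)"
  proof -
    have "(\<Sum>\<^sub>\<infinity>m\<in>coset \<mu>. cint (integrand (Mshift Nk) (sshift a) m) (\<gamma>M m)) =
        (\<Sum>\<^sub>\<infinity>m\<in>coset \<mu>. 16 * pi * \<i> * res_sum (refl_B B) (Mshift Nk) m)"
      using contM unfolding reflB[symmetric] by (intro infsum_cong cint_integrand[OF okM _ sumM]) (auto simp: coset_def)
    thus ?thesis unfolding res_total_eq_infsum[OF okM sumM] by (simp add: infsum_cmult_right' coset_def)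
  qed
  moreover have "(\<Prod>(j, k)\<in>pairsP. pochR (1 + (a j + a k - of_real (Nk j) - of_real (Nk k)) / 2) (Nk j + Nk k - 1)) =
      (\<Prod>(j, k)\<in>pairsP. gq (B j + B k) (Nk j + Nk k))"
  proof (intro prod.cong refl, clarify)
    fix j k
    have e: "(a j + a k - of_real (Nk j) - of_real (Nk k)) / 2 = B j + B k"
      unfolding B_def half_diff_def by (simp add: add_divide_distrib diff_divide_distrib)
    show "pochR (1 + (a j + a k - of_real (Nk j) - of_real (Nk k)) / 2) (Nk j + Nk k - 1) = gq (B j + B k) (Nk j + Nk k)"
      unfolding e gq_def by (rule refl)
  qed
  ultimately show ?thesis unfolding coefficient_def by (simp add: mult_ac)
qed

end
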